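(* Let $k$ be a field and let $\mathcal{C}$ be a Krull-Schmidt, Hom-finite, $k$-linear triangulated category. If $\mathcal{C}$ has a cluster tilting object, then $\mathcal{C}$ has a Serre functor.
   Context: Let $[1]$ be the shift functor of $\mathcal{C}$. An object $T\in\mathcal{C}$ is cluster tilting if $\mathrm{add}\,T=\{X\in\mathcal{C}\mid \mathrm{Hom}_{\mathcal{C}}(T,X[1])=0\}=\{X\in\mathcal{C}\mid \mathrm{Hom}_{\mathcal{C}}(X,T[1])=0\}$, where $\mathrm{add}\,T$ is the full subcategory of direct summands of finite direct sums of copies of $T$. A Serre functor is a $k$-linear autoequivalence $\mathbb{S}:\mathcal{C}\to\mathcal{C}$ with isomorphisms $\mathrm{Hom}_{\mathcal{C}}(X,Y)\cong \mathrm{Hom}_k(\mathrm{Hom}_{\mathcal{C}}(Y,\mathbb{S}X),k)$ natural in $X,Y$. *)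

theory Defs
  imports Complex_Main "HOL-Library.FuncSet"
begin

section \<open>Linear categories\<close>

text \<open>
  The objects are all elements of the type 'o. The hom spaces are subspaces of one ambient
  k-vector space 'm, and composition is one operation on 'm, about which nothing is assumed
  outside the hom spaces. Every small k-linear category has this form: let the ambient space be the
  direct sum of all hom spaces, with the product of non-composable morphisms equal to 0. Since a
  morphism does not determine its source and target (0 lies in every hom space), the action of a
  functor on morphisms takes the source and target as arguments.
\<close>

record ('k, 'o, 'm) lin_cat =
  Hom :: "'o \<Rightarrow> 'o \<Rightarrow> 'm set"
  Cmp :: "'m \<Rightarrow> 'm \<Rightarrow> 'm" (infixl \<open>\<cdot>\<index>\<close> 70)
  Idn :: "'o \<Rightarrow> 'm"
  Scl :: "'k \<Rightarrow> 'm \<Rightarrow> 'm"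

locale linear_category =
  fixes C :: "('k::field, 'o, 'm::ab_group_add, 'z) lin_cat_scheme" (structure)
  assumes vector_space: "vector_space (Scl C)"
    and subspace_Hom: "module.subspace (Scl C) (Hom C X Y)"
    and Idn_in_Hom: "Idn C X \<in> Hom C X X"
    and Cmp_in_Hom: "\<lbrakk>f \<in> Hom C X Y; g \<in> Hom C Y Z\<rbrakk> \<Longrightarrow> g \<cdot> f \<in> Hom C X Z"
    and Cmp_Idn_left: "f \<in> Hom C X Y \<Longrightarrow> Idn C Y \<cdot> f = f"
    and Cmp_Idn_right: "f \<in> Hom C X Y \<Longrightarrow> f \<cdot> Idn C X = f"
    and Cmp_assoc:
      "\<lbrakk>f \<in> Hom C W X; g \<in> Hom C X Y; h \<in> Hom C Y Z\<rbrakk> \<Longrightarrow> (h \<cdot> g) \<cdot> f = h \<cdot> (g \<cdot> f)"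
    and Cmp_add_right:
      "\<lbrakk>f \<in> Hom C X Y; f' \<in> Hom C X Y; g \<in> Hom C Y Z\<rbrakk> \<Longrightarrow> g \<cdot> (f + f') = g \<cdot> f + g \<cdot> f'"
    and Cmp_add_left:
      "\<lbrakk>f \<in> Hom C X Y; g \<in> Hom C Y Z; g' \<in> Hom C Y Z\<rbrakk> \<Longrightarrow> (g + g') \<cdot> f = g \<cdot> f + g' \<cdot> f"
    and Cmp_Scl_right:
      "\<lbrakk>f \<in> Hom C X Y; g \<in> Hom C Y Z\<rbrakk> \<Longrightarrow> g \<cdot> Scl C a f = Scl C a (g \<cdot> f)"
    and Cmp_Scl_left:
      "\<lbrakk>f \<in> Hom C X Y; g \<in> Hom C Y Z\<rbrakk> \<Longrightarrow> Scl C a g \<cdot> f = Scl C a (g \<cdot> f)"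

definition is_iso :: "('k, 'o, 'm, 'z) lin_cat_scheme \<Rightarrow> 'o \<Rightarrow> 'o \<Rightarrow> 'm \<Rightarrow> bool" where
  "is_iso C X Y f \<longleftrightarrow> f \<in> Hom C X Y \<and>
     (\<exists>g \<in> Hom C Y X. g \<cdot>\<^bsub>C\<^esub> f = Idn C X \<and> f \<cdot>\<^bsub>C\<^esub> g = Idn C Y)"

definition zero_object :: "('k, 'o, 'm, 'z) lin_cat_scheme \<Rightarrow> 'o \<Rightarrow> bool" where
  "zero_object C Z \<longleftrightarrow> (\<forall>X. (\<exists>!f. f \<in> Hom C X Z) \<and> (\<exists>!f. f \<in> Hom C Z X))"

text \<open>
  Y is the direct sum of the objects in the list Xs, with inclusions i and projections p.
  For the empty list this says that the identity of Y is 0, i.e. that Y is a zero object.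
\<close>

definition direct_sum ::
  "('k, 'o, 'm::ab_group_add, 'z) lin_cat_scheme \<Rightarrow> 'o list \<Rightarrow> 'o
     \<Rightarrow> (nat \<Rightarrow> 'm) \<Rightarrow> (nat \<Rightarrow> 'm) \<Rightarrow> bool" where
  "direct_sum C Xs Y i p \<longleftrightarrow>
     (\<forall>s < length Xs. i s \<in> Hom C (Xs ! s) Y \<and> p s \<in> Hom C Y (Xs ! s)) \<and>
     (\<forall>s < length Xs. \<forall>t < length Xs.
        p t \<cdot>\<^bsub>C\<^esub> i s = (if s = t then Idn C (Xs ! s) else 0)) \<and>
     (\<Sum>s < length Xs. i s \<cdot>\<^bsub>C\<^esub> p s) = Idn C Y"

definition has_finite_direct_sums ::
  "('k, 'o, 'm::ab_group_add, 'z) lin_cat_scheme \<Rightarrow> bool" where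
  "has_finite_direct_sums C \<longleftrightarrow> (\<forall>Xs. \<exists>Y i p. direct_sum C Xs Y i p)"

definition direct_summand ::
  "('k, 'o, 'm::ab_group_add, 'z) lin_cat_scheme \<Rightarrow> 'o \<Rightarrow> 'o \<Rightarrow> bool" where
  "direct_summand C X Y \<longleftrightarrow> (\<exists>X' i p. direct_sum C [X, X'] Y i p)"

definition add_objects ::
  "('k, 'o, 'm::ab_group_add, 'z) lin_cat_scheme \<Rightarrow> 'o \<Rightarrow> 'o set" where
  "add_objects C T =
     {X. \<exists>n Y i p. direct_sum C (replicate n T) Y i p \<and> direct_summand C X Y}"

definition hom_finite :: "('k::field, 'o, 'm::ab_group_add, 'z) lin_cat_scheme \<Rightarrow> bool" where
  "hom_finite C \<longleftrightarrow> (\<forall>X Y. \<exists>B. finite B \<and> module.span (Scl C) B = Hom C X Y)"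

text \<open>
  A ring is local if it is nonzero and the sum of two non-units is a non-unit.
\<close>

definition local_endomorphism_ring ::
  "('k, 'o, 'm::ab_group_add, 'z) lin_cat_scheme \<Rightarrow> 'o \<Rightarrow> bool" where
  "local_endomorphism_ring C X \<longleftrightarrow> Idn C X \<noteq> 0 \<and>
     (\<forall>f \<in> Hom C X X. \<forall>g \<in> Hom C X X.
        \<not> is_iso C X X f \<longrightarrow> \<not> is_iso C X X g \<longrightarrow> \<not> is_iso C X X (f + g))"

definition krull_schmidt :: "('k, 'o, 'm::ab_group_add, 'z) lin_cat_scheme \<Rightarrow> bool" where
  "krull_schmidt C \<longleftrightarrow> has_finite_direct_sums C \<and>
     (\<forall>Y. \<exists>Xs i p. direct_sum C Xs Y i p \<and> (\<forall>X \<in> set Xs. local_endomorphism_ring C X))"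


section \<open>Endofunctors\<close>

text \<open>FMor F X Y is the map from Hom X Y to Hom (F X) (F Y).\<close>

record ('o, 'm) endofunctor =
  FOb :: "'o \<Rightarrow> 'o"
  FMor :: "'o \<Rightarrow> 'o \<Rightarrow> 'm \<Rightarrow> 'm"

definition is_functor ::
  "('k, 'o, 'm, 'z) lin_cat_scheme \<Rightarrow> ('o, 'm) endofunctor \<Rightarrow> bool" where
  "is_functor C F \<longleftrightarrow>
     (\<forall>X Y. \<forall>f \<in> Hom C X Y. FMor F X Y f \<in> Hom C (FOb F X) (FOb F Y)) \<and>
     (\<forall>X. FMor F X X (Idn C X) = Idn C (FOb F X)) \<and>
     (\<forall>X Y Z. \<forall>f \<in> Hom C X Y. \<forall>g \<in> Hom C Y Z.
        FMor F X Z (g \<cdot>\<^bsub>C\<^esub> f) = FMor F Y Z g \<cdot>\<^bsub>C\<^esub> FMor F X Y f)"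

definition is_linear_functor ::
  "('k, 'o, 'm::ab_group_add, 'z) lin_cat_scheme \<Rightarrow> ('o, 'm) endofunctor \<Rightarrow> bool" where
  "is_linear_functor C F \<longleftrightarrow> is_functor C F \<and>
     (\<forall>X Y. \<forall>f \<in> Hom C X Y. \<forall>g \<in> Hom C X Y.
        FMor F X Y (f + g) = FMor F X Y f + FMor F X Y g) \<and>
     (\<forall>X Y a. \<forall>f \<in> Hom C X Y. FMor F X Y (Scl C a f) = Scl C a (FMor F X Y f))"

definition id_functor :: "('o, 'm) endofunctor" where
  "id_functor = \<lparr>FOb = (\<lambda>X. X), FMor = (\<lambda>X Y f. f)\<rparr>"

definition comp_functor ::
  "('o, 'm) endofunctor \<Rightarrow> ('o, 'm) endofunctor \<Rightarrow> ('o, 'm) endofunctor" where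
  "comp_functor G F = \<lparr>FOb = (\<lambda>X. FOb G (FOb F X)),
     FMor = (\<lambda>X Y f. FMor G (FOb F X) (FOb F Y) (FMor F X Y f))\<rparr>"

definition is_natural_iso ::
  "('k, 'o, 'm, 'z) lin_cat_scheme \<Rightarrow> ('o, 'm) endofunctor \<Rightarrow> ('o, 'm) endofunctor
     \<Rightarrow> ('o \<Rightarrow> 'm) \<Rightarrow> bool" where
  "is_natural_iso C F G \<eta> \<longleftrightarrow>
     (\<forall>X. is_iso C (FOb F X) (FOb G X) (\<eta> X)) \<and>
     (\<forall>X Y. \<forall>f \<in> Hom C X Y. \<eta> Y \<cdot>\<^bsub>C\<^esub> FMor F X Y f = FMor G X Y f \<cdot>\<^bsub>C\<^esub> \<eta> X)"

definition is_autoequivalence ::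
  "('k, 'o, 'm, 'z) lin_cat_scheme \<Rightarrow> ('o, 'm) endofunctor \<Rightarrow> bool" where
  "is_autoequivalence C F \<longleftrightarrow> is_functor C F \<and>
     (\<exists>G \<eta> \<epsilon>. is_functor C G \<and> is_natural_iso C (comp_functor G F) id_functor \<eta>
        \<and> is_natural_iso C (comp_functor F G) id_functor \<epsilon>)"


section \<open>Triangulated categories\<close>

text \<open>
  Dist C X Y Z u v w means that X -u-> Y -v-> Z -w-> X[1] is a distinguished triangle.
  The shift is only required to be an autoequivalence, not an automorphism.
\<close>

record ('k, 'o, 'm) tri_cat = "('k, 'o, 'm) lin_cat" +
  Shift :: "('o, 'm) endofunctor"
  Dist :: "'o \<Rightarrow> 'o \<Rightarrow> 'o \<Rightarrow> 'm \<Rightarrow> 'm \<Rightarrow> 'm \<Rightarrow> bool"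

abbreviation ShOb :: "('k, 'o, 'm, 'z) tri_cat_scheme \<Rightarrow> 'o \<Rightarrow> 'o" where
  "ShOb C \<equiv> FOb (Shift C)"

abbreviation ShMor :: "('k, 'o, 'm, 'z) tri_cat_scheme \<Rightarrow> 'o \<Rightarrow> 'o \<Rightarrow> 'm \<Rightarrow> 'm" where
  "ShMor C \<equiv> FMor (Shift C)"

locale triangulated_category = linear_category C
  for C :: "('k::field, 'o, 'm::ab_group_add, 'z) tri_cat_scheme" (structure) +
  assumes additive: "has_finite_direct_sums C"
    and linear_Shift: "is_linear_functor C (Shift C)"
    and autoequivalence_Shift: "is_autoequivalence C (Shift C)"
    and Dist_in_Hom:
      "Dist C X Y Z u v w \<Longrightarrow> u \<in> Hom C X Y \<and> v \<in> Hom C Y Z \<and> w \<in> Hom C Z (ShOb C X)"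
    and TR1_iso:
      "\<lbrakk>Dist C X Y Z u v w;
        u' \<in> Hom C X' Y'; v' \<in> Hom C Y' Z'; w' \<in> Hom C Z' (ShOb C X');
        is_iso C X X' a; is_iso C Y Y' b; is_iso C Z Z' c;
        u' \<cdot> a = b \<cdot> u; v' \<cdot> b = c \<cdot> v; w' \<cdot> c = ShMor C X X' a \<cdot> w\<rbrakk>
       \<Longrightarrow> Dist C X' Y' Z' u' v' w'"
    and TR1_Idn: "zero_object C Z \<Longrightarrow> Dist C X X Z (Idn C X) 0 0"
    and TR1_cone: "u \<in> Hom C X Y \<Longrightarrow> \<exists>Z v w. Dist C X Y Z u v w"
    and TR2:
      "\<lbrakk>u \<in> Hom C X Y; v \<in> Hom C Y Z; w \<in> Hom C Z (ShOb C X)\<rbrakk>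
       \<Longrightarrow> Dist C X Y Z u v w \<longleftrightarrow> Dist C Y Z (ShOb C X) v w (- ShMor C X Y u)"
    and TR3:
      "\<lbrakk>Dist C X Y Z u v w; Dist C X' Y' Z' u' v' w';
        a \<in> Hom C X X'; b \<in> Hom C Y Y'; u' \<cdot> a = b \<cdot> u\<rbrakk>
       \<Longrightarrow> \<exists>c \<in> Hom C Z Z'. v' \<cdot> b = c \<cdot> v \<and> w' \<cdot> c = ShMor C X X' a \<cdot> w"
    and TR4:
      "\<lbrakk>f \<in> Hom C X Y; g \<in> Hom C Y Z;
        Dist C X Y Z' f i i'; Dist C Y Z X' g j j'; Dist C X Z Y' (g \<cdot> f) k k'\<rbrakk>
       \<Longrightarrow> \<exists>u \<in> Hom C Z' Y'. \<exists>v \<in> Hom C Y' X'.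
             Dist C Z' Y' X' u v (ShMor C Y Z' i \<cdot> j') \<and>
             u \<cdot> i = k \<cdot> g \<and> k' \<cdot> u = i' \<and> v \<cdot> k = j \<and> j' \<cdot> v = ShMor C X Y f \<cdot> k'"

definition cluster_tilting ::
  "('k, 'o, 'm::ab_group_add, 'z) tri_cat_scheme \<Rightarrow> 'o \<Rightarrow> bool" where
  "cluster_tilting C T \<longleftrightarrow>
     add_objects C T = {X. Hom C T (ShOb C X) = {0}} \<and>
     add_objects C T = {X. Hom C X (ShOb C T) = {0}}"


section \<open>Serre functors\<close>

text \<open>
  The k-linear functionals on the subspace V; being extensional, they are determined by their
  values on V.
\<close>

definition dual_space ::
  "('k::field \<Rightarrow> 'm::ab_group_add \<Rightarrow> 'm) \<Rightarrow> 'm set \<Rightarrow> ('m \<Rightarrow> 'k) set" where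
  "dual_space scale V = {\<phi> \<in> extensional V.
     (\<forall>x \<in> V. \<forall>y \<in> V. \<phi> (x + y) = \<phi> x + \<phi> y) \<and>
     (\<forall>a. \<forall>x \<in> V. \<phi> (scale a x) = a * \<phi> x)}"

text \<open>
  \<eta> X Y is the isomorphism from Hom X Y to the dual of Hom Y (S X). The last two conditions are
  naturality in Y and in X.
\<close>

definition serre_duality ::
  "('k::field, 'o, 'm::ab_group_add, 'z) lin_cat_scheme \<Rightarrow> ('o, 'm) endofunctor
     \<Rightarrow> ('o \<Rightarrow> 'o \<Rightarrow> 'm \<Rightarrow> 'm \<Rightarrow> 'k) \<Rightarrow> bool" where
  "serre_duality C S \<eta> \<longleftrightarrow>
     (\<forall>X Y. bij_betw (\<eta> X Y) (Hom C X Y) (dual_space (Scl C) (Hom C Y (FOb S X)))) \<and>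
     (\<forall>X Y. \<forall>f \<in> Hom C X Y. \<forall>g \<in> Hom C X Y. \<forall>h \<in> Hom C Y (FOb S X).
        \<eta> X Y (f + g) h = \<eta> X Y f h + \<eta> X Y g h) \<and>
     (\<forall>X Y a. \<forall>f \<in> Hom C X Y. \<forall>h \<in> Hom C Y (FOb S X).
        \<eta> X Y (Scl C a f) h = a * \<eta> X Y f h) \<and>
     (\<forall>X Y Y'. \<forall>f \<in> Hom C X Y. \<forall>b \<in> Hom C Y Y'. \<forall>h \<in> Hom C Y' (FOb S X).
        \<eta> X Y' (b \<cdot>\<^bsub>C\<^esub> f) h = \<eta> X Y f (h \<cdot>\<^bsub>C\<^esub> b)) \<and>
     (\<forall>X X' Y. \<forall>f \<in> Hom C X Y. \<forall>a \<in> Hom C X' X. \<forall>h \<in> Hom C Y (FOb S X').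
        \<eta> X' Y (f \<cdot>\<^bsub>C\<^esub> a) h = \<eta> X Y f (FMor S X' X a \<cdot>\<^bsub>C\<^esub> h))"

definition serre_functor ::
  "('k::field, 'o, 'm::ab_group_add, 'z) lin_cat_scheme \<Rightarrow> ('o, 'm) endofunctor \<Rightarrow> bool" where
  "serre_functor C S \<longleftrightarrow>
     is_linear_functor C S \<and> is_autoequivalence C S \<and> (\<exists>\<eta>. serre_duality C S \<eta>)"

end

theory Submission
  imports Defs
begin

text \<open>
  Write \<open>D\<close> for the \<open>k\<close>-dual and \<open>add P\<close> for the objects that are retracts of finite sums of
  copies of \<open>P\<close>. A Serre functor exists as soon as each functor \<open>D Hom(X,-)\<close> is representable, by
  an object \<open>S X\<close>, and each functor \<open>D Hom(-,X)\<close> is corepresentable. Indeed, the representing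
  pairing \<open>Hom(X,Y) \<times> Hom(Y,S X) \<rightarrow> k\<close> is perfect, because the hom spaces are finite-dimensional
  (\<open>perfect_pairing_transpose\<close>); it makes \<open>S\<close> a fully faithful linear functor, and
  corepresentability makes \<open>S\<close> essentially surjective (\<open>represented_duals\<close>).

  Representability is a Brown type theorem. A form \<open>\<xi>\<close> on \<open>Hom(X,A)\<close> is the same as a natural
  transformation \<open>Hom(-,A) \<rightarrow> D Hom(X,-)\<close>, and \<open>D Hom(X,-)\<close> turns the exact pairs of a triangle
  into exact sequences (\<open>form_extend\<close>). Starting with some \<open>(A0,\<xi>0)\<close> whose transformation is onto
  at \<open>P = T\<close> and at \<open>Q = T[1]\<close>, one passes repeatedly to the cone of a morphism into \<open>A\<close> that
  covers the kernel of the transformation at \<open>P\<close> or at \<open>Q\<close> (\<open>kernel_killing\<close>). For a general Brown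
  theorem this must be iterated infinitely often. Here a cluster tilting object generates in one
  step: every \<open>Y\<close> sits in an exact sequence \<open>T1 \<rightarrow> T0 \<rightarrow> Y \<rightarrow> Q1 \<rightarrow> Q0\<close> with \<open>T1\<close>, \<open>T0\<close> in \<open>add P\<close> and
  \<open>Q1\<close>, \<open>Q0\<close> in \<open>add Q\<close>. Hence, by two four-lemma type chases, one step yields a pair \<open>(A1,\<xi>1)\<close>
  that is onto at every object (\<open>onto_everywhere\<close>), and two further steps kill its kernel at every
  object (\<open>kernel_killed_everywhere\<close>). This exhibits \<open>D Hom(X,-)\<close> as a direct summand of
  \<open>Hom(-,A3)\<close>, cut out by an idempotent, which splits because the category is Krull-Schmidt
  (\<open>krull_schmidt_idempotent_complete\<close>).

  The hypotheses of this argument are collected in the locale \<open>resolved_category\<close> in terms of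
  exact pairs of morphisms, a self-dual notion. They hold in the category with \<open>P = T\<close>, \<open>Q = T[1]\<close>
  by right approximations, and in its opposite with \<open>P = T\<close>, \<open>Q = T[-1]\<close> by left approximations.
  So the same theorem gives both representability statements.
\<close>

section \<open>Linear forms on subspaces\<close>

text \<open>
  The condition in \<^const>\<open>dual_space\<close> without extensionality: values outside the subspace are ignored,
  so that composing a form with a morphism gives a form without a restriction in between.
\<close>

definition linear_form ::
  "('k::field \<Rightarrow> 'm::ab_group_add \<Rightarrow> 'm) \<Rightarrow> 'm set \<Rightarrow> ('m \<Rightarrow> 'k) \<Rightarrow> bool" where
  "linear_form scale V \<phi> \<longleftrightarrow>
     (\<forall>x\<in>V. \<forall>y\<in>V. \<phi> (x + y) = \<phi> x + \<phi> y) \<and> (\<forall>a. \<forall>x\<in>V. \<phi> (scale a x) = a * \<phi> x)"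

lemma linear_formI:
  assumes "\<And>x y. \<lbrakk>x \<in> V; y \<in> V\<rbrakk> \<Longrightarrow> \<phi> (x + y) = \<phi> x + \<phi> y"
    and "\<And>a x. x \<in> V \<Longrightarrow> \<phi> (scale a x) = a * \<phi> x"
  shows "linear_form scale V \<phi>"
  using assms by (simp add: linear_form_def)

lemma linear_form_add: "\<lbrakk>linear_form scale V \<phi>; x \<in> V; y \<in> V\<rbrakk> \<Longrightarrow> \<phi> (x + y) = \<phi> x + \<phi> y"
  by (simp add: linear_form_def)

lemma linear_form_scale: "\<lbrakk>linear_form scale V \<phi>; x \<in> V\<rbrakk> \<Longrightarrow> \<phi> (scale a x) = a * \<phi> x"
  by (simp add: linear_form_def)

lemma linear_form_minus:
  assumes "linear_form scale V \<phi>" "linear_form scale V \<psi>"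
  shows "linear_form scale V (\<lambda>x. \<phi> x - \<psi> x)"
  using assms by (auto simp: linear_form_def algebra_simps)

lemma linear_form_sum:
  assumes "\<And>s. s \<in> I \<Longrightarrow> linear_form scale V (\<phi> s)"
  shows "linear_form scale V (\<lambda>x. \<Sum>s\<in>I. \<phi> s x)"
  using assms by (auto simp: linear_form_def sum.distrib sum_distrib_left intro!: sum.cong)

context vector_space
begin

lemma linear_form_zero:
  assumes "subspace V" "linear_form scale V \<phi>"
  shows "\<phi> 0 = 0"
  using linear_form_scale[OF assms(2) subspace_0[OF assms(1)], of 0] by simp

lemma linear_form_diff:
  assumes "subspace V" "linear_form scale V \<phi>" "x \<in> V" "y \<in> V"
  shows "\<phi> (x - y) = \<phi> x - \<phi> y"
proof -
  have "\<phi> ((x - y) + y) = \<phi> (x - y) + \<phi> y"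
    using assms by (intro linear_form_add[OF assms(2)]) (auto simp: subspace_diff)
  then show ?thesis by simp
qed

lemma linear_form_sum_arg:
  assumes "subspace V" "linear_form scale V \<phi>" "\<And>s. s \<in> I \<Longrightarrow> x s \<in> V"
  shows "\<phi> (\<Sum>s\<in>I. x s) = (\<Sum>s\<in>I. \<phi> (x s))"
  using assms(3)
proof (induction I rule: infinite_finite_induct)
  case (insert s I)
  have "\<phi> (x s + (\<Sum>s\<in>I. x s)) = \<phi> (x s) + \<phi> (\<Sum>s\<in>I. x s)"
    using insert by (intro linear_form_add[OF assms(2)] subspace_sum[OF assms(1)]) auto
  then show ?case using insert by simp
qed (simp_all add: linear_form_zero[OF assms(1,2)])

lemma subspace_finite_basis:
  assumes "finite B0" "V \<subseteq> span B0"
  obtains B where "finite B" "independent B" "B \<subseteq> V" "V \<subseteq> span B"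
proof -
  obtain B where B: "B \<subseteq> V" "independent B" "V \<subseteq> span B"
    using maximal_independent_subset by blast
  moreover have "finite B"
    using independent_span_bound[OF assms(1) B(2)] B(1) assms(2) by blast
  ultimately show ?thesis using that by blast
qed

lemma linear_form_representation:
  assumes "subspace V" "linear_form scale V \<phi>" "independent B" "finite B" "B \<subseteq> V" "x \<in> span B"
  shows "\<phi> x = (\<Sum>b\<in>B. representation B x b * \<phi> b)"
proof -
  have "x = (\<Sum>b\<in>B. scale (representation B x b) b)"
    using sum_representation_eq[OF assms(3,6,4) order.refl] by simp
  then have "\<phi> x = \<phi> (\<Sum>b\<in>B. scale (representation B x b) b)" by simp
  also have "\<dots> = (\<Sum>b\<in>B. \<phi> (scale (representation B x b) b))"
    using assms by (intro linear_form_sum_arg[OF assms(1,2)]) (auto simp: subspace_scale)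
  also have "\<dots> = (\<Sum>b\<in>B. representation B x b * \<phi> b)"
    using assms by (intro sum.cong) (auto intro: linear_form_scale)
  finally show ?thesis .
qed

lemma representation_linear_form:
  assumes "independent B" "V \<subseteq> span B"
  shows "linear_form scale V (\<lambda>x. representation B x b)"
  using assms
  by (intro linear_formI) (simp_all add: representation_add representation_scale subset_iff)

text \<open>
  This is the exactness of dualization. On a basis of the image of \<open>L\<close> the form \<open>\<psi>\<close> is prescribed
  by choosing preimages, and it is extended linearly to the ambient space.
\<close>

lemma linear_form_factor:
  assumes V: "subspace V" and \<phi>: "linear_form scale V \<phi>"
    and L_add: "\<And>x y. \<lbrakk>x \<in> V; y \<in> V\<rbrakk> \<Longrightarrow> L (x + y) = L x + L y"
    and L_scale: "\<And>a x. x \<in> V \<Longrightarrow> L (scale a x) = scale a (L x)"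
    and ker: "\<And>x. \<lbrakk>x \<in> V; L x = 0\<rbrakk> \<Longrightarrow> \<phi> x = 0"
  obtains \<psi> where "linear_form scale UNIV \<psi>" "\<And>x. x \<in> V \<Longrightarrow> \<psi> (L x) = \<phi> x"
proof -
  interpret k: vector_space "(*) :: 'a \<Rightarrow> 'a \<Rightarrow> 'a"
    by unfold_locales (simp_all add: algebra_simps)
  interpret p: vector_space_pair scale "(*) :: 'a \<Rightarrow> 'a \<Rightarrow> 'a" ..
  obtain B where B: "B \<subseteq> L ` V" "independent B" "L ` V \<subseteq> span B"
    using maximal_independent_subset by blast
  obtain r where r: "\<And>b. b \<in> B \<Longrightarrow> r b \<in> V" "\<And>b. b \<in> B \<Longrightarrow> L (r b) = b"
  proof
    show "inv_into V L b \<in> V" if "b \<in> B" for b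
      using that B(1) by (auto intro: inv_into_into)
    show "L (inv_into V L b) = b" if "b \<in> B" for b
      using that B(1) by (auto intro: f_inv_into_f)
  qed
  obtain \<psi> where \<psi>: "Vector_Spaces.linear scale (*) \<psi>" "\<forall>b\<in>B. \<psi> b = \<phi> (r b)"
    using p.linear_independent_extend[OF B(2), of "\<lambda>b. \<phi> (r b)"] by blast
  interpret l: Vector_Spaces.linear scale "(*)" \<psi> by (rule \<psi>(1))
  have L_sum: "L (\<Sum>s\<in>I. x s) = (\<Sum>s\<in>I. L (x s))"
    if "finite I" "\<And>s. s \<in> I \<Longrightarrow> x s \<in> V" for I :: "'b set" and x
    using that
  proof (induction I)
    case empty
    show ?case using L_scale[OF subspace_0[OF V], of 0] by simp
  next
    case (insert s I)
    then show ?case using L_add[of "x s" "\<Sum>s\<in>I. x s"] subspace_sum[OF V, of I x] by simp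
  qed
  show thesis
  proof (rule that)
    show "linear_form scale UNIV \<psi>"
      by (intro linear_formI) (simp_all add: l.add l.scale)
    fix x assume x: "x \<in> V"
    let ?c = "representation B (L x)"
    let ?S = "{b. ?c b \<noteq> 0}"
    have S: "finite ?S" "?S \<subseteq> B"
      using finite_representation representation_ne_zero by auto
    have Lx: "L x = (\<Sum>b\<in>?S. scale (?c b) b)"
      using sum_nonzero_representation_eq[OF B(2), of "L x"] B(3) x by auto
    let ?y = "\<Sum>b\<in>?S. scale (?c b) (r b)"
    have terms: "scale (?c b) (r b) \<in> V" if "b \<in> ?S" for b
      using that S(2) r(1) V by (auto intro: subspace_scale)
    have y: "?y \<in> V" using terms by (intro subspace_sum[OF V]) auto
    have "L ?y = (\<Sum>b\<in>?S. L (scale (?c b) (r b)))" using L_sum[OF S(1)] terms by auto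
    also have "\<dots> = (\<Sum>b\<in>?S. scale (?c b) b)"
      using S(2) r by (intro sum.cong) (auto simp: L_scale)
    finally have "L ?y = L x" using Lx by simp
    moreover have "L x = L (x - ?y) + L ?y"
      using L_add[of "x - ?y" ?y] x y V by (simp add: subspace_diff)
    ultimately have "\<phi> (x - ?y) = 0" using ker x y V by (auto simp: subspace_diff)
    then have "\<phi> x = \<phi> ?y" using linear_form_diff[OF V \<phi> x y] by simp
    also have "\<dots> = (\<Sum>b\<in>?S. \<phi> (scale (?c b) (r b)))"
      using terms by (intro linear_form_sum_arg[OF V \<phi>]) auto
    also have "\<dots> = (\<Sum>b\<in>?S. ?c b * \<psi> b)"
      using S(2) \<psi>(2) r(1) by (intro sum.cong) (auto simp: linear_form_scale[OF \<phi>])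
    also have "\<dots> = \<psi> (L x)" by (subst Lx) (simp add: l.sum l.scale)
    finally show "\<psi> (L x) = \<phi> x" by simp
  qed
qed

text \<open>
  The elements \<open>d b\<close> of \<open>W\<close> that correspond to the coordinate forms of a basis of \<open>V\<close> span \<open>W\<close>, so
  the two bases are dual to each other, and the two spaces play symmetric roles. This is where
  finite dimension of the hom spaces enters Serre duality.
\<close>

lemma perfect_pairing_transpose:
  assumes V: "subspace V" "finite B0" "V \<subseteq> span B0" and W: "subspace W"
    and left: "\<And>w. w \<in> W \<Longrightarrow> linear_form scale V (\<lambda>v. \<beta> v w)"
    and right: "\<And>v. v \<in> V \<Longrightarrow> linear_form scale W (\<beta> v)"
    and onto: "\<And>\<phi>. linear_form scale V \<phi> \<Longrightarrow> \<exists>w\<in>W. \<forall>v\<in>V. \<phi> v = \<beta> v w"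
    and inj: "\<And>w. \<lbrakk>w \<in> W; \<forall>v\<in>V. \<beta> v w = 0\<rbrakk> \<Longrightarrow> w = 0"
  shows "\<And>\<psi>. linear_form scale W \<psi> \<Longrightarrow> \<exists>v\<in>V. \<forall>w\<in>W. \<psi> w = \<beta> v w"
    and "\<And>v. \<lbrakk>v \<in> V; \<forall>w\<in>W. \<beta> v w = 0\<rbrakk> \<Longrightarrow> v = 0"
proof -
  obtain B where B: "finite B" "independent B" "B \<subseteq> V" "V \<subseteq> span B"
    using subspace_finite_basis[OF V(2,3)] by blast
  let ?r = "representation B"
  have "\<exists>w\<in>W. \<forall>v\<in>V. ?r v b = \<beta> v w" for b
    using onto[OF representation_linear_form[OF B(2,4)]] .
  then obtain d where d: "\<And>b. d b \<in> W" "\<And>b v. v \<in> V \<Longrightarrow> ?r v b = \<beta> v (d b)" by metis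
  have expand: "w = (\<Sum>b\<in>B. scale (\<beta> b w) (d b))" if w: "w \<in> W" for w
  proof -
    have terms: "scale (\<beta> b w) (d b) \<in> W" for b using d(1) W by (simp add: subspace_scale)
    have sum: "(\<Sum>b\<in>B. scale (\<beta> b w) (d b)) \<in> W" by (intro subspace_sum[OF W] terms)
    have "\<beta> v (w - (\<Sum>b\<in>B. scale (\<beta> b w) (d b))) = 0" if v: "v \<in> V" for v
    proof -
      have "\<beta> v (\<Sum>b\<in>B. scale (\<beta> b w) (d b)) = (\<Sum>b\<in>B. \<beta> v (scale (\<beta> b w) (d b)))"
        by (intro linear_form_sum_arg[OF W right[OF v]] terms)
      also have "\<dots> = (\<Sum>b\<in>B. ?r v b * \<beta> b w)"
        by (intro sum.cong) (auto simp: linear_form_scale[OF right[OF v] d(1)] d(2)[OF v])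
      also have "\<dots> = \<beta> v w"
        using linear_form_representation[OF V(1) left[OF w] B(2,1,3)] B(4) v by auto
      finally show ?thesis using linear_form_diff[OF W right[OF v] w sum] by simp
    qed
    then show ?thesis using inj[of "w - (\<Sum>b\<in>B. scale (\<beta> b w) (d b))"] w sum W
      by (auto simp: subspace_diff)
  qed
  show "\<exists>v\<in>V. \<forall>w\<in>W. \<psi> w = \<beta> v w" if \<psi>: "linear_form scale W \<psi>" for \<psi>
  proof (intro bexI ballI)
    let ?v = "\<Sum>b\<in>B. scale (\<psi> (d b)) b"
    have terms: "scale (\<psi> (d b)) b \<in> V" if "b \<in> B" for b
      using that B(3) V(1) by (auto intro: subspace_scale)
    show "?v \<in> V" using terms by (intro subspace_sum[OF V(1)]) auto
    fix w assume w: "w \<in> W"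
    have "\<psi> w = \<psi> (\<Sum>b\<in>B. scale (\<beta> b w) (d b))" using expand[OF w] by simp
    also have "\<dots> = (\<Sum>b\<in>B. \<psi> (scale (\<beta> b w) (d b)))"
      using d(1) W by (intro linear_form_sum_arg[OF W \<psi>]) (auto simp: subspace_scale)
    also have "\<dots> = (\<Sum>b\<in>B. \<beta> (scale (\<psi> (d b)) b) w)"
      using B(3) d(1)
      by (intro sum.cong) (auto simp: linear_form_scale[OF \<psi>] linear_form_scale[OF left[OF w]])
    also have "\<dots> = \<beta> ?v w"
      using linear_form_sum_arg[OF V(1) left[OF w], of B "\<lambda>b. scale (\<psi> (d b)) b"] terms by simp
    finally show "\<psi> w = \<beta> ?v w" .
  qed
  show "v = 0" if v: "v \<in> V" "\<forall>w\<in>W. \<beta> v w = 0" for v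
  proof -
    have "?r v b = 0" for b using d v by simp
    moreover have "(\<Sum>b\<in>B. scale (?r v b) b) = v"
      using sum_representation_eq[OF B(2) _ B(1) order.refl] v(1) B(4) by auto
    ultimately show ?thesis by simp
  qed
qed

end

section \<open>Linear categories\<close>

context linear_category
begin

sublocale vs: vector_space "Scl C"
  by (rule vector_space)

lemma zero_in_Hom [simp]: "0 \<in> Hom C X Y"
  using subspace_Hom by (rule vs.subspace_0)

lemma add_in_Hom: "\<lbrakk>f \<in> Hom C X Y; g \<in> Hom C X Y\<rbrakk> \<Longrightarrow> f + g \<in> Hom C X Y"
  using subspace_Hom by (rule vs.subspace_add)

lemma diff_in_Hom: "\<lbrakk>f \<in> Hom C X Y; g \<in> Hom C X Y\<rbrakk> \<Longrightarrow> f - g \<in> Hom C X Y"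
  using subspace_Hom by (rule vs.subspace_diff)

lemma uminus_in_Hom: "f \<in> Hom C X Y \<Longrightarrow> - f \<in> Hom C X Y"
  using subspace_Hom by (rule vs.subspace_neg)

lemma Scl_in_Hom: "f \<in> Hom C X Y \<Longrightarrow> Scl C a f \<in> Hom C X Y"
  using subspace_Hom by (rule vs.subspace_scale)

lemma sum_in_Hom: "(\<And>s. s \<in> I \<Longrightarrow> f s \<in> Hom C X Y) \<Longrightarrow> (\<Sum>s\<in>I. f s) \<in> Hom C X Y"
  using subspace_Hom by (rule vs.subspace_sum)

lemma Cmp_zero_right: "g \<in> Hom C Y Z \<Longrightarrow> g \<cdot> 0 = 0"
  using Cmp_Scl_right[OF zero_in_Hom, of g Y Z 0] by simp

lemma Cmp_zero_left: "f \<in> Hom C X Y \<Longrightarrow> 0 \<cdot> f = 0"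
  using Cmp_Scl_left[OF _ zero_in_Hom, of f X Y 0] by simp

lemma Cmp_diff_right:
  assumes "f \<in> Hom C X Y" "f' \<in> Hom C X Y" "g \<in> Hom C Y Z"
  shows "g \<cdot> (f - f') = g \<cdot> f - g \<cdot> f'"
  using Cmp_add_right[OF diff_in_Hom[OF assms(1,2)] assms(2,3)] by simp

lemma Cmp_diff_left:
  assumes "f \<in> Hom C X Y" "g \<in> Hom C Y Z" "g' \<in> Hom C Y Z"
  shows "(g - g') \<cdot> f = g \<cdot> f - g' \<cdot> f"
  using Cmp_add_left[OF assms(1) diff_in_Hom[OF assms(2,3)] assms(3)] by simp

lemma Cmp_uminus_right:
  assumes "f \<in> Hom C X Y" "g \<in> Hom C Y Z"
  shows "g \<cdot> (- f) = - (g \<cdot> f)"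
  using Cmp_diff_right[OF zero_in_Hom assms] Cmp_zero_right[OF assms(2)] by simp

lemma Cmp_uminus_left:
  assumes "f \<in> Hom C X Y" "g \<in> Hom C Y Z"
  shows "(- g) \<cdot> f = - (g \<cdot> f)"
  using Cmp_diff_left[OF assms(1) zero_in_Hom assms(2)] Cmp_zero_left[OF assms(1)] by simp

lemma Cmp_sum_right:
  assumes g: "g \<in> Hom C Y Z" and f: "\<And>s. s \<in> I \<Longrightarrow> f s \<in> Hom C X Y"
  shows "g \<cdot> (\<Sum>s\<in>I. f s) = (\<Sum>s\<in>I. g \<cdot> f s)"
  using f
proof (induction I rule: infinite_finite_induct)
  case (insert s I)
  then show ?case
    using Cmp_add_right[OF _ sum_in_Hom g, of "f s" X I f] by simp
qed (simp_all add: Cmp_zero_right[OF g])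

lemma Cmp_sum_left:
  assumes f: "f \<in> Hom C X Y" and g: "\<And>s. s \<in> I \<Longrightarrow> g s \<in> Hom C Y Z"
  shows "(\<Sum>s\<in>I. g s) \<cdot> f = (\<Sum>s\<in>I. g s \<cdot> f)"
  using g
proof (induction I rule: infinite_finite_induct)
  case (insert s I)
  then show ?case
    using Cmp_add_left[OF f _ sum_in_Hom, of "g s" Z I g] by simp
qed (simp_all add: Cmp_zero_left[OF f])

lemma is_iso_Idn: "is_iso C X X (Idn C X)"
  unfolding is_iso_def using Idn_in_Hom Cmp_Idn_left by blast

lemma is_isoE:
  assumes "is_iso C X Y f"
  obtains g where "f \<in> Hom C X Y" "g \<in> Hom C Y X" "g \<cdot> f = Idn C X" "f \<cdot> g = Idn C Y"
  using assms unfolding is_iso_def by blast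

lemma zero_object_iff: "zero_object C Z \<longleftrightarrow> Idn C Z = 0"
proof
  show "Idn C Z = 0" if "zero_object C Z"
    using that Idn_in_Hom[of Z] zero_in_Hom unfolding zero_object_def by metis
next
  assume Z: "Idn C Z = 0"
  have "f = 0" if "f \<in> Hom C X Z" for f X
    using Cmp_Idn_left[OF that] Cmp_zero_left[OF that] Z by simp
  moreover have "f = 0" if "f \<in> Hom C Z X" for f X
    using Cmp_Idn_right[OF that] Cmp_zero_right[OF that] Z by simp
  ultimately show "zero_object C Z" unfolding zero_object_def using zero_in_Hom by metis
qed

lemma Hom_to_zero_object:
  assumes "zero_object C Z" "f \<in> Hom C X Z"
  shows "f = 0"
  using assms zero_in_Hom unfolding zero_object_def by metis

lemma zero_object_exists:
  assumes "has_finite_direct_sums C"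
  obtains Z where "zero_object C Z"
proof -
  obtain Z i p where "direct_sum C [] Z i p"
    using assms unfolding has_finite_direct_sums_def by blast
  then show ?thesis using that unfolding direct_sum_def zero_object_iff by simp
qed

lemma direct_sumD:
  assumes "direct_sum C Xs Y i p"
  shows "s < length Xs \<Longrightarrow> i s \<in> Hom C (Xs ! s) Y"
    and "s < length Xs \<Longrightarrow> p s \<in> Hom C Y (Xs ! s)"
    and "s < length Xs \<Longrightarrow> p s \<cdot> i s = Idn C (Xs ! s)"
    and "\<lbrakk>s < length Xs; t < length Xs; s \<noteq> t\<rbrakk> \<Longrightarrow> p t \<cdot> i s = 0"
    and "(\<Sum>s<length Xs. i s \<cdot> p s) = Idn C Y"
  using assms unfolding direct_sum_def by auto

lemma direct_sum_cotuple:
  assumes "direct_sum C Xs Y i p" and f: "\<And>s. s < length Xs \<Longrightarrow> f s \<in> Hom C (Xs ! s) Z"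
  obtains g where "g \<in> Hom C Y Z" "\<And>s. s < length Xs \<Longrightarrow> g \<cdot> i s = f s"
proof
  note D = direct_sumD[OF assms(1)]
  let ?g = "\<Sum>t<length Xs. f t \<cdot> p t"
  have fp: "f t \<cdot> p t \<in> Hom C Y Z" if "t < length Xs" for t
    using that f D(2) Cmp_in_Hom by blast
  show "?g \<in> Hom C Y Z" using fp by (intro sum_in_Hom) auto
  fix s assume s: "s < length Xs"
  have "?g \<cdot> i s = (\<Sum>t<length Xs. (f t \<cdot> p t) \<cdot> i s)"
    using fp by (intro Cmp_sum_left[OF D(1)[OF s]]) auto
  also have "\<dots> = (\<Sum>t<length Xs. if t = s then f s else 0)"
  proof (intro sum.cong refl)
    fix t assume "t \<in> {..<length Xs}"
    then have t: "t < length Xs" by simp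
    have "(f t \<cdot> p t) \<cdot> i s = f t \<cdot> (p t \<cdot> i s)"
      by (rule Cmp_assoc[OF D(1)[OF s] D(2)[OF t] f[OF t]])
    then show "(f t \<cdot> p t) \<cdot> i s = (if t = s then f s else 0)"
      using D(3)[OF s] D(4)[OF s t] Cmp_Idn_right[OF f[OF s]] Cmp_zero_right[OF f[OF t]] by auto
  qed
  also have "\<dots> = f s" using s by simp
  finally show "?g \<cdot> i s = f s" .
qed

end

definition op_cat :: "('k, 'o, 'm, 'z) lin_cat_scheme \<Rightarrow> ('k, 'o, 'm) lin_cat" where
  "op_cat C = \<lparr>Hom = (\<lambda>X Y. Hom C Y X), Cmp = (\<lambda>g f. Cmp C f g), Idn = Idn C, Scl = Scl C\<rparr>"

lemma op_cat_simps [simp]: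
  "Hom (op_cat C) X Y = Hom C Y X" "Cmp (op_cat C) g f = Cmp C f g"
  "Idn (op_cat C) = Idn C" "Scl (op_cat C) = Scl C"
  by (simp_all add: op_cat_def)

lemma (in linear_category) linear_category_op: "linear_category (op_cat C)"
proof (rule linear_category.intro, unfold op_cat_simps)
  show "vector_space (Scl C)" by (rule vector_space)
  show "module.subspace (Scl C) (Hom C Y X)" for X Y by (rule subspace_Hom)
  show "Idn C X \<in> Hom C X X" for X by (rule Idn_in_Hom)
  show "f \<cdot> Idn C Y = f" if "f \<in> Hom C Y X" for f X Y using that by (rule Cmp_Idn_right)
  show "Idn C X \<cdot> f = f" if "f \<in> Hom C Y X" for f X Y using that by (rule Cmp_Idn_left)
next
  fix f g X Y Z assume f: "f \<in> Hom C Y X" and g: "g \<in> Hom C Z Y"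
  show "f \<cdot> g \<in> Hom C Z X" using g f by (rule Cmp_in_Hom)
  show "Scl C a f \<cdot> g = Scl C a (f \<cdot> g)" for a using g f by (rule Cmp_Scl_left)
  show "f \<cdot> Scl C a g = Scl C a (f \<cdot> g)" for a using g f by (rule Cmp_Scl_right)
  show "f \<cdot> (g \<cdot> h) = f \<cdot> g \<cdot> h" if "h \<in> Hom C W Z" for h W
    using Cmp_assoc[OF that g f] by simp
  show "(f + f') \<cdot> g = f \<cdot> g + f' \<cdot> g" if "f' \<in> Hom C Y X" for f'
    using Cmp_add_left[OF g f that] .
  show "f \<cdot> (g + g') = f \<cdot> g + f \<cdot> g'" if "g' \<in> Hom C Z Y" for g'
    using Cmp_add_right[OF g that f] .
qed

lemma direct_sum_op: "direct_sum (op_cat C) Xs Y i p \<longleftrightarrow> direct_sum C Xs Y p i"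
  unfolding direct_sum_def by auto

section \<open>Splitting idempotents\<close>

definition splits :: "('k, 'o, 'm, 'z) lin_cat_scheme \<Rightarrow> 'o \<Rightarrow> 'm \<Rightarrow> bool" where
  "splits C X e \<longleftrightarrow>
     (\<exists>S i p. i \<in> Hom C S X \<and> p \<in> Hom C X S \<and> p \<cdot>\<^bsub>C\<^esub> i = Idn C S \<and> i \<cdot>\<^bsub>C\<^esub> p = e)"

definition idempotent_complete :: "('k, 'o, 'm, 'z) lin_cat_scheme \<Rightarrow> bool" where
  "idempotent_complete C \<longleftrightarrow> (\<forall>X. \<forall>e\<in>Hom C X X. e \<cdot>\<^bsub>C\<^esub> e = e \<longrightarrow> splits C X e)"

lemma idempotent_complete_op: "idempotent_complete (op_cat C) \<longleftrightarrow> idempotent_complete C"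
  unfolding idempotent_complete_def splits_def op_cat_simps by blast

context linear_category
begin

lemma Cmp_sandwich:
  assumes "a \<in> Hom C U V" "b \<in> Hom C V W" "b' \<in> Hom C W V'" "a' \<in> Hom C V' Z"
  shows "(a' \<cdot> b') \<cdot> (b \<cdot> a) = a' \<cdot> ((b' \<cdot> b) \<cdot> a)"
  using Cmp_assoc[OF Cmp_in_Hom[OF assms(1,2)] assms(3,4)] Cmp_assoc[OF assms(1-3)] by simp

lemma splits_sum:
  assumes additive: "has_finite_direct_sums C"
    and "i \<in> Hom C S X" "p \<in> Hom C X S" "p \<cdot> i = Idn C S"
    and "j \<in> Hom C R X" "q \<in> Hom C X R" "q \<cdot> j = Idn C R"
    and "p \<cdot> j = 0" "q \<cdot> i = 0"
  shows "splits C X (i \<cdot> p + j \<cdot> q)"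
proof -
  obtain D k r where D: "direct_sum C [S, R] D k r"
    using additive unfolding has_finite_direct_sums_def by blast
  have k: "k 0 \<in> Hom C S D" "k 1 \<in> Hom C R D" and r: "r 0 \<in> Hom C D S" "r 1 \<in> Hom C D R"
    using direct_sumD(1,2)[OF D, of 0] direct_sumD(1,2)[OF D, of 1] by auto
  have rk: "r 0 \<cdot> k 0 = Idn C S" "r 1 \<cdot> k 1 = Idn C R" "r 1 \<cdot> k 0 = 0" "r 0 \<cdot> k 1 = 0"
    using direct_sumD(3)[OF D, of 0] direct_sumD(3)[OF D, of 1]
      direct_sumD(4)[OF D, of 0 1] direct_sumD(4)[OF D, of 1 0] by auto
  have Id: "k 0 \<cdot> r 0 + k 1 \<cdot> r 1 = Idn C D"
    using direct_sumD(5)[OF D] by (simp add: lessThan_Suc add.commute)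
  note mem = assms(2,3,5,6) k r
  have comp: "i \<cdot> r 0 \<in> Hom C D X" "j \<cdot> r 1 \<in> Hom C D X" "k 0 \<cdot> p \<in> Hom C X D" "k 1 \<cdot> q \<in> Hom C X D"
    using mem Cmp_in_Hom by blast+
  have "(k 0 \<cdot> p + k 1 \<cdot> q) \<cdot> (i \<cdot> r 0 + j \<cdot> r 1)
    = (k 0 \<cdot> p) \<cdot> (i \<cdot> r 0) + (k 1 \<cdot> q) \<cdot> (i \<cdot> r 0) + ((k 0 \<cdot> p) \<cdot> (j \<cdot> r 1) + (k 1 \<cdot> q) \<cdot> (j \<cdot> r
      1))"
    using Cmp_add_right[OF comp(1,2) add_in_Hom[OF comp(3,4)]]
      Cmp_add_left[OF comp(1) comp(3,4)] Cmp_add_left[OF comp(2) comp(3,4)] by simp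
  also have "\<dots> = Idn C D"
    using assms mem Id
    by (simp add: Cmp_sandwich[OF r(1) assms(2,3) k(1)] Cmp_sandwich[OF r(1) assms(2) assms(6) k(2)]
      Cmp_sandwich[OF r(2) assms(5) assms(3) k(1)] Cmp_sandwich[OF r(2) assms(5,6) k(2)]
      Cmp_Idn_left[OF r(1)] Cmp_Idn_left[OF r(2)] Cmp_zero_left[OF r(1)] Cmp_zero_left[OF r(2)]
      Cmp_zero_right[OF k(1)] Cmp_zero_right[OF k(2)] del: One_nat_def)
  finally have 1: "(k 0 \<cdot> p + k 1 \<cdot> q) \<cdot> (i \<cdot> r 0 + j \<cdot> r 1) = Idn C D" .
  have "(i \<cdot> r 0 + j \<cdot> r 1) \<cdot> (k 0 \<cdot> p + k 1 \<cdot> q)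
    = (i \<cdot> r 0) \<cdot> (k 0 \<cdot> p) + (j \<cdot> r 1) \<cdot> (k 0 \<cdot> p) + ((i \<cdot> r 0) \<cdot> (k 1 \<cdot> q) + (j \<cdot> r 1) \<cdot> (k 1 \<cdot>
      q))"
    using Cmp_add_right[OF comp(3,4) add_in_Hom[OF comp(1,2)]]
      Cmp_add_left[OF comp(3) comp(1,2)] Cmp_add_left[OF comp(4) comp(1,2)] by simp
  also have "\<dots> = i \<cdot> p + j \<cdot> q"
    using rk
    by (simp add: Cmp_sandwich[OF assms(3) k(1) r(1) assms(2)]
      Cmp_sandwich[OF assms(3) k(1) r(2) assms(5)]
      Cmp_sandwich[OF assms(6) k(2) r(1) assms(2)] Cmp_sandwich[OF assms(6) k(2) r(2) assms(5)]
      Cmp_Idn_left[OF assms(3)] Cmp_Idn_left[OF assms(6)] Cmp_zero_left[OF assms(3)]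
      Cmp_zero_left[OF assms(6)] Cmp_zero_right[OF assms(2)] Cmp_zero_right[OF assms(5)]
      del: One_nat_def)
  finally have 2: "(i \<cdot> r 0 + j \<cdot> r 1) \<cdot> (k 0 \<cdot> p + k 1 \<cdot> q) = i \<cdot> p + j \<cdot> q" .
  show ?thesis
    unfolding splits_def using 1 2 add_in_Hom[OF comp(1,2)] add_in_Hom[OF comp(3,4)] by blast
qed

text \<open>
  The object \<open>R\<close> is the image of \<open>e\<close>, now regarded as a retract of \<open>X\<close>. The last two conclusions
  provide the orthogonality that \<open>splits_sum\<close> needs in order to add \<open>R\<close> to another summand.
\<close>

lemma splits_transport:
  assumes i: "i \<in> Hom C Y X" and p: "p \<in> Hom C X Y" and pi: "p \<cdot> i = Idn C Y"
    and "splits C Y e"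
  obtains j q R where "j \<in> Hom C R X" "q \<in> Hom C X R" "q \<cdot> j = Idn C R" "j \<cdot> q = i \<cdot> (e \<cdot> p)"
    "\<And>c Z. \<lbrakk>c \<in> Hom C X Z; c \<cdot> i = 0\<rbrakk> \<Longrightarrow> c \<cdot> j = 0"
    "\<And>c Z. \<lbrakk>c \<in> Hom C Z X; p \<cdot> c = 0\<rbrakk> \<Longrightarrow> q \<cdot> c = 0"
proof -
  obtain R j q where R: "j \<in> Hom C R Y" "q \<in> Hom C Y R" "q \<cdot> j = Idn C R" "j \<cdot> q = e"
    using assms(4) unfolding splits_def by blast
  have ij: "i \<cdot> j \<in> Hom C R X" and qp: "q \<cdot> p \<in> Hom C X R" and jqp: "j \<cdot> q \<in> Hom C Y Y"
    using R i p Cmp_in_Hom by blast+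
  show thesis
  proof (rule that[OF ij qp])
    have "(q \<cdot> p) \<cdot> (i \<cdot> j) = q \<cdot> ((p \<cdot> i) \<cdot> j)"
      by (simp add: Cmp_assoc[OF ij p R(2)] Cmp_assoc[OF R(1) i p])
    then show "(q \<cdot> p) \<cdot> (i \<cdot> j) = Idn C R" by (simp add: pi Cmp_Idn_left[OF R(1)] R(3))
    show "(i \<cdot> j) \<cdot> (q \<cdot> p) = i \<cdot> (e \<cdot> p)"
      by (simp add: Cmp_assoc[OF qp R(1) i] Cmp_assoc[OF p R(2,1)] flip: R(4))
    show "c \<cdot> (i \<cdot> j) = 0" if "c \<in> Hom C X Z" "c \<cdot> i = 0" for c Z
      using Cmp_assoc[OF R(1) i that(1)] that(2) Cmp_zero_left[OF R(1)] by simp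
    show "(q \<cdot> p) \<cdot> c = 0" if "c \<in> Hom C Z X" "p \<cdot> c = 0" for c Z
      using Cmp_assoc[OF that(1) p R(2)] that(2) Cmp_zero_right[OF R(2)] by simp
  qed
qed

lemma complementary_idempotent:
  assumes "e \<in> Hom C X X" "e \<cdot> e = e"
  shows "Idn C X - e \<in> Hom C X X" "(Idn C X - e) \<cdot> (Idn C X - e) = Idn C X - e"
proof -
  show m: "Idn C X - e \<in> Hom C X X" by (intro diff_in_Hom Idn_in_Hom assms)
  show "(Idn C X - e) \<cdot> (Idn C X - e) = Idn C X - e"
    using assms m
    by (simp add: Cmp_diff_left[OF m Idn_in_Hom assms(1)] Cmp_diff_right[OF Idn_in_Hom assms(1)]
      Cmp_Idn_left[of _ X X] Cmp_Idn_right[of _ X X] Idn_in_Hom)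
qed

text \<open>
  An exchange argument. When \<open>e\<close> restricts to an isomorphism on the summand \<open>X\<close> of \<open>Y\<close>, the image
  of \<open>e\<close> contains the copy \<open>a = e i\<close> of \<open>X\<close>, and \<open>Y'\<close> is still a complement of this copy, because
  \<open>p a\<close> is invertible. Along a suitable projection onto \<open>Y'\<close> the rest of \<open>e\<close> becomes an idempotent
  of \<open>Y'\<close>, so the image of \<open>e\<close> is \<open>X\<close> plus the image of that idempotent, while the image of \<open>1 -
  e\<close> is the image of the complementary idempotent of \<open>Y'\<close>.
\<close>

lemma splits_exchange:
  assumes additive: "has_finite_direct_sums C"
    and mem: "i \<in> Hom C X Y" "p \<in> Hom C Y X" "i' \<in> Hom C Y' Y" "p' \<in> Hom C Y Y'"
    and pi: "p' \<cdot> i' = Idn C Y'" "p \<cdot> i' = 0" and Id: "i \<cdot> p + i' \<cdot> p' = Idn C Y"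
    and rest: "\<And>e. \<lbrakk>e \<in> Hom C Y' Y'; e \<cdot> e = e\<rbrakk> \<Longrightarrow> splits C Y' e"
    and e: "e \<in> Hom C Y Y" "e \<cdot> e = e" and iso: "is_iso C X X (p \<cdot> (e \<cdot> i))"
  shows "splits C Y e" "splits C Y (Idn C Y - e)"
proof -
  let ?u = "p \<cdot> (e \<cdot> i)"
  obtain u' where u: "?u \<in> Hom C X X" "u' \<in> Hom C X X" "u' \<cdot> ?u = Idn C X" "?u \<cdot> u' = Idn C X"
    using iso by (rule is_isoE)
  \<comment> \<open>Two retractions of \<open>a\<close>: \<open>b\<close> is compatible with \<open>e\<close>, and \<open>b0\<close> vanishes on \<open>Y'\<close>. The projections
    \<open>a b\<close> and \<open>a b0\<close> have the same image, so the images of \<open>1 - a b\<close> and \<open>1 - a b0\<close> are two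
    complements of it; the second one is \<open>Y'\<close>.\<close>
  define a b b0 where "a = e \<cdot> i" and "b = u' \<cdot> (p \<cdot> e)" and "b0 = u' \<cdot> p"
  have pe: "p \<cdot> e \<in> Hom C Y X" using mem e Cmp_in_Hom by blast
  have a: "a \<in> Hom C X Y" and b: "b \<in> Hom C Y X" and b0: "b0 \<in> Hom C Y X"
    unfolding a_def b_def b0_def using mem e u pe Cmp_in_Hom by blast+
  have ea: "e \<cdot> a = a" unfolding a_def using Cmp_assoc[OF mem(1) e(1) e(1)] e(2) by simp
  have be: "b \<cdot> e = b" unfolding b_def
    using Cmp_assoc[OF e(1) pe u(2)] Cmp_assoc[OF e(1) e(1) mem(2)] e(2) by simp
  have pa: "p \<cdot> a = ?u" by (simp add: a_def)
  have b0a: "b0 \<cdot> a = Idn C X" unfolding b0_def using Cmp_assoc[OF a mem(2) u(2)] pa u(3) by simp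
  have b_b0e: "b = b0 \<cdot> e" unfolding b_def b0_def using Cmp_assoc[OF e(1) mem(2) u(2)] by simp
  have ba: "b \<cdot> a = Idn C X" using b_b0e Cmp_assoc[OF a e(1) b0] ea b0a by simp
  have b0i': "b0 \<cdot> i' = 0"
    unfolding b0_def using Cmp_assoc[OF mem(3,2) u(2)] pi(2) Cmp_zero_right[OF u(2)] by simp
  have ab: "a \<cdot> b \<in> Hom C Y Y" and ab0: "a \<cdot> b0 \<in> Hom C Y Y" using a b b0 Cmp_in_Hom by blast+
  have absorb: "(a \<cdot> c) \<cdot> (a \<cdot> d) = a \<cdot> d"
    if "c \<in> Hom C Y X" "d \<in> Hom C Y X" "c \<cdot> a = Idn C X" for c d
    using Cmp_assoc[OF _ that(1) a, of "a \<cdot> d" Y] Cmp_assoc[OF that(2) a that(1)] that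
      Cmp_in_Hom[OF that(2) a] Cmp_Idn_left[OF that(2)] by simp
  let ?q = "Idn C Y - a \<cdot> b" and ?t = "Idn C Y - a \<cdot> b0"
  have q: "?q \<in> Hom C Y Y" "?t \<in> Hom C Y Y"
    using Idn_in_Hom ab ab0 by (auto intro: diff_in_Hom)
  have qq: "(Idn C Y - f) \<cdot> (Idn C Y - g) = Idn C Y - f - g + f \<cdot> g"
    if "f \<in> Hom C Y Y" "g \<in> Hom C Y Y" for f g
    using that Idn_in_Hom[of Y]
    by (simp add: Cmp_diff_left[of _ Y Y _ Y] Cmp_diff_right[of _ Y Y _ _ Y] diff_in_Hom
      Cmp_Idn_left[of _ Y Y] Cmp_Idn_right[of _ Y Y])
  have q0q: "?t \<cdot> ?q = ?t" and qq0: "?q \<cdot> ?t = ?q"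
    using qq[OF ab ab0] qq[OF ab0 ab] absorb[OF b0 b b0a] absorb[OF b b0 ba] by auto
  have q0i': "?t \<cdot> i' = i'"
    using Cmp_diff_left[OF mem(3) Idn_in_Hom ab0] Cmp_assoc[OF mem(3) b0 a] b0i'
      Cmp_zero_right[OF a] Cmp_Idn_left[OF mem(3)] by simp
  have ip: "i \<cdot> p \<in> Hom C Y Y" and i'p': "i' \<cdot> p' \<in> Hom C Y Y" using mem Cmp_in_Hom by blast+
  have "p \<cdot> ?t = p - p \<cdot> (a \<cdot> b0)"
    using Cmp_diff_right[OF Idn_in_Hom ab0 mem(2)] Cmp_Idn_right[OF mem(2)] by simp
  also have "p \<cdot> (a \<cdot> b0) = p"
    using Cmp_assoc[OF b0 a mem(2)] Cmp_assoc[OF mem(2) u(2,1)] u(4) pa Cmp_Idn_left[OF mem(2)]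
    by (simp add: b0_def)
  finally have pq0: "p \<cdot> ?t = 0" by simp
  have i'p'q0: "(i' \<cdot> p') \<cdot> ?t = ?t"
    using Cmp_add_left[OF q(2) ip i'p'] Id Cmp_Idn_left[OF q(2)] Cmp_assoc[OF q(2) mem(2,1)]
      pq0 Cmp_zero_right[OF mem(1)] by simp
  \<comment> \<open>Therefore \<open>1 - a b\<close> splits through \<open>Y'\<close>, and it commutes with \<open>e\<close>.\<close>
  define j r where "j = ?q \<cdot> i'" and "r = p' \<cdot> ?t"
  have j: "j \<in> Hom C Y' Y" and r: "r \<in> Hom C Y Y'"
    unfolding j_def r_def using q mem Cmp_in_Hom by blast+
  have rj: "r \<cdot> j = Idn C Y'"
    unfolding j_def r_def
    using Cmp_assoc[OF Cmp_in_Hom[OF mem(3) q(1)] q(2) mem(4)] Cmp_assoc[OF mem(3) q] q0q q0i' pi(1)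
    by simp
  have jr: "j \<cdot> r = ?q"
    unfolding j_def r_def
    using Cmp_assoc[OF Cmp_in_Hom[OF q(2) mem(4)] mem(3) q(1)] Cmp_assoc[OF q(2) mem(4,3)] i'p'q0
      qq0
    by simp
  define e2 where "e2 = r \<cdot> (e \<cdot> j)"
  have ej: "e \<cdot> j \<in> Hom C Y' Y" and er: "e \<cdot> ?q \<in> Hom C Y Y" using j e q Cmp_in_Hom by blast+
  have e2: "e2 \<in> Hom C Y' Y'" unfolding e2_def using r ej Cmp_in_Hom by blast
  have eab: "e \<cdot> (a \<cdot> b) = a \<cdot> b" using Cmp_assoc[OF b a e(1)] ea by simp
  have abe: "(a \<cdot> b) \<cdot> e = a \<cdot> b" using Cmp_assoc[OF e(1) b a] be by simp
  have eq: "e \<cdot> ?q = e - a \<cdot> b"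
    using Cmp_diff_right[OF Idn_in_Hom ab e(1)] Cmp_Idn_right[OF e(1)] eab by simp
  have qe: "?q \<cdot> e = e - a \<cdot> b"
    using Cmp_diff_left[OF e(1) Idn_in_Hom ab] Cmp_Idn_left[OF e(1)] abe by simp
  have q_id: "?q \<cdot> ?q = ?q" using qq[OF ab ab] absorb[OF b b ba] by simp
  have rq: "r \<cdot> ?q = r"
    unfolding jr[symmetric] using Cmp_assoc[OF r j r] rj Cmp_Idn_left[OF r] by simp
  have qj: "?q \<cdot> j = j"
    unfolding jr[symmetric] using Cmp_assoc[OF j r j] rj Cmp_Idn_right[OF j] by simp
  have "e2 \<cdot> e2 = r \<cdot> ((e \<cdot> ?q) \<cdot> (e \<cdot> j))"
    unfolding e2_def jr[symmetric]
    using Cmp_assoc[OF Cmp_in_Hom[OF ej r] ej r] Cmp_assoc[OF ej r ej]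
      Cmp_assoc[OF r j e(1)] by simp
  also have "(e \<cdot> ?q) \<cdot> (e \<cdot> j) = (?q \<cdot> e) \<cdot> (e \<cdot> j)" using eq qe by simp
  also have "\<dots> = ?q \<cdot> (e \<cdot> j)"
    using Cmp_assoc[OF ej e(1) q(1)] Cmp_assoc[OF j e(1) e(1)] e(2) by simp
  also have "r \<cdot> (?q \<cdot> (e \<cdot> j)) = e2"
    using Cmp_assoc[OF ej q(1) r] rq unfolding e2_def by simp
  finally have e2_id: "e2 \<cdot> e2 = e2" .
  have je2r: "j \<cdot> (e2 \<cdot> r) = e - a \<cdot> b"
  proof -
    have "j \<cdot> (e2 \<cdot> r) = (j \<cdot> r) \<cdot> ((e \<cdot> j) \<cdot> r)"
      unfolding e2_def
      using Cmp_assoc[OF r ej r] Cmp_assoc[OF Cmp_in_Hom[OF r ej] r j] by simp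
    also have "\<dots> = ?q \<cdot> (e \<cdot> ?q)" using Cmp_assoc[OF r j e(1)] jr by simp
    also have "\<dots> = (?q \<cdot> ?q) \<cdot> e" using eq qe Cmp_assoc[OF e(1) q(1) q(1)] by simp
    finally show ?thesis using q_id qe by simp
  qed
  show "splits C Y e"
  proof (rule splits_transport[OF j r rj rest[OF e2 e2_id]])
    fix k s R
    assume k: "k \<in> Hom C R Y" "s \<in> Hom C Y R" "s \<cdot> k = Idn C R" "k \<cdot> s = j \<cdot> (e2 \<cdot> r)"
      "\<And>c Z. \<lbrakk>c \<in> Hom C Y Z; c \<cdot> j = 0\<rbrakk> \<Longrightarrow> c \<cdot> k = 0"
      "\<And>c Z. \<lbrakk>c \<in> Hom C Z Y; r \<cdot> c = 0\<rbrakk> \<Longrightarrow> s \<cdot> c = 0"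
    have "b \<cdot> ?q = 0"
      using Cmp_diff_right[OF Idn_in_Hom ab b] Cmp_Idn_right[OF b] Cmp_assoc[OF b a b] ba
        Cmp_Idn_left[OF b] by simp
    then have bj: "b \<cdot> j = 0" using Cmp_assoc[OF j q(1) b] qj Cmp_zero_left[OF j] by simp
    have "?q \<cdot> a = 0"
      using Cmp_diff_left[OF a Idn_in_Hom ab] Cmp_Idn_left[OF a] Cmp_assoc[OF a b a] ba
        Cmp_Idn_right[OF a] by simp
    then have ra: "r \<cdot> a = 0" using Cmp_assoc[OF a q(1) r] rq Cmp_zero_right[OF r] by simp
    have "splits C Y (a \<cdot> b + k \<cdot> s)"
      by (rule splits_sum[OF additive a b ba k(1-3) k(5)[OF b bj] k(6)[OF a ra]])
    then show ?thesis using k(4) je2r by simp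
  qed
  show "splits C Y (Idn C Y - e)"
  proof (rule splits_transport[OF j r rj rest[OF complementary_idempotent[OF e2 e2_id]]])
    fix k s R
    assume k: "k \<in> Hom C R Y" "s \<in> Hom C Y R" "s \<cdot> k = Idn C R"
      "k \<cdot> s = j \<cdot> ((Idn C Y' - e2) \<cdot> r)"
    have "j \<cdot> ((Idn C Y' - e2) \<cdot> r) = ?q - (e - a \<cdot> b)"
      using Cmp_diff_left[OF r Idn_in_Hom e2] Cmp_Idn_left[OF r] je2r jr
        Cmp_diff_right[OF r Cmp_in_Hom[OF r e2] j] by simp
    then have "j \<cdot> ((Idn C Y' - e2) \<cdot> r) = Idn C Y - e" by simp
    then show ?thesis unfolding splits_def using k by metis
  qed
qed

lemma local_summand_dichotomy:
  assumes X: "local_endomorphism_ring C X" and "f \<in> Hom C X X" "g \<in> Hom C X X" "f + g = Idn C X"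
  shows "is_iso C X X f \<or> is_iso C X X g"
proof (rule ccontr)
  assume "\<not> ?thesis"
  then have "\<not> is_iso C X X (f + g)" using assms unfolding local_endomorphism_ring_def by blast
  then show False using assms(4) is_iso_Idn by simp
qed

text \<open>
  Induction on the number of local summands. Let \<open>X\<close> be the first one, with inclusion \<open>i\<close> and
  projection \<open>p\<close>. The endomorphisms \<open>p e i\<close> and \<open>p (1 - e) i\<close> of \<open>X\<close> add up to the identity, so
  one of them is invertible, and the exchange argument applies to \<open>e\<close> or to \<open>1 - e\<close>.
\<close>

lemma krull_schmidt_splits:
  assumes additive: "has_finite_direct_sums C"
    and "direct_sum C Xs Y i p" "\<And>X. X \<in> set Xs \<Longrightarrow> local_endomorphism_ring C X"
    and "e \<in> Hom C Y Y" "e \<cdot> e = e"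
  shows "splits C Y e"
  using assms(2-)
proof (induction Xs arbitrary: Y i p e)
  case Nil
  then have "Idn C Y = 0" unfolding direct_sum_def by simp
  moreover from this have "zero_object C Y" by (simp add: zero_object_iff)
  moreover from this have "e = 0" by (rule Hom_to_zero_object[OF _ Nil.prems(3)])
  ultimately show ?case
    unfolding splits_def
    using zero_in_Hom[of Y Y] Cmp_zero_left[OF zero_in_Hom[of Y Y]]
    by (intro exI[of _ Y] exI[of _ 0]) simp
next
  case (Cons X Xs)
  note D = direct_sumD[OF Cons.prems(1)]
  obtain Y' j q where D': "direct_sum C Xs Y' j q"
    using additive unfolding has_finite_direct_sums_def by blast
  note D'm = direct_sumD[OF D']
  have i: "i (Suc s) \<in> Hom C (Xs ! s) Y" and p: "p (Suc s) \<in> Hom C Y (Xs ! s)"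
    if "s < length Xs" for s using D(1,2)[of "Suc s"] that by auto
  have i0: "i 0 \<in> Hom C X Y" and p0: "p 0 \<in> Hom C Y X" using D(1,2)[of 0] by auto
  \<comment> \<open>The remaining summands have a direct sum \<open>Y'\<close> of their own; it is a complement of \<open>X\<close> in \<open>Y\<close>.\<close>
  define i' p' where "i' = (\<Sum>s<length Xs. i (Suc s) \<cdot> q s)" and
    "p' = (\<Sum>s<length Xs. j s \<cdot> p (Suc s))"
  have iq: "i (Suc s) \<cdot> q s \<in> Hom C Y' Y" and jp: "j s \<cdot> p (Suc s) \<in> Hom C Y Y'"
    if "s < length Xs" for s using i p D'm(1,2) that Cmp_in_Hom by blast+
  have i': "i' \<in> Hom C Y' Y" and p': "p' \<in> Hom C Y Y'"
    unfolding i'_def p'_def using iq jp by (auto intro: sum_in_Hom)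
  have ps_i': "p (Suc s) \<cdot> i' = q s" if s: "s < length Xs" for s
  proof -
    have "p (Suc s) \<cdot> i' = (\<Sum>t<length Xs. p (Suc s) \<cdot> (i (Suc t) \<cdot> q t))"
      unfolding i'_def using iq by (intro Cmp_sum_right[OF p[OF s]]) auto
    also have "\<dots> = (\<Sum>t<length Xs. if t = s then q s else 0)"
    proof (intro sum.cong refl)
      fix t assume "t \<in> {..<length Xs}"
      then have t: "t < length Xs" by simp
      have "p (Suc s) \<cdot> (i (Suc t) \<cdot> q t) = (p (Suc s) \<cdot> i (Suc t)) \<cdot> q t"
        by (rule Cmp_assoc[OF D'm(2)[OF t] i[OF t] p[OF s], symmetric])
      then show "p (Suc s) \<cdot> (i (Suc t) \<cdot> q t) = (if t = s then q s else 0)"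
        using D(3)[of "Suc s"] D(4)[of "Suc t" "Suc s"] s t Cmp_Idn_left[OF D'm(2)[OF s]]
          Cmp_zero_left[OF D'm(2)[OF t]] by auto
    qed
    finally show ?thesis using s by simp
  qed
  have qs_p': "q s \<cdot> p' = p (Suc s)" if s: "s < length Xs" for s
  proof -
    have "q s \<cdot> p' = (\<Sum>t<length Xs. q s \<cdot> (j t \<cdot> p (Suc t)))"
      unfolding p'_def using jp by (intro Cmp_sum_right[OF D'm(2)[OF s]]) auto
    also have "\<dots> = (\<Sum>t<length Xs. if t = s then p (Suc s) else 0)"
    proof (intro sum.cong refl)
      fix t assume "t \<in> {..<length Xs}"
      then have t: "t < length Xs" by simp
      have "q s \<cdot> (j t \<cdot> p (Suc t)) = (q s \<cdot> j t) \<cdot> p (Suc t)"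
        by (rule Cmp_assoc[OF p[OF t] D'm(1)[OF t] D'm(2)[OF s], symmetric])
      then show "q s \<cdot> (j t \<cdot> p (Suc t)) = (if t = s then p (Suc s) else 0)"
        using D'm(3)[of s] D'm(4)[of t s] s t Cmp_Idn_left[OF p[OF s]]
          Cmp_zero_left[OF p[OF t]] by auto
    qed
    finally show ?thesis using s by simp
  qed
  have "p' \<cdot> i' = (\<Sum>s<length Xs. (j s \<cdot> p (Suc s)) \<cdot> i')"
    unfolding p'_def using jp by (intro Cmp_sum_left[OF i']) auto
  also have "\<dots> = (\<Sum>s<length Xs. j s \<cdot> q s)"
    by (intro sum.cong refl) (simp add: Cmp_assoc[OF i' p D'm(1)] ps_i')
  finally have p'i': "p' \<cdot> i' = Idn C Y'" using D'm(5) by simp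
  have "i' \<cdot> p' = (\<Sum>s<length Xs. (i (Suc s) \<cdot> q s) \<cdot> p')"
    unfolding i'_def using iq by (intro Cmp_sum_left[OF p']) auto
  also have "\<dots> = (\<Sum>s<length Xs. i (Suc s) \<cdot> p (Suc s))"
    by (intro sum.cong refl) (simp add: Cmp_assoc[OF p' D'm(2) i] qs_p')
  finally have Id: "i 0 \<cdot> p 0 + i' \<cdot> p' = Idn C Y"
    using D(5) by (simp add: sum.lessThan_Suc_shift del: sum.lessThan_Suc)
  have "p 0 \<cdot> i' = (\<Sum>t<length Xs. p 0 \<cdot> (i (Suc t) \<cdot> q t))"
    unfolding i'_def using iq by (intro Cmp_sum_right[OF p0]) auto
  also have "\<dots> = 0"
  proof (intro sum.neutral ballI)
    fix t assume "t \<in> {..<length Xs}"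
    then have t: "t < length Xs" by simp
    show "p 0 \<cdot> (i (Suc t) \<cdot> q t) = 0"
      using Cmp_assoc[OF D'm(2)[OF t] i[OF t] p0] D(4)[of "Suc t" 0] t
        Cmp_zero_left[OF D'm(2)[OF t]] by simp
  qed
  finally have p0i': "p 0 \<cdot> i' = 0" .
  have rest: "splits C Y' e" if "e \<in> Hom C Y' Y'" "e \<cdot> e = e" for e
    using Cons.IH[OF D' _ that] Cons.prems(2) by simp
  note e = Cons.prems(3,4)
  note e' = complementary_idempotent[OF e]
  note exchange = splits_exchange[OF additive i0 p0 i' p' p'i' p0i' Id rest]
  have ei: "e \<cdot> i 0 \<in> Hom C X Y" "(Idn C Y - e) \<cdot> i 0 \<in> Hom C X Y" using i0 e e' Cmp_in_Hom
    by blast+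
  have pei: "p 0 \<cdot> (e \<cdot> i 0) \<in> Hom C X X" "p 0 \<cdot> ((Idn C Y - e) \<cdot> i 0) \<in> Hom C X X"
    using ei p0 Cmp_in_Hom by blast+
  have "e \<cdot> i 0 + (Idn C Y - e) \<cdot> i 0 = i 0"
    using Cmp_add_left[OF i0 e(1) e'(1)] Cmp_Idn_left[OF i0] by simp
  then have "p 0 \<cdot> (e \<cdot> i 0) + p 0 \<cdot> ((Idn C Y - e) \<cdot> i 0) = Idn C X"
    using Cmp_add_right[OF ei p0] D(3)[of 0] by simp
  then consider "is_iso C X X (p 0 \<cdot> (e \<cdot> i 0))" | "is_iso C X X (p 0 \<cdot> ((Idn C Y - e) \<cdot> i 0))"
    using local_summand_dichotomy[OF _ pei] Cons.prems(2) by auto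
  then show ?case
  proof cases
    case 1
    show ?thesis using exchange(1)[OF _ _ e 1] .
  next
    case 2
    show ?thesis using exchange(2)[OF _ _ e' 2] by simp
  qed
qed

lemma krull_schmidt_idempotent_complete:
  assumes "krull_schmidt C"
  shows "idempotent_complete C"
  unfolding idempotent_complete_def
proof (intro allI ballI impI)
  fix X e assume e: "e \<in> Hom C X X" "e \<cdot> e = e"
  obtain Xs i p where D: "direct_sum C Xs X i p" and l: "\<forall>X\<in>set Xs. local_endomorphism_ring C X"
    using assms unfolding krull_schmidt_def by blast
  have "has_finite_direct_sums C" using assms unfolding krull_schmidt_def by (rule conjunct1)
  then show "splits C X e" by (rule krull_schmidt_splits[OF _ D bspec[OF l] e])
qed

end

section \<open>Representability\<close>

text \<open>
  All that the representability argument needs to know about two consecutive morphisms of a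
  triangle: \<open>u\<close> is a weak kernel of \<open>v\<close>, and \<open>v\<close> is a weak cokernel of \<open>u\<close>. The condition is
  self-dual.
\<close>

definition exact_pair ::
  "('k, 'o, 'm::ab_group_add, 'z) lin_cat_scheme \<Rightarrow> 'o \<Rightarrow> 'o \<Rightarrow> 'o \<Rightarrow> 'm \<Rightarrow> 'm \<Rightarrow> bool" where
  "exact_pair C X Y Z u v \<longleftrightarrow> u \<in> Hom C X Y \<and> v \<in> Hom C Y Z \<and> v \<cdot>\<^bsub>C\<^esub> u = 0 \<and>
     (\<forall>U. \<forall>f\<in>Hom C U Y. v \<cdot>\<^bsub>C\<^esub> f = 0 \<longrightarrow> (\<exists>g\<in>Hom C U X. f = u \<cdot>\<^bsub>C\<^esub> g)) \<and>
     (\<forall>U. \<forall>f\<in>Hom C Y U. f \<cdot>\<^bsub>C\<^esub> u = 0 \<longrightarrow> (\<exists>g\<in>Hom C Z U. f = g \<cdot>\<^bsub>C\<^esub> v))"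

lemma exact_pairD:
  assumes "exact_pair C X Y Z u v"
  shows "u \<in> Hom C X Y" "v \<in> Hom C Y Z" "v \<cdot>\<^bsub>C\<^esub> u = 0"
    and "\<lbrakk>f \<in> Hom C U Y; v \<cdot>\<^bsub>C\<^esub> f = 0\<rbrakk> \<Longrightarrow> \<exists>g\<in>Hom C U X. f = u \<cdot>\<^bsub>C\<^esub> g"
    and "\<lbrakk>f \<in> Hom C Y U; f \<cdot>\<^bsub>C\<^esub> u = 0\<rbrakk> \<Longrightarrow> \<exists>g\<in>Hom C Z U. f = g \<cdot>\<^bsub>C\<^esub> v"
  using assms unfolding exact_pair_def by blast+

lemma exact_pair_op: "exact_pair (op_cat C) X Y Z u v \<longleftrightarrow> exact_pair C Z Y X v u"
  unfolding exact_pair_def op_cat_simps by blast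

text \<open>
  \<open>X\<close> is a retract of \<open>P\<^sup>n\<close>, expressed by the components of the inclusion and the retraction, so
  that no direct sum has to be chosen and the condition is self-dual.
\<close>

definition retract_of_power ::
  "('k, 'o, 'm::ab_group_add, 'z) lin_cat_scheme \<Rightarrow> 'o \<Rightarrow> 'o \<Rightarrow> bool" where
  "retract_of_power C P X \<longleftrightarrow> (\<exists>n i p.
     (\<forall>s<(n::nat). i s \<in> Hom C P X \<and> p s \<in> Hom C X P) \<and> (\<Sum>s<n. i s \<cdot>\<^bsub>C\<^esub> p s) = Idn C X)"

lemma retract_of_power_op: "retract_of_power (op_cat C) P X \<longleftrightarrow> retract_of_power C P X"
  unfolding retract_of_power_def op_cat_simps by blast

context linear_category
begin

abbreviation form :: "'o \<Rightarrow> 'o \<Rightarrow> ('m \<Rightarrow> 'k) \<Rightarrow> bool" where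
  "form X A \<equiv> linear_form (Scl C) (Hom C X A)"

text \<open>
  A form \<open>\<xi>\<close> on \<open>Hom X A\<close> is viewed as the natural transformation from \<open>Hom(-,A)\<close> to the dual of
  \<open>Hom(X,-)\<close> that sends \<open>g\<close> to the form \<open>f \<mapsto> \<xi> (g \<cdot> f)\<close>. The next definitions speak about this
  transformation at an object \<open>Y\<close>; a pair \<open>(A', \<xi>')\<close> extends \<open>(A, \<xi>)\<close> along \<open>f\<close> if the
  transformation of \<open>\<xi>\<close> is the one of \<open>\<xi>'\<close> after composition with \<open>f\<close>.
\<close>

definition onto_at :: "'o \<Rightarrow> 'o \<Rightarrow> ('m \<Rightarrow> 'k) \<Rightarrow> 'o \<Rightarrow> bool" where
  "onto_at X A \<xi> Y \<longleftrightarrow> (\<forall>\<phi>. form X Y \<phi> \<longrightarrow> (\<exists>g\<in>Hom C Y A. \<forall>f\<in>Hom C X Y. \<phi> f = \<xi> (g \<cdot> f)))"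

definition kernel_at :: "'o \<Rightarrow> 'o \<Rightarrow> ('m \<Rightarrow> 'k) \<Rightarrow> 'o \<Rightarrow> 'm set" where
  "kernel_at X A \<xi> Y = {g \<in> Hom C Y A. \<forall>f\<in>Hom C X Y. \<xi> (g \<cdot> f) = 0}"

definition extends :: "'o \<Rightarrow> 'o \<Rightarrow> ('m \<Rightarrow> 'k) \<Rightarrow> 'm \<Rightarrow> 'o \<Rightarrow> ('m \<Rightarrow> 'k) \<Rightarrow> bool" where
  "extends X A \<xi> f A' \<xi>' \<longleftrightarrow>
     f \<in> Hom C A A' \<and> form X A' \<xi>' \<and> (\<forall>h\<in>Hom C X A. \<xi>' (f \<cdot> h) = \<xi> h)"

definition represents :: "'o \<Rightarrow> 'o \<Rightarrow> ('m \<Rightarrow> 'k) \<Rightarrow> bool" where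
  "represents X A \<xi> \<longleftrightarrow>
     form X A \<xi> \<and> (\<forall>Y. onto_at X A \<xi> Y \<and> kernel_at X A \<xi> Y \<subseteq> {0})"

lemma form_pullback:
  assumes "form X A \<xi>" and g: "g \<in> Hom C Y A"
  shows "form X Y (\<lambda>f. \<xi> (g \<cdot> f))"
  using Cmp_add_right[OF _ _ g] Cmp_Scl_right[OF _ g] Cmp_in_Hom[OF _ g]
  by (intro linear_formI) (simp_all add: linear_form_add[OF assms(1)]
    linear_form_scale[OF assms(1)])

lemma form_pullback_arg:
  assumes "form X A \<xi>" and h: "h \<in> Hom C X Y"
  shows "form Y A (\<lambda>g. \<xi> (g \<cdot> h))"
  using Cmp_add_left[OF h] Cmp_Scl_left[OF h] Cmp_in_Hom[OF h]
  by (intro linear_formI) (simp_all add: linear_form_add[OF assms(1)]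
    linear_form_scale[OF assms(1)])

text \<open>
  The dual of \<open>Hom(X,-)\<close> is exact on exact pairs.
\<close>

lemma form_extend:
  assumes ex: "exact_pair C U V W u v" and \<phi>: "form X V \<phi>"
    and vanish: "\<And>f. f \<in> Hom C X U \<Longrightarrow> \<phi> (u \<cdot> f) = 0"
  obtains \<psi> where "form X W \<psi>" "\<And>f. f \<in> Hom C X V \<Longrightarrow> \<psi> (v \<cdot> f) = \<phi> f"
proof (rule vs.linear_form_factor[OF subspace_Hom \<phi>, of "\<lambda>f. v \<cdot> f"])
  note v = exact_pairD(2)[OF ex] and form = that
  show "v \<cdot> (f + g) = v \<cdot> f + v \<cdot> g" if "f \<in> Hom C X V" "g \<in> Hom C X V" for f g
    using Cmp_add_right[OF that v] .
  show "v \<cdot> Scl C a f = Scl C a (v \<cdot> f)" if "f \<in> Hom C X V" for a f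
    using Cmp_Scl_right[OF that v] .
  show "\<phi> f = 0" if "f \<in> Hom C X V" "v \<cdot> f = 0" for f
    using exact_pairD(4)[OF ex that] vanish by blast
  show thesis if "linear_form (Scl C) UNIV \<psi>" "\<And>f. f \<in> Hom C X V \<Longrightarrow> \<psi> (v \<cdot> f) = \<phi> f" for \<psi>
  proof (rule form)
    show "form X W \<psi>" using that(1) by (simp add: linear_form_def)
  qed (rule that(2))
qed

lemma retract_expand:
  assumes "retract_of_power C P Y"
  obtains n i p where "\<And>s. s < (n::nat) \<Longrightarrow> i s \<in> Hom C P Y" "\<And>s. s < n \<Longrightarrow> p s \<in> Hom C Y P"
    "\<And>X f. f \<in> Hom C X Y \<Longrightarrow> f = (\<Sum>s<n. i s \<cdot> (p s \<cdot> f))"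
    "\<And>Z g. g \<in> Hom C Y Z \<Longrightarrow> g = (\<Sum>s<n. (g \<cdot> i s) \<cdot> p s)"
proof -
  obtain n i p where ip: "\<And>s. s < (n::nat) \<Longrightarrow> i s \<in> Hom C P Y" "\<And>s. s < n \<Longrightarrow> p s \<in> Hom C Y P"
    and Id: "(\<Sum>s<n. i s \<cdot> p s) = Idn C Y"
    using assms unfolding retract_of_power_def by blast
  have mem: "i s \<cdot> p s \<in> Hom C Y Y" if "s < n" for s
    by (rule Cmp_in_Hom[OF ip(2)[OF that] ip(1)[OF that]])
  show thesis
  proof (rule that)
    show "i s \<in> Hom C P Y" "p s \<in> Hom C Y P" if "s < n" for s using ip that by auto
    show "f = (\<Sum>s<n. i s \<cdot> (p s \<cdot> f))" if f: "f \<in> Hom C X Y" for X f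
    proof -
      have "f = (\<Sum>s<n. i s \<cdot> p s) \<cdot> f" using Id Cmp_Idn_left[OF f] by simp
      also have "\<dots> = (\<Sum>s<n. (i s \<cdot> p s) \<cdot> f)" using mem by (intro Cmp_sum_left[OF f]) auto
      also have "\<dots> = (\<Sum>s<n. i s \<cdot> (p s \<cdot> f))"
        by (intro sum.cong refl) (simp add: Cmp_assoc[OF f ip(2,1)])
      finally show ?thesis .
    qed
    show "g = (\<Sum>s<n. (g \<cdot> i s) \<cdot> p s)" if g: "g \<in> Hom C Y Z" for Z g
    proof -
      have "g = g \<cdot> (\<Sum>s<n. i s \<cdot> p s)" using Id Cmp_Idn_right[OF g] by simp
      also have "\<dots> = (\<Sum>s<n. g \<cdot> (i s \<cdot> p s))" using mem by (intro Cmp_sum_right[OF g]) auto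
      also have "\<dots> = (\<Sum>s<n. (g \<cdot> i s) \<cdot> p s)"
        by (intro sum.cong refl) (simp add: Cmp_assoc[OF ip(2,1) g])
      finally show ?thesis .
    qed
  qed
qed

lemma onto_at_retract:
  assumes P: "retract_of_power C P Y" and \<xi>: "form X A \<xi>" and onto: "onto_at X A \<xi> P"
  shows "onto_at X A \<xi> Y"
  unfolding onto_at_def
proof (intro allI impI)
  fix \<phi> assume \<phi>: "form X Y \<phi>"
  obtain n i p where ip: "\<And>s. s < (n::nat) \<Longrightarrow> i s \<in> Hom C P Y" "\<And>s. s < n \<Longrightarrow> p s \<in> Hom C Y P"
    "\<And>X f. f \<in> Hom C X Y \<Longrightarrow> f = (\<Sum>s<n. i s \<cdot> (p s \<cdot> f))"
    "\<And>Z g. g \<in> Hom C Y Z \<Longrightarrow> g = (\<Sum>s<n. (g \<cdot> i s) \<cdot> p s)"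
    by (rule retract_expand[OF P]) (rule that)
  have "\<exists>g\<in>Hom C P A. \<forall>f\<in>Hom C X P. \<phi> (i s \<cdot> f) = \<xi> (g \<cdot> f)" if "s < n" for s
    using onto form_pullback[OF \<phi> ip(1)[OF that]] unfolding onto_at_def by blast
  then obtain g where g: "\<And>s. s < n \<Longrightarrow> g s \<in> Hom C P A"
    "\<And>s f. \<lbrakk>s < n; f \<in> Hom C X P\<rbrakk> \<Longrightarrow> \<phi> (i s \<cdot> f) = \<xi> (g s \<cdot> f)" by metis
  have gp: "g s \<cdot> p s \<in> Hom C Y A" if "s < n" for s
    by (rule Cmp_in_Hom[OF ip(2)[OF that] g(1)[OF that]])
  show "\<exists>g\<in>Hom C Y A. \<forall>f\<in>Hom C X Y. \<phi> f = \<xi> (g \<cdot> f)"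
  proof (intro bexI ballI)
    show "(\<Sum>s<n. g s \<cdot> p s) \<in> Hom C Y A" using gp by (intro sum_in_Hom) auto
    fix f assume f: "f \<in> Hom C X Y"
    have pf: "p s \<cdot> f \<in> Hom C X P" if "s < n" for s
      by (rule Cmp_in_Hom[OF f ip(2)[OF that]])
    have "\<phi> f = \<phi> (\<Sum>s<n. i s \<cdot> (p s \<cdot> f))" using ip(3)[OF f] by simp
    also have "\<dots> = (\<Sum>s<n. \<phi> (i s \<cdot> (p s \<cdot> f)))"
      using Cmp_in_Hom[OF pf ip(1)] by (intro vs.linear_form_sum_arg[OF subspace_Hom \<phi>]) auto
    also have "\<dots> = (\<Sum>s<n. \<xi> ((g s \<cdot> p s) \<cdot> f))"
      by (intro sum.cong refl) (simp add: g(2) pf Cmp_assoc[OF f ip(2) g(1)])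
    also have "\<dots> = \<xi> (\<Sum>s<n. (g s \<cdot> p s) \<cdot> f)"
      using Cmp_in_Hom[OF f gp] by (intro vs.linear_form_sum_arg[OF subspace_Hom \<xi>, symmetric]) auto
    also have "(\<Sum>s<n. (g s \<cdot> p s) \<cdot> f) = (\<Sum>s<n. g s \<cdot> p s) \<cdot> f"
      using gp by (intro Cmp_sum_left[OF f, symmetric]) auto
    finally show "\<phi> f = \<xi> ((\<Sum>s<n. g s \<cdot> p s) \<cdot> f)" .
  qed
qed

lemma kernel_at_Cmp:
  assumes g: "g \<in> kernel_at X A \<xi> Y" and h: "h \<in> Hom C Z Y"
  shows "g \<cdot> h \<in> kernel_at X A \<xi> Z"
proof -
  have g': "g \<in> Hom C Y A" using g unfolding kernel_at_def by simp
  show ?thesis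
    using g Cmp_in_Hom[OF h g'] Cmp_in_Hom[OF _ h] Cmp_assoc[OF _ h g']
    unfolding kernel_at_def by simp
qed

lemma kernel_killed_at_retract:
  assumes P: "retract_of_power C P Y" and f: "f \<in> Hom C A A'"
    and kill: "\<And>g. g \<in> kernel_at X A \<xi> P \<Longrightarrow> f \<cdot> g = 0"
    and g: "g \<in> kernel_at X A \<xi> Y"
  shows "f \<cdot> g = 0"
proof -
  obtain n i p where ip: "\<And>s. s < (n::nat) \<Longrightarrow> i s \<in> Hom C P Y" "\<And>s. s < n \<Longrightarrow> p s \<in> Hom C Y P"
    "\<And>X f. f \<in> Hom C X Y \<Longrightarrow> f = (\<Sum>s<n. i s \<cdot> (p s \<cdot> f))"
    "\<And>Z g. g \<in> Hom C Y Z \<Longrightarrow> g = (\<Sum>s<n. (g \<cdot> i s) \<cdot> p s)"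
    by (rule retract_expand[OF P]) (rule that)
  have g': "g \<in> Hom C Y A" using g unfolding kernel_at_def by simp
  have "f \<cdot> g = (\<Sum>s<n. ((f \<cdot> g) \<cdot> i s) \<cdot> p s)" by (rule ip(4)[OF Cmp_in_Hom[OF g' f]])
  also have "\<dots> = 0"
  proof (intro sum.neutral ballI)
    fix s assume "s \<in> {..<n}"
    then have s: "s < n" by simp
    have "f \<cdot> (g \<cdot> i s) = 0" by (rule kill[OF kernel_at_Cmp[OF g ip(1)[OF s]]])
    then show "((f \<cdot> g) \<cdot> i s) \<cdot> p s = 0"
      using Cmp_assoc[OF ip(1)[OF s] g' f] Cmp_zero_left[OF ip(2)[OF s]] by simp
  qed
  finally show ?thesis .
qed

lemma extendsD:
  assumes "extends X A \<xi> f A' \<xi>'"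
  shows "f \<in> Hom C A A'" "form X A' \<xi>'" "h \<in> Hom C X A \<Longrightarrow> \<xi>' (f \<cdot> h) = \<xi> h"
  using assms unfolding extends_def by auto

lemma extends_Cmp:
  assumes "extends X A \<xi> f A' \<xi>'" "extends X A' \<xi>' f' A'' \<xi>''"
  shows "extends X A \<xi> (f' \<cdot> f) A'' \<xi>''"
  using extendsD[OF assms(1)] extendsD[OF assms(2)]
    Cmp_in_Hom[OF extendsD(1)[OF assms(1)] extendsD(1)[OF assms(2)]]
    Cmp_in_Hom[OF _ extendsD(1)[OF assms(1)]]
    Cmp_assoc[OF _ extendsD(1)[OF assms(1)] extendsD(1)[OF assms(2)]]
  unfolding extends_def by simp

lemma extends_value:
  assumes "extends X A \<xi> f A' \<xi>'" "g \<in> Hom C Y A" "h \<in> Hom C X Y"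
  shows "\<xi>' ((f \<cdot> g) \<cdot> h) = \<xi> (g \<cdot> h)"
  using extendsD(3)[OF assms(1) Cmp_in_Hom[OF assms(3,2)]]
    Cmp_assoc[OF assms(3,2) extendsD(1)[OF assms(1)]] by simp

lemma kernel_at_extends:
  assumes ext: "extends X A \<xi> f A' \<xi>'" and g: "g \<in> kernel_at X A \<xi> Y"
  shows "f \<cdot> g \<in> kernel_at X A' \<xi>' Y"
  using g Cmp_in_Hom[OF _ extendsD(1)[OF ext]] extends_value[OF ext, of g Y]
  unfolding kernel_at_def by simp

lemma onto_at_extends:
  assumes ext: "extends X A \<xi> f A' \<xi>'" and onto: "onto_at X A \<xi> Y"
  shows "onto_at X A' \<xi>' Y"
  unfolding onto_at_def
proof (intro allI impI)
  fix \<phi> assume "form X Y \<phi>"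
  then obtain g where g: "g \<in> Hom C Y A" "\<forall>h\<in>Hom C X Y. \<phi> h = \<xi> (g \<cdot> h)"
    using onto unfolding onto_at_def by blast
  then show "\<exists>g\<in>Hom C Y A'. \<forall>h\<in>Hom C X Y. \<phi> h = \<xi>' (g \<cdot> h)"
    using extends_value[OF ext g(1)] Cmp_in_Hom[OF g(1) extendsD(1)[OF ext]]
    by (intro bexI[of _ "f \<cdot> g"]) auto
qed

lemma form_on_direct_sum:
  assumes D: "direct_sum C Xs A i p" and \<phi>: "\<And>s. s < length Xs \<Longrightarrow> form X (Xs ! s) (\<phi> s)"
  obtains \<xi> where "form X A \<xi>"
    "\<And>s. s < length Xs \<Longrightarrow> extends X (Xs ! s) (\<phi> s) (i s) A \<xi>"
proof
  note D = direct_sumD[OF D]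
  let ?\<xi> = "\<lambda>f. \<Sum>s<length Xs. \<phi> s (p s \<cdot> f)"
  show \<xi>: "form X A ?\<xi>"
    using form_pullback[OF \<phi> D(2)] by (intro linear_form_sum) auto
  fix s assume s: "s < length Xs"
  have "?\<xi> (i s \<cdot> h) = \<phi> s h" if h: "h \<in> Hom C X (Xs ! s)" for h
  proof -
    have "?\<xi> (i s \<cdot> h) = (\<Sum>t<length Xs. if t = s then \<phi> s h else 0)"
    proof (intro sum.cong refl)
      fix t assume "t \<in> {..<length Xs}"
      then have t: "t < length Xs" by simp
      show "\<phi> t (p t \<cdot> (i s \<cdot> h)) = (if t = s then \<phi> s h else 0)"
        using Cmp_assoc[OF h D(1)[OF s] D(2)[OF t]] D(3)[OF s] D(4)[OF s t] Cmp_Idn_left[OF h]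
          Cmp_zero_left[OF h] vs.linear_form_zero[OF subspace_Hom \<phi>[OF t]] by auto
    qed
    then show ?thesis using s by simp
  qed
  then show "extends X (Xs ! s) (\<phi> s) (i s) A ?\<xi>"
    unfolding extends_def using \<xi> D(1)[OF s] by blast
qed

lemma Hom_finite_basis:
  assumes "hom_finite C" "vs.subspace V" "V \<subseteq> Hom C X Y"
  obtains bs where "distinct bs" "set bs \<subseteq> V" "vs.independent (set bs)" "V \<subseteq> vs.span (set bs)"
proof -
  obtain B0 where B0: "finite B0" "vs.span B0 = Hom C X Y"
    using assms(1) unfolding hom_finite_def by blast
  then obtain B where "finite B" "vs.independent B" "B \<subseteq> V" "V \<subseteq> vs.span B"
    using vs.subspace_finite_basis[of B0 V] assms(3) by blast
  then show thesis using that finite_distinct_list[of B] by metis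
qed

text \<open>
  Take one copy of \<open>P\<close> for each element of a basis of \<open>Hom X P\<close>, with the coordinate forms on the
  copies: they span the dual of \<open>Hom X P\<close>.
\<close>

lemma onto_at_exists:
  assumes "has_finite_direct_sums C" "hom_finite C"
  obtains A \<xi> where "form X A \<xi>" "onto_at X A \<xi> P"
proof -
  obtain bs where bs: "distinct bs" "set bs \<subseteq> Hom C X P" "vs.independent (set bs)"
    "Hom C X P \<subseteq> vs.span (set bs)"
    by (rule Hom_finite_basis[OF assms(2) subspace_Hom order.refl]) (rule that)
  let ?n = "length bs"
  let ?r = "\<lambda>s h. vs.representation (set bs) h (bs ! s)"
  obtain A i p where D: "direct_sum C (replicate ?n P) A i p"
    using assms(1) unfolding has_finite_direct_sums_def by blast
  have "\<exists>\<xi>. form X A \<xi> \<and> (\<forall>s<?n. extends X P (?r s) (i s) A \<xi>)"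
  proof (rule form_on_direct_sum[OF D, of X ?r])
    show "form X (replicate ?n P ! s) (?r s)" if "s < length (replicate ?n P)" for s
      using vs.representation_linear_form[OF bs(3,4)] that by simp
    show ?thesis if "form X A \<xi>" "\<And>s. s < length (replicate ?n P) \<Longrightarrow>
        extends X (replicate ?n P ! s) (?r s) (i s) A \<xi>" for \<xi>
      using that(1) that(2) by (intro exI[of _ \<xi>]) (simp add: nth_replicate)
  qed
  then obtain \<xi> where \<xi>: "form X A \<xi>" and
    ext: "\<And>s. s < ?n \<Longrightarrow> extends X P (?r s) (i s) A \<xi>" by blast
  have "onto_at X A \<xi> P"
    unfolding onto_at_def
  proof (intro allI impI bexI ballI)
    fix \<phi> assume \<phi>: "form X P \<phi>"
    let ?g = "\<Sum>s<?n. Scl C (\<phi> (bs ! s)) (i s)"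
    have mem: "Scl C (\<phi> (bs ! s)) (i s) \<in> Hom C P A" if "s < ?n" for s
      using Scl_in_Hom[OF extendsD(1)[OF ext[OF that]]] .
    then show g: "?g \<in> Hom C P A" by (intro sum_in_Hom) auto
    fix h assume h: "h \<in> Hom C X P"
    have "\<xi> (?g \<cdot> h) = \<xi> (\<Sum>s<?n. Scl C (\<phi> (bs ! s)) (i s) \<cdot> h)"
      using mem by (subst Cmp_sum_left[OF h]) auto
    also have "\<dots> = (\<Sum>s<?n. \<xi> (Scl C (\<phi> (bs ! s)) (i s) \<cdot> h))"
      using Cmp_in_Hom[OF h mem] by (intro vs.linear_form_sum_arg[OF subspace_Hom \<xi>]) auto
    also have "\<dots> = (\<Sum>s<?n. ?r s h * \<phi> (bs ! s))"
    proof (intro sum.cong refl)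
      fix s assume "s \<in> {..<?n}"
      then have e: "extends X P (?r s) (i s) A \<xi>" using ext by simp
      show "\<xi> (Scl C (\<phi> (bs ! s)) (i s) \<cdot> h) = ?r s h * \<phi> (bs ! s)"
        using Cmp_Scl_left[OF h extendsD(1)[OF e]] extendsD(3)[OF e h]
          linear_form_scale[OF \<xi> Cmp_in_Hom[OF h extendsD(1)[OF e]]] by simp
    qed
    also have "\<dots> = (\<Sum>b\<in>set bs. vs.representation (set bs) h b * \<phi> b)"
      by (rule sum.reindex_bij_betw[OF bij_betw_nth[OF bs(1) refl refl]])
    also have "\<dots> = \<phi> h"
      using vs.linear_form_representation[OF subspace_Hom \<phi> bs(3) _ bs(2)] h bs(4) by auto
    finally show "\<phi> h = \<xi> (?g \<cdot> h)" by simp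
  qed
  then show thesis using that \<xi> by blast
qed

lemma kernel_at_subspace:
  assumes \<xi>: "form X A \<xi>"
  shows "vs.subspace (kernel_at X A \<xi> P)"
proof (rule vs.subspaceI)
  show "0 \<in> kernel_at X A \<xi> P"
    unfolding kernel_at_def
    using Cmp_zero_left vs.linear_form_zero[OF subspace_Hom \<xi>] by auto
next
  fix f g assume "f \<in> kernel_at X A \<xi> P" "g \<in> kernel_at X A \<xi> P"
  then have fg: "f \<in> Hom C P A" "g \<in> Hom C P A"
    and zero: "\<And>h. h \<in> Hom C X P \<Longrightarrow> \<xi> (f \<cdot> h) = 0 \<and> \<xi> (g \<cdot> h) = 0"
    unfolding kernel_at_def by auto
  have "\<xi> ((f + g) \<cdot> h) = 0" if h: "h \<in> Hom C X P" for h
    using linear_form_add[OF form_pullback_arg[OF \<xi> h] fg] zero[OF h] by simp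
  then show "f + g \<in> kernel_at X A \<xi> P"
    unfolding kernel_at_def using add_in_Hom[OF fg] by blast
next
  fix a g assume "g \<in> kernel_at X A \<xi> P"
  then have g: "g \<in> Hom C P A" and zero: "\<And>h. h \<in> Hom C X P \<Longrightarrow> \<xi> (g \<cdot> h) = 0"
    unfolding kernel_at_def by auto
  have "\<xi> (Scl C a g \<cdot> h) = 0" if h: "h \<in> Hom C X P" for h
    using linear_form_scale[OF form_pullback_arg[OF \<xi> h] g] zero[OF h] by simp
  then show "Scl C a g \<in> kernel_at X A \<xi> P"
    unfolding kernel_at_def using Scl_in_Hom[OF g] by blast
qed

text \<open>
  A finite spanning set of the kernel at \<open>P\<close> assembles to a morphism \<open>\<beta>\<close> from a power of \<open>P\<close> to
  \<open>A\<close>. Its weak cokernel \<open>f\<close> kills the kernel, and \<open>\<xi>\<close> extends along \<open>f\<close> because it vanishes on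
  \<open>\<beta>\<close>.
\<close>

lemma kernel_killing:
  assumes additive: "has_finite_direct_sums C" and finite: "hom_finite C"
    and weak_cokernels: "\<And>X Y u. u \<in> Hom C X Y \<Longrightarrow> \<exists>Z v. exact_pair C X Y Z u v"
    and \<xi>: "form X A \<xi>"
  obtains A' f \<xi>' where "extends X A \<xi> f A' \<xi>'" "\<And>g. g \<in> kernel_at X A \<xi> P \<Longrightarrow> f \<cdot> g = 0"
proof -
  have KH: "kernel_at X A \<xi> P \<subseteq> Hom C P A" unfolding kernel_at_def by auto
  obtain ks where ks: "set ks \<subseteq> kernel_at X A \<xi> P" "kernel_at X A \<xi> P \<subseteq> vs.span (set ks)"
    by (rule Hom_finite_basis[OF finite kernel_at_subspace[OF \<xi>] KH]) (rule that)
  let ?n = "length ks"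
  have ks_mem: "ks ! s \<in> kernel_at X A \<xi> P" if "s < ?n" for s
    by (rule subsetD[OF ks(1) nth_mem[OF that]])
  have ksH: "ks ! s \<in> Hom C P A" if "s < ?n" for s
    by (rule subsetD[OF KH ks_mem[OF that]])
  have ks0: "\<xi> (ks ! s \<cdot> f) = 0" if "s < ?n" "f \<in> Hom C X P" for s f
    using ks_mem[OF that(1)] that(2) unfolding kernel_at_def by simp
  obtain B i p where D: "direct_sum C (replicate ?n P) B i p"
    using additive unfolding has_finite_direct_sums_def by blast
  have ip: "i s \<in> Hom C P B" "p s \<in> Hom C B P" if "s < ?n" for s
    using direct_sumD(1,2)[OF D, of s] that by simp_all
  have "\<exists>\<beta>\<in>Hom C B A. \<forall>s<?n. \<beta> \<cdot> i s = ks ! s"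
  proof (rule direct_sum_cotuple[OF D, of "\<lambda>s. ks ! s" A])
    show "ks ! s \<in> Hom C (replicate ?n P ! s) A" if "s < length (replicate ?n P)" for s
      using ksH that by simp
    show ?thesis if "\<beta> \<in> Hom C B A"
      "\<And>s. s < length (replicate ?n P) \<Longrightarrow> \<beta> \<cdot> i s = ks ! s" for \<beta>
      using that(1) that(2) by (intro bexI[of _ \<beta>]) simp_all
  qed
  then obtain \<beta> where \<beta>: "\<beta> \<in> Hom C B A" and \<beta>i: "\<And>s. s < ?n \<Longrightarrow> \<beta> \<cdot> i s = ks ! s" by blast
  have Id: "(\<Sum>s<?n. i s \<cdot> p s) = Idn C B" using direct_sumD(5)[OF D] by simp
  obtain A' f where ex: "exact_pair C B A A' \<beta> f" using weak_cokernels[OF \<beta>] by blast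
  note f = exact_pairD(2)[OF ex]
  have "\<xi> (\<beta> \<cdot> h) = 0" if h: "h \<in> Hom C X B" for h
  proof -
    have mem: "i s \<cdot> p s \<in> Hom C B B" "p s \<cdot> h \<in> Hom C X P" if "s < ?n" for s
      by (rule Cmp_in_Hom[OF ip(2)[OF that] ip(1)[OF that]], rule Cmp_in_Hom[OF h ip(2)[OF that]])
    have "\<beta> = (\<Sum>s<?n. \<beta> \<cdot> (i s \<cdot> p s))"
      using Cmp_sum_right[OF \<beta>, of "{..<?n}" "\<lambda>s. i s \<cdot> p s"] mem(1) Id Cmp_Idn_right[OF \<beta>] by auto
    also have "\<dots> = (\<Sum>s<?n. ks ! s \<cdot> p s)"
      using \<beta>i by (intro sum.cong refl) (simp add: Cmp_assoc[OF ip(2,1) \<beta>, symmetric])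
    finally have "\<beta> \<cdot> h = (\<Sum>s<?n. (ks ! s \<cdot> p s) \<cdot> h)"
      using Cmp_sum_left[OF h, of "{..<?n}" "\<lambda>s. ks ! s \<cdot> p s"] Cmp_in_Hom[OF ip(2) ksH] by auto
    also have "\<dots> = (\<Sum>s<?n. ks ! s \<cdot> (p s \<cdot> h))"
      by (intro sum.cong refl) (simp add: Cmp_assoc[OF h ip(2) ksH])
    finally have "\<xi> (\<beta> \<cdot> h) = (\<Sum>s<?n. \<xi> (ks ! s \<cdot> (p s \<cdot> h)))"
      using vs.linear_form_sum_arg[OF subspace_Hom \<xi>, of "{..<?n}" "\<lambda>s. ks ! s \<cdot> (p s \<cdot> h)"]
        Cmp_in_Hom[OF mem(2) ksH] by auto
    then show ?thesis using ks0 mem(2) by simp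
  qed
  then obtain \<xi>' where \<xi>': "form X A' \<xi>'" "\<And>h. h \<in> Hom C X A \<Longrightarrow> \<xi>' (f \<cdot> h) = \<xi> h"
    using form_extend[OF ex \<xi>] by blast
  have f_ks: "f \<cdot> k = 0" if k: "k \<in> set ks" for k
  proof -
    obtain s where s: "s < ?n" "k = ks ! s" using k by (metis in_set_conv_nth)
    then show ?thesis
      using \<beta>i Cmp_assoc[OF ip(1)[OF s(1)] \<beta> f] exact_pairD(3)[OF ex]
        Cmp_zero_left[OF ip(1)[OF s(1)]]
      by simp
  qed
  show thesis
  proof (rule that)
    show "extends X A \<xi> f A' \<xi>'" unfolding extends_def using f \<xi>' by blast
    fix g assume "g \<in> kernel_at X A \<xi> P"
    then have "g \<in> vs.span (set ks)" using ks(2) by blast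
    then have "g \<in> Hom C P A \<and> f \<cdot> g = 0"
    proof (induction rule: vs.span_induct_alt)
      case base
      show ?case using Cmp_zero_right[OF f] by simp
    next
      case (step c k g)
      then have "k \<in> Hom C P A" using ks(1) KH by blast
      then show ?case
        using step f_ks[of k] Cmp_add_right[OF Scl_in_Hom[of k P A c] _ f, of g]
          Cmp_Scl_right[of k P A f A' c] f
        by (simp add: add_in_Hom Scl_in_Hom)
    qed
    then show "f \<cdot> g = 0" by simp
  qed
qed

end

text \<open>
  The hypotheses of the representability theorem. Every object has a presentation by \<open>add P\<close> up to
  an error term \<open>Q1\<close>, and the error is controlled by a further morphism inside \<open>add Q\<close>.
\<close>

locale resolved_category = linear_category C
  for C :: "('k::field, 'o, 'm::ab_group_add, 'z) lin_cat_scheme" (structure) +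
  fixes P Q :: 'o
  assumes additive: "has_finite_direct_sums C"
    and finite: "hom_finite C"
    and complete: "idempotent_complete C"
    and weak_cokernels: "u \<in> Hom C X Y \<Longrightarrow> \<exists>Z v. exact_pair C X Y Z u v"
    and resolution: "\<exists>T1 T0 Q1 Q0 a b c d.
      retract_of_power C P T1 \<and> retract_of_power C P T0 \<and>
      retract_of_power C Q Q1 \<and> retract_of_power C Q Q0 \<and>
      exact_pair C T1 T0 Y a b \<and> exact_pair C T0 Y Q1 b c \<and> exact_pair C Y Q1 Q0 c d"
begin

lemma onto_both_exists:
  obtains A \<xi> where "form X A \<xi>" "onto_at X A \<xi> P" "onto_at X A \<xi> Q"
proof -
  obtain A1 \<xi>1 where 1: "form X A1 \<xi>1" "onto_at X A1 \<xi>1 P"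
    by (rule onto_at_exists[OF additive finite])
  obtain A2 \<xi>2 where 2: "form X A2 \<xi>2" "onto_at X A2 \<xi>2 Q"
    by (rule onto_at_exists[OF additive finite])
  obtain A i p where D: "direct_sum C [A1, A2] A i p"
    using additive unfolding has_finite_direct_sums_def by blast
  show thesis
  proof (rule form_on_direct_sum[OF D, of X "\<lambda>s. [\<xi>1, \<xi>2] ! s"])
    show "form X ([A1, A2] ! s) ([\<xi>1, \<xi>2] ! s)" if "s < length [A1, A2]" for s
      using that 1(1) 2(1) by (cases s) auto
    fix \<xi>
    assume \<xi>: "form X A \<xi>"
      "\<And>s. s < length [A1, A2] \<Longrightarrow> extends X ([A1, A2] ! s) ([\<xi>1, \<xi>2] ! s) (i s) A \<xi>"
    have "extends X A1 \<xi>1 (i 0) A \<xi>" "extends X A2 \<xi>2 (i 1) A \<xi>"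
      using \<xi>(2)[of 0] \<xi>(2)[of 1] by simp_all
    then show thesis using that \<xi>(1) onto_at_extends 1(2) 2(2) by blast
  qed
qed

text \<open>
  Let \<open>\<phi>\<close> be a form on \<open>Hom X Y\<close> and let \<open>T1 \<rightarrow> T0 \<rightarrow> Y \<rightarrow> Q1\<close> start a resolution. On \<open>T0\<close> the form
  comes from some \<open>g: T0 \<rightarrow> A\<close>. On \<open>T1\<close> this \<open>g\<close> lies in the kernel, hence it vanishes there after
  composition with \<open>f\<close>, so it extends to a morphism \<open>Y \<rightarrow> A'\<close>. What remains of \<open>\<phi>\<close> vanishes on
  \<open>T0\<close>, so it comes from \<open>Q1\<close>, where \<open>\<xi>'\<close> is onto.
\<close>

lemma onto_everywhere:
  assumes ext: "extends X A \<xi> f A' \<xi>'" and onto: "onto_at X A \<xi> P" "onto_at X A \<xi> Q"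
    and kill: "\<And>g. g \<in> kernel_at X A \<xi> P \<Longrightarrow> f \<cdot> g = 0" and \<xi>: "form X A \<xi>"
  shows "onto_at X A' \<xi>' Y"
  unfolding onto_at_def
proof (intro allI impI)
  fix \<phi> assume \<phi>: "form X Y \<phi>"
  obtain T1 T0 Q1 Q0 a b c d where res: "retract_of_power C P T1" "retract_of_power C P T0"
    "retract_of_power C Q Q1" "exact_pair C T1 T0 Y a b" "exact_pair C T0 Y Q1 b c"
    using resolution[of Y] by blast
  note a = exact_pairD(1)[OF res(4)] and b = exact_pairD(2)[OF res(4)] and c =
    exact_pairD(2)[OF res(5)]
  note f = extendsD(1)[OF ext] and \<xi>' = extendsD(2)[OF ext]
  obtain g where g: "g \<in> Hom C T0 A" "\<And>h. h \<in> Hom C X T0 \<Longrightarrow> \<phi> (b \<cdot> h) = \<xi> (g \<cdot> h)"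
    using onto_at_retract[OF res(2) \<xi> onto(1)] form_pullback[OF \<phi> b] unfolding onto_at_def by blast
  have "\<xi> ((g \<cdot> a) \<cdot> h) = 0" if h: "h \<in> Hom C X T1" for h
    using g(2)[OF Cmp_in_Hom[OF h a]] Cmp_assoc[OF h a g(1)] Cmp_assoc[OF h a b]
      exact_pairD(3)[OF res(4)]
      Cmp_zero_left[OF h] vs.linear_form_zero[OF subspace_Hom \<phi>] by simp
  then have ker: "g \<cdot> a \<in> kernel_at X A \<xi> T1"
    unfolding kernel_at_def using Cmp_in_Hom[OF a g(1)] by blast
  have "f \<cdot> (g \<cdot> a) = 0" by (rule kernel_killed_at_retract[OF res(1) f kill ker])
  then have "(f \<cdot> g) \<cdot> a = 0" using Cmp_assoc[OF a g(1) f] by simp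
  then obtain g1 where g1: "g1 \<in> Hom C Y A'" "f \<cdot> g = g1 \<cdot> b"
    using exact_pairD(5)[OF res(4) Cmp_in_Hom[OF g(1) f]] by blast
  let ?\<psi> = "\<lambda>h. \<phi> h - \<xi>' (g1 \<cdot> h)"
  have \<psi>: "form X Y ?\<psi>" by (rule linear_form_minus[OF \<phi> form_pullback[OF \<xi>' g1(1)]])
  have vanish: "?\<psi> (b \<cdot> h) = 0" if h: "h \<in> Hom C X T0" for h
    using g(2)[OF h] extends_value[OF ext g(1) h] g1(2) Cmp_assoc[OF h b g1(1)] by simp
  obtain \<chi> where \<chi>: "form X Q1 \<chi>" "\<And>h. h \<in> Hom C X Y \<Longrightarrow> \<chi> (c \<cdot> h) = ?\<psi> h"
    by (rule form_extend[OF res(5) \<psi> vanish]) (assumption, rule that)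
  have "onto_at X A' \<xi>' Q1"
    by (rule onto_at_retract[OF res(3) \<xi>' onto_at_extends[OF ext onto(2)]])
  then obtain g2 where g2: "g2 \<in> Hom C Q1 A'" "\<And>h. h \<in> Hom C X Q1 \<Longrightarrow> \<chi> h = \<xi>' (g2 \<cdot> h)"
    using \<chi>(1) unfolding onto_at_def by blast
  show "\<exists>g\<in>Hom C Y A'. \<forall>h\<in>Hom C X Y. \<phi> h = \<xi>' (g \<cdot> h)"
  proof (intro bexI ballI)
    show "g1 + g2 \<cdot> c \<in> Hom C Y A'" using g1(1) Cmp_in_Hom[OF c g2(1)] by (rule add_in_Hom)
    fix h assume h: "h \<in> Hom C X Y"
    have "(g1 + g2 \<cdot> c) \<cdot> h = g1 \<cdot> h + g2 \<cdot> (c \<cdot> h)"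
      using Cmp_add_left[OF h g1(1) Cmp_in_Hom[OF c g2(1)]] Cmp_assoc[OF h c g2(1)] by simp
    then show "\<phi> h = \<xi>' ((g1 + g2 \<cdot> c) \<cdot> h)"
      using linear_form_add[OF \<xi>' Cmp_in_Hom[OF h g1(1)] Cmp_in_Hom[OF Cmp_in_Hom[OF h c] g2(1)]]
        \<chi>(2)[OF h] g2(2)[OF Cmp_in_Hom[OF h c]] by simp
  qed
qed

text \<open>
  Let \<open>g: Y \<rightarrow> A\<close> lie in the kernel and let \<open>T0 \<rightarrow> Y \<rightarrow> Q1 \<rightarrow> Q0\<close> be the end of a resolution. The
  first step kills \<open>g\<close> on \<open>T0\<close>, so \<open>f g\<close> factors through some \<open>g1: Q1 \<rightarrow> A'\<close>. Its form vanishes on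
  \<open>Y\<close>, so it comes from \<open>Q0\<close>, where \<open>\<xi>'\<close> is onto. Therefore \<open>g1\<close> can be changed by a morphism that
  factors through \<open>Q0\<close>, without an effect on \<open>f g\<close>, so that it lies in the kernel at \<open>Q1\<close>, and the
  second step kills it.
\<close>

lemma kernel_killed_everywhere:
  assumes ext: "extends X A \<xi> f A' \<xi>'" "extends X A' \<xi>' f' A'' \<xi>''" and onto: "onto_at X A' \<xi>' Q"
    and kill: "\<And>g. g \<in> kernel_at X A \<xi> P \<Longrightarrow> f \<cdot> g = 0" "\<And>g. g \<in> kernel_at X A' \<xi>' Q \<Longrightarrow> f' \<cdot> g = 0"
    and g: "g \<in> kernel_at X A \<xi> Y"
  shows "(f' \<cdot> f) \<cdot> g = 0"
proof -
  obtain T1 T0 Q1 Q0 a b c d where res: "retract_of_power C P T0"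
    "retract_of_power C Q Q1" "retract_of_power C Q Q0" "exact_pair C T0 Y Q1 b c"
      "exact_pair C Y Q1 Q0 c d"
    using resolution[of Y] by blast
  note b = exact_pairD(1)[OF res(4)] and c = exact_pairD(1)[OF res(5)] and d =
    exact_pairD(2)[OF res(5)]
  note f = extendsD(1)[OF ext(1)] and \<xi>' = extendsD(2)[OF ext(1)] and f' = extendsD(1)[OF ext(2)]
  have gH: "g \<in> Hom C Y A" using g unfolding kernel_at_def by simp
  have "f \<cdot> (g \<cdot> b) = 0"
    by (rule kernel_killed_at_retract[OF res(1) f kill(1) kernel_at_Cmp[OF g b]])
  then have "(f \<cdot> g) \<cdot> b = 0" using Cmp_assoc[OF b gH f] by simp
  then obtain g1 where g1: "g1 \<in> Hom C Q1 A'" "f \<cdot> g = g1 \<cdot> c"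
    using exact_pairD(5)[OF res(4) Cmp_in_Hom[OF gH f]] by blast
  have vanish: "\<xi>' (g1 \<cdot> (c \<cdot> h)) = 0" if h: "h \<in> Hom C X Y" for h
  proof -
    have "\<xi>' ((f \<cdot> g) \<cdot> h) = 0"
      using kernel_at_extends[OF ext(1) g] h unfolding kernel_at_def by blast
    then show ?thesis using g1(2) Cmp_assoc[OF h c g1(1)] by simp
  qed
  obtain \<chi> where \<chi>: "form X Q0 \<chi>" "\<And>h. h \<in> Hom C X Q1 \<Longrightarrow> \<chi> (d \<cdot> h) = \<xi>' (g1 \<cdot> h)"
    by (rule form_extend[OF res(5) form_pullback[OF \<xi>' g1(1)] vanish]) (assumption, rule that)
  obtain g2 where g2: "g2 \<in> Hom C Q0 A'" "\<And>h. h \<in> Hom C X Q0 \<Longrightarrow> \<chi> h = \<xi>' (g2 \<cdot> h)"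
    using onto_at_retract[OF res(3) \<xi>' onto] \<chi>(1) unfolding onto_at_def by blast
  note g2d = Cmp_in_Hom[OF d g2(1)]
  have "\<xi>' ((g1 - g2 \<cdot> d) \<cdot> h) = 0" if h: "h \<in> Hom C X Q1" for h
    using Cmp_diff_left[OF h g1(1) g2d] Cmp_assoc[OF h d g2(1)] \<chi>(2)[OF h]
      g2(2)[OF Cmp_in_Hom[OF h d]]
      vs.linear_form_diff[OF subspace_Hom \<xi>' Cmp_in_Hom[OF h g1(1)] Cmp_in_Hom[OF h g2d]] by simp
  then have ker: "g1 - g2 \<cdot> d \<in> kernel_at X A' \<xi>' Q1"
    unfolding kernel_at_def using diff_in_Hom[OF g1(1) g2d] by blast
  have "f' \<cdot> (g1 - g2 \<cdot> d) = 0" by (rule kernel_killed_at_retract[OF res(2) f' kill(2) ker])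
  then have "f' \<cdot> g1 = f' \<cdot> (g2 \<cdot> d)" using Cmp_diff_right[OF g1(1) g2d f'] by simp
  then have "f' \<cdot> (f \<cdot> g) = (f' \<cdot> (g2 \<cdot> d)) \<cdot> c"
    using g1(2) Cmp_assoc[OF c g1(1) f'] by simp
  also have "\<dots> = f' \<cdot> (g2 \<cdot> (d \<cdot> c))" using Cmp_assoc[OF c g2d f'] Cmp_assoc[OF c d g2(1)] by simp
  also have "\<dots> = 0" using exact_pairD(3)[OF res(5)] Cmp_zero_right[OF g2(1)] Cmp_zero_right[OF f']
    by simp
  finally show ?thesis using Cmp_assoc[OF gH f f'] by simp
qed

text \<open>
  Kill the kernel at \<open>P\<close>, at \<open>P\<close> again and at \<open>Q\<close>. The transformation of \<open>\<xi>1\<close> is onto everywhere,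
  and its kernel dies under \<open>f: A1 \<rightarrow> A3\<close>. Lifting \<open>\<xi>3\<close> along \<open>\<xi>1\<close> gives \<open>e: A3 \<rightarrow> A1\<close> with \<open>f e f =
  f\<close>, and the image of the idempotent \<open>f e\<close> represents the dual of \<open>Hom(X,-)\<close>.
\<close>

theorem dual_representable: "\<exists>S \<xi>. represents X S \<xi>"
proof -
  note killing = kernel_killing[OF additive finite weak_cokernels]
  obtain A0 \<xi>0 where 0: "form X A0 \<xi>0" "onto_at X A0 \<xi>0 P" "onto_at X A0 \<xi>0 Q"
    by (rule onto_both_exists)
  obtain A1 f1 \<xi>1 where 1: "extends X A0 \<xi>0 f1 A1 \<xi>1" "\<And>g. g \<in> kernel_at X A0 \<xi>0 P \<Longrightarrow> f1 \<cdot> g = 0"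
    by (rule killing[OF _ 0(1)]) (assumption, rule that)
  note \<xi>1 = extendsD(2)[OF 1(1)]
  obtain A2 f2 \<xi>2 where 2: "extends X A1 \<xi>1 f2 A2 \<xi>2" "\<And>g. g \<in> kernel_at X A1 \<xi>1 P \<Longrightarrow> f2 \<cdot> g = 0"
    by (rule killing[OF _ \<xi>1]) (assumption, rule that)
  obtain A3 f3 \<xi>3 where 3: "extends X A2 \<xi>2 f3 A3 \<xi>3" "\<And>g. g \<in> kernel_at X A2 \<xi>2 Q \<Longrightarrow> f3 \<cdot> g = 0"
    by (rule killing[OF _ extendsD(2)[OF 2(1)]]) (assumption, rule that)
  have onto: "onto_at X A1 \<xi>1 Y" for Y by (rule onto_everywhere[OF 1(1) 0(2,3) 1(2) 0(1)])
  define f where "f = f3 \<cdot> f2"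
  have killed: "f \<cdot> g = 0" if "g \<in> kernel_at X A1 \<xi>1 Y" for g Y
    unfolding f_def
      by (rule kernel_killed_everywhere[OF 2(1) 3(1) onto_at_extends[OF 2(1) onto] 2(2) 3(2) that])
  have ext: "extends X A1 \<xi>1 f A3 \<xi>3" unfolding f_def by (rule extends_Cmp[OF 2(1) 3(1)])
  note f = extendsD(1)[OF ext] and \<xi>3 = extendsD(2)[OF ext]
  obtain e where e: "e \<in> Hom C A3 A1" "\<And>h. h \<in> Hom C X A3 \<Longrightarrow> \<xi>3 h = \<xi>1 (e \<cdot> h)"
    using onto[of A3] \<xi>3 unfolding onto_at_def by blast
  have ef: "e \<cdot> f \<in> Hom C A1 A1" and fe: "f \<cdot> e \<in> Hom C A3 A3"
    using Cmp_in_Hom[OF f e(1)] Cmp_in_Hom[OF e(1) f] by auto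
  have "\<xi>1 ((Idn C A1 - e \<cdot> f) \<cdot> h) = 0" if h: "h \<in> Hom C X A1" for h
    using Cmp_diff_left[OF h Idn_in_Hom ef] Cmp_Idn_left[OF h] Cmp_assoc[OF h f e(1)]
      vs.linear_form_diff[OF subspace_Hom \<xi>1 h Cmp_in_Hom[OF h ef]]
      e(2)[OF Cmp_in_Hom[OF h f]] extendsD(3)[OF ext h] by simp
  then have "Idn C A1 - e \<cdot> f \<in> kernel_at X A1 \<xi>1 A1"
    unfolding kernel_at_def using diff_in_Hom[OF Idn_in_Hom ef] by blast
  then have "f \<cdot> (Idn C A1 - e \<cdot> f) = 0" by (rule killed)
  then have fef: "f \<cdot> (e \<cdot> f) = f"
    using Cmp_diff_right[OF Idn_in_Hom ef f] Cmp_Idn_right[OF f] by simp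
  have "(f \<cdot> e) \<cdot> (f \<cdot> e) = f \<cdot> e"
    using Cmp_assoc[OF fe e(1) f] Cmp_assoc[OF e(1) f e(1)] Cmp_assoc[OF e(1) ef f] fef by simp
  then obtain S i p where S: "i \<in> Hom C S A3" "p \<in> Hom C A3 S" "p \<cdot> i = Idn C S" "i \<cdot> p = f \<cdot> e"
    using complete fe unfolding idempotent_complete_def splits_def by blast
  have fe_i: "(f \<cdot> e) \<cdot> i = i"
    using S(3) Cmp_assoc[OF S(1,2,1)] Cmp_Idn_right[OF S(1)] by (simp flip: S(4))
  have \<xi>3_fe: "\<xi>3 ((f \<cdot> e) \<cdot> h) = \<xi>3 h" if h: "h \<in> Hom C X A3" for h
    using Cmp_assoc[OF h e(1) f] extendsD(3)[OF ext Cmp_in_Hom[OF h e(1)]] e(2)[OF h] by simp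
  let ?\<xi> = "\<lambda>h. \<xi>3 (i \<cdot> h)"
  have "represents X S ?\<xi>"
    unfolding represents_def
  proof (intro conjI allI)
    show "form X S ?\<xi>" by (rule form_pullback[OF \<xi>3 S(1)])
    fix Y
    show "onto_at X S ?\<xi> Y"
      unfolding onto_at_def
    proof (intro allI impI)
      fix \<phi> assume "form X Y \<phi>"
      then obtain g where g: "g \<in> Hom C Y A3" "\<And>h. h \<in> Hom C X Y \<Longrightarrow> \<phi> h = \<xi>3 (g \<cdot> h)"
        using onto_at_extends[OF ext onto[of Y]] unfolding onto_at_def by blast
      have "\<xi>3 (i \<cdot> ((p \<cdot> g) \<cdot> h)) = \<phi> h" if h: "h \<in> Hom C X Y" for h
        using Cmp_assoc[OF h g(1) S(2)] Cmp_assoc[OF Cmp_in_Hom[OF h g(1)] S(2,1)] S(4)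
          \<xi>3_fe[OF Cmp_in_Hom[OF h g(1)]] g(2)[OF h] by simp
      then show "\<exists>g\<in>Hom C Y S. \<forall>h\<in>Hom C X Y. \<phi> h = \<xi>3 (i \<cdot> (g \<cdot> h))"
        using Cmp_in_Hom[OF g(1) S(2)] by metis
    qed
    show "kernel_at X S ?\<xi> Y \<subseteq> {0}"
    proof
      fix g assume "g \<in> kernel_at X S ?\<xi> Y"
      then have g: "g \<in> Hom C Y S" and zero: "\<And>h. h \<in> Hom C X Y \<Longrightarrow> \<xi>3 (i \<cdot> (g \<cdot> h)) = 0"
        unfolding kernel_at_def by auto
      have ig: "i \<cdot> g \<in> Hom C Y A3" using Cmp_in_Hom[OF g S(1)] .
      have eig: "e \<cdot> (i \<cdot> g) \<in> Hom C Y A1" using Cmp_in_Hom[OF ig e(1)] .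
      have "\<xi>1 ((e \<cdot> (i \<cdot> g)) \<cdot> h) = 0" if h: "h \<in> Hom C X Y" for h
        using Cmp_assoc[OF h ig e(1)] Cmp_assoc[OF h g S(1)] e(2)[OF Cmp_in_Hom[OF h ig]]
          zero[OF h] by simp
      then have "f \<cdot> (e \<cdot> (i \<cdot> g)) = 0"
        using killed[of "e \<cdot> (i \<cdot> g)" Y] eig unfolding kernel_at_def by blast
      then have "i \<cdot> g = 0" using Cmp_assoc[OF ig e(1) f] Cmp_assoc[OF g S(1) fe] fe_i by simp
      then have "p \<cdot> (i \<cdot> g) = 0" using Cmp_zero_right[OF S(2)] by simp
      then show "g \<in> {0}" using Cmp_assoc[OF g S(1,2)] S(3) Cmp_Idn_left[OF g] by simp
    qed
  qed
  then show ?thesis by blast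
qed

end

section \<open>Equivalences of categories\<close>

definition fully_faithful :: "('k, 'o, 'm, 'z) lin_cat_scheme \<Rightarrow> ('o, 'm) endofunctor \<Rightarrow> bool" where
  "fully_faithful C F \<longleftrightarrow>
     (\<forall>X Y. bij_betw (FMor F X Y) (Hom C X Y) (Hom C (FOb F X) (FOb F Y)))"

definition essentially_surjective ::
  "('k, 'o, 'm, 'z) lin_cat_scheme \<Rightarrow> ('o, 'm) endofunctor \<Rightarrow> bool" where
  "essentially_surjective C F \<longleftrightarrow> (\<forall>Z. \<exists>X f. is_iso C (FOb F X) Z f)"

lemma is_functorD:
  assumes "is_functor C F"
  shows "f \<in> Hom C X Y \<Longrightarrow> FMor F X Y f \<in> Hom C (FOb F X) (FOb F Y)"
    and "FMor F X X (Idn C X) = Idn C (FOb F X)"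
    and "\<lbrakk>f \<in> Hom C X Y; g \<in> Hom C Y Z\<rbrakk> \<Longrightarrow> FMor F X Z (g \<cdot>\<^bsub>C\<^esub> f) = FMor F Y Z g \<cdot>\<^bsub>C\<^esub> FMor F X Y f"
  using assms unfolding is_functor_def by auto

lemma fully_faithfulD:
  assumes "fully_faithful C F"
  shows "\<lbrakk>f \<in> Hom C X Y; g \<in> Hom C X Y; FMor F X Y f = FMor F X Y g\<rbrakk> \<Longrightarrow> f = g"
    and "h \<in> Hom C (FOb F X) (FOb F Y) \<Longrightarrow> \<exists>f\<in>Hom C X Y. FMor F X Y f = h"
proof -
  have b: "bij_betw (FMor F X Y) (Hom C X Y) (Hom C (FOb F X) (FOb F Y))"
    using assms unfolding fully_faithful_def by blast
  show "f = g" if "f \<in> Hom C X Y" "g \<in> Hom C X Y" "FMor F X Y f = FMor F X Y g"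
    using inj_onD[OF bij_betw_imp_inj_on[OF b] that(3,1,2)] .
  show "\<exists>f\<in>Hom C X Y. FMor F X Y f = h" if "h \<in> Hom C (FOb F X) (FOb F Y)"
    using that bij_betw_imp_surj_on[OF b] by (metis imageE)
qed

context linear_category
begin

lemma iso_cancel_right:
  assumes "is_iso C X Y j" "f \<in> Hom C Y Z" "g \<in> Hom C Y Z" "f \<cdot> j = g \<cdot> j"
  shows "f = g"
proof -
  obtain k where k: "j \<in> Hom C X Y" "k \<in> Hom C Y X" "j \<cdot> k = Idn C Y"
    using is_isoE[OF assms(1)] by blast
  have "f = (f \<cdot> j) \<cdot> k" using Cmp_assoc[OF k(2,1) assms(2)] k(3) Cmp_Idn_right[OF assms(2)] by simp
  also have "\<dots> = g" using assms(4) Cmp_assoc[OF k(2,1) assms(3)] k(3) Cmp_Idn_right[OF assms(3)]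
    by simp
  finally show ?thesis .
qed

lemma iso_cancel_left:
  assumes "is_iso C X Y j" "f \<in> Hom C Z X" "g \<in> Hom C Z X" "j \<cdot> f = j \<cdot> g"
  shows "f = g"
proof -
  obtain k where k: "j \<in> Hom C X Y" "k \<in> Hom C Y X" "k \<cdot> j = Idn C X"
    using is_isoE[OF assms(1)] by blast
  have "f = k \<cdot> (j \<cdot> f)" using Cmp_assoc[OF assms(2) k(1,2)] k(3) Cmp_Idn_left[OF assms(2)] by simp
  also have "\<dots> = g" using assms(4) Cmp_assoc[OF assms(3) k(1,2)] k(3) Cmp_Idn_left[OF assms(3)]
    by simp
  finally show ?thesis .
qed

text \<open>
  This is applied to either of the two natural isomorphisms of an equivalence, hence it shows that
  both functors are faithful.
\<close>

lemma natural_iso_to_identity_faithful: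
  assumes F: "is_functor C F" and \<eta>: "is_natural_iso C (comp_functor G F) id_functor \<eta>"
    and f: "f \<in> Hom C X Y" and g: "g \<in> Hom C X Y" and eq: "FMor F X Y f = FMor F X Y g"
  shows "f = g"
proof -
  have iso: "is_iso C (FOb G (FOb F X)) X (\<eta> X)"
    using \<eta> unfolding is_natural_iso_def comp_functor_def id_functor_def by simp
  have "\<eta> Y \<cdot> FMor G (FOb F X) (FOb F Y) (FMor F X Y h) = h \<cdot> \<eta> X" if "h \<in> Hom C X Y" for h
    using \<eta> that unfolding is_natural_iso_def comp_functor_def id_functor_def by simp
  then have "f \<cdot> \<eta> X = g \<cdot> \<eta> X" using f g eq by metis
  then show ?thesis by (rule iso_cancel_right[OF iso f g])
qed

lemma autoequivalence_fully_faithful: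
  assumes "is_autoequivalence C F"
  shows "fully_faithful C F"
proof -
  obtain G \<eta> \<epsilon> where F: "is_functor C F" and G: "is_functor C G"
    and \<eta>: "is_natural_iso C (comp_functor G F) id_functor \<eta>"
    and \<epsilon>: "is_natural_iso C (comp_functor F G) id_functor \<epsilon>"
    using assms unfolding is_autoequivalence_def by blast
  have "bij_betw (FMor F X Y) (Hom C X Y) (Hom C (FOb F X) (FOb F Y))" for X Y
  proof (rule bij_betwI')
    show "(FMor F X Y f = FMor F X Y g) = (f = g)" if "f \<in> Hom C X Y" "g \<in> Hom C X Y" for f g
      using natural_iso_to_identity_faithful[OF F \<eta> that] by blast
    show "FMor F X Y f \<in> Hom C (FOb F X) (FOb F Y)" if "f \<in> Hom C X Y" for f
      using is_functorD(1)[OF F that] .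
    fix h assume h: "h \<in> Hom C (FOb F X) (FOb F Y)"
    let ?Gh = "FMor G (FOb F X) (FOb F Y) h"
    have Gh: "?Gh \<in> Hom C (FOb G (FOb F X)) (FOb G (FOb F Y))" using is_functorD(1)[OF G h] .
    have iso: "is_iso C (FOb G (FOb F Z)) Z (\<eta> Z)" for Z
      using \<eta> unfolding is_natural_iso_def comp_functor_def id_functor_def by simp
    obtain k where k: "\<eta> X \<in> Hom C (FOb G (FOb F X)) X" "k \<in> Hom C X (FOb G (FOb F X))"
      "k \<cdot> \<eta> X = Idn C (FOb G (FOb F X))"
      using is_isoE[OF iso[of X]] by blast
    have \<eta>Y: "\<eta> Y \<in> Hom C (FOb G (FOb F Y)) Y" using iso[of Y] unfolding is_iso_def by simp
    let ?f = "(\<eta> Y \<cdot> ?Gh) \<cdot> k"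
    have \<eta>Gh: "\<eta> Y \<cdot> ?Gh \<in> Hom C (FOb G (FOb F X)) Y" using Cmp_in_Hom[OF Gh \<eta>Y] .
    have f: "?f \<in> Hom C X Y" using Cmp_in_Hom[OF k(2) \<eta>Gh] .
    have Ff: "FMor F X Y ?f \<in> Hom C (FOb F X) (FOb F Y)" using is_functorD(1)[OF F f] .
    have "\<eta> Y \<cdot> FMor G (FOb F X) (FOb F Y) (FMor F X Y ?f) = ?f \<cdot> \<eta> X"
      using \<eta> f unfolding is_natural_iso_def comp_functor_def id_functor_def by simp
    also have "\<dots> = \<eta> Y \<cdot> ?Gh" using Cmp_assoc[OF k(1,2) \<eta>Gh] k(3) Cmp_Idn_right[OF \<eta>Gh] by simp
    finally have "FMor G (FOb F X) (FOb F Y) (FMor F X Y ?f) = ?Gh"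
      by (rule iso_cancel_left[OF iso is_functorD(1)[OF G Ff] Gh])
    then have "FMor F X Y ?f = h" by (rule natural_iso_to_identity_faithful[OF G \<epsilon> Ff h])
    then show "\<exists>f\<in>Hom C X Y. h = FMor F X Y f" using f by (intro bexI[of _ ?f]) simp_all
  qed
  then show ?thesis unfolding fully_faithful_def by blast
qed

lemma autoequivalence_essentially_surjective:
  assumes "is_autoequivalence C F"
  shows "essentially_surjective C F"
  using assms
  unfolding is_autoequivalence_def essentially_surjective_def is_natural_iso_def comp_functor_def
    id_functor_def
  by simp blast

text \<open>
  The inverse on objects chooses preimages \<open>g Z\<close> up to an isomorphism \<open>\<epsilon> Z\<close>; on morphisms it
  conjugates with \<open>\<epsilon>\<close> and takes the preimage under the fully faithful functor.
\<close>

lemma autoequivalenceI: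
  assumes F: "is_functor C F" and ff: "fully_faithful C F" and es: "essentially_surjective C F"
  shows "is_autoequivalence C F"
proof -
  obtain g \<epsilon> where \<epsilon>: "\<And>Z. is_iso C (FOb F (g Z)) Z (\<epsilon> Z)"
    using es unfolding essentially_surjective_def by metis
  have "\<exists>k\<in>Hom C Z (FOb F (g Z)). k \<cdot> \<epsilon> Z = Idn C (FOb F (g Z)) \<and> \<epsilon> Z \<cdot> k = Idn C Z" for Z
    using \<epsilon>[of Z] unfolding is_iso_def by blast
  then obtain k where k: "\<And>Z. k Z \<in> Hom C Z (FOb F (g Z))" "\<And>Z. k Z \<cdot> \<epsilon> Z = Idn C (FOb F (g Z))"
    "\<And>Z. \<epsilon> Z \<cdot> k Z = Idn C Z" by metis
  have \<epsilon>H: "\<epsilon> Z \<in> Hom C (FOb F (g Z)) Z" for Z using \<epsilon>[of Z] unfolding is_iso_def by simp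
  define L where "L X Y h = (SOME f. f \<in> Hom C X Y \<and> FMor F X Y f = h)" for X Y h
  have L: "L X Y h \<in> Hom C X Y" "FMor F X Y (L X Y h) = h" if "h \<in> Hom C (FOb F X) (FOb F Y)" for
    X Y h
    using someI_ex[of "\<lambda>f. f \<in> Hom C X Y \<and> FMor F X Y f = h"] fully_faithfulD(2)[OF ff that]
    unfolding L_def by blast+
  define conj where "conj Y Z f = k Z \<cdot> (f \<cdot> \<epsilon> Y)" for Y Z f
  have f\<epsilon>: "f \<cdot> \<epsilon> Y \<in> Hom C (FOb F (g Y)) Z" if "f \<in> Hom C Y Z" for f Y Z
    using Cmp_in_Hom[OF \<epsilon>H that] .
  have conj: "conj Y Z f \<in> Hom C (FOb F (g Y)) (FOb F (g Z))" if "f \<in> Hom C Y Z" for f Y Z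
    unfolding conj_def by (rule Cmp_in_Hom[OF f\<epsilon>[OF that] k(1)])
  have \<epsilon>_conj: "\<epsilon> Z \<cdot> conj Y Z f = f \<cdot> \<epsilon> Y" if "f \<in> Hom C Y Z" for f Y Z
    unfolding conj_def using Cmp_assoc[OF f\<epsilon>[OF that] k(1) \<epsilon>H] k(3) Cmp_Idn_left[OF f\<epsilon>[OF that]]
      by simp
  define G where "G = \<lparr>FOb = g, FMor = (\<lambda>Y Z f. L (g Y) (g Z) (conj Y Z f))\<rparr>"
  have GO: "FOb G = g" and GM: "FMor G Y Z f = L (g Y) (g Z) (conj Y Z f)" for Y Z f
    unfolding G_def by simp_all
  have G: "is_functor C G"
    unfolding is_functor_def GO GM
  proof (intro conjI allI ballI)
    show "L (g X) (g Y) (conj X Y f) \<in> Hom C (g X) (g Y)" if "f \<in> Hom C X Y" for X Y f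
      by (rule L(1)[OF conj[OF that]])
    show "L (g X) (g X) (conj X X (Idn C X)) = Idn C (g X)" for X
    proof (rule fully_faithfulD(1)[OF ff L(1)[OF conj[OF Idn_in_Hom]] Idn_in_Hom])
      have "conj X X (Idn C X) = Idn C (FOb F (g X))"
        unfolding conj_def using k(2) Cmp_Idn_left[OF \<epsilon>H] by simp
      then show
        "FMor F (g X) (g X) (L (g X) (g X) (conj X X (Idn C X))) = FMor F (g X) (g X) (Idn C (g X))"
        using L(2)[OF conj[OF Idn_in_Hom[of X]]] is_functorD(2)[OF F, of "g X"] by metis
    qed
    fix X Y Z p q assume p: "p \<in> Hom C X Y" and q: "q \<in> Hom C Y Z"
    note qp = Cmp_in_Hom[OF p q]
    show "L (g X) (g Z) (conj X Z (q \<cdot> p)) = L (g Y) (g Z) (conj Y Z q) \<cdot> L (g X) (g Y) (conj X Y p)"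
    proof (rule fully_faithfulD(1)[OF ff L(1)[OF conj[OF qp]]
        Cmp_in_Hom[OF L(1)[OF conj[OF p]] L(1)[OF conj[OF q]]]])
      have "\<epsilon> Z \<cdot> conj X Z (q \<cdot> p) = \<epsilon> Z \<cdot> (conj Y Z q \<cdot> conj X Y p)"
        using \<epsilon>_conj[OF qp] \<epsilon>_conj[OF p] \<epsilon>_conj[OF q] Cmp_assoc[OF \<epsilon>H p q]
          Cmp_assoc[OF conj[OF p] \<epsilon>H q]
          Cmp_assoc[OF conj[OF p] conj[OF q] \<epsilon>H] by simp
      then have "conj X Z (q \<cdot> p) = conj Y Z q \<cdot> conj X Y p"
        by (rule iso_cancel_left[OF \<epsilon> conj[OF qp] Cmp_in_Hom[OF conj[OF p] conj[OF q]]])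
      then show "FMor F (g X) (g Z) (L (g X) (g Z) (conj X Z (q \<cdot> p)))
        = FMor F (g X) (g Z) (L (g Y) (g Z) (conj Y Z q) \<cdot> L (g X) (g Y) (conj X Y p))"
        using L(2)[OF conj[OF qp]] L(2)[OF conj[OF p]] L(2)[OF conj[OF q]]
          is_functorD(3)[OF F L(1)[OF conj[OF p]] L(1)[OF conj[OF q]]] by simp
    qed
  qed
  have counit: "is_natural_iso C (comp_functor F G) id_functor \<epsilon>"
    unfolding is_natural_iso_def comp_functor_def id_functor_def GO GM
    using \<epsilon> \<epsilon>_conj L(2)[OF conj] by simp
  define \<eta> where "\<eta> X = L (g (FOb F X)) X (\<epsilon> (FOb F X))" for X
  have \<eta>: "\<eta> X \<in> Hom C (g (FOb F X)) X" "FMor F (g (FOb F X)) X (\<eta> X) = \<epsilon> (FOb F X)" for X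
    unfolding \<eta>_def using L[OF \<epsilon>H] by auto
  have "is_iso C (g (FOb F X)) X (\<eta> X)" for X
  proof -
    let ?k = "L X (g (FOb F X)) (k (FOb F X))"
    note K = L[OF k(1)[of "FOb F X"]]
    have "?k \<cdot> \<eta> X = Idn C (g (FOb F X))"
      using K k(2) \<eta> is_functorD(2)[OF F] is_functorD(3)[OF F \<eta>(1) K(1)]
      by (intro fully_faithfulD(1)[OF ff Cmp_in_Hom[OF \<eta>(1) K(1)] Idn_in_Hom]) simp
    moreover have "\<eta> X \<cdot> ?k = Idn C X"
      using K k(3) \<eta> is_functorD(2)[OF F] is_functorD(3)[OF F K(1) \<eta>(1)]
      by (intro fully_faithfulD(1)[OF ff Cmp_in_Hom[OF K(1) \<eta>(1)] Idn_in_Hom]) simp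
    ultimately show ?thesis unfolding is_iso_def using \<eta>(1) K(1) by blast
  qed
  moreover have "\<eta> Y \<cdot> FMor G (FOb F X) (FOb F Y) (FMor F X Y f) = f \<cdot> \<eta> X"
    if f: "f \<in> Hom C X Y" for f X Y
  proof -
    note Ff = is_functorD(1)[OF F f]
    have GFf: "FMor G (FOb F X) (FOb F Y) (FMor F X Y f) \<in> Hom C (g (FOb F X)) (g (FOb F Y))"
      unfolding GM by (rule L(1)[OF conj[OF Ff]])
    show ?thesis
    proof (rule fully_faithfulD(1)[OF ff Cmp_in_Hom[OF GFf \<eta>(1)] Cmp_in_Hom[OF \<eta>(1) f]])
      show "FMor F (g (FOb F X)) Y (\<eta> Y \<cdot> FMor G (FOb F X) (FOb F Y) (FMor F X Y f))
        = FMor F (g (FOb F X)) Y (f \<cdot> \<eta> X)"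
        using is_functorD(3)[OF F GFf \<eta>(1)] is_functorD(3)[OF F \<eta>(1) f] \<eta>(2) \<epsilon>_conj[OF Ff]
          L(2)[OF conj[OF Ff]] by (simp add: GM)
    qed
  qed
  ultimately have "is_natural_iso C (comp_functor G F) id_functor \<eta>"
    unfolding is_natural_iso_def comp_functor_def id_functor_def GO by simp
  then show ?thesis unfolding is_autoequivalence_def using F G counit by blast
qed

end

section \<open>Exact sequences in a triangulated category\<close>

context linear_category
begin

lemma exact_pair_iso_left:
  assumes ex: "exact_pair C X Y Z u v" and j: "is_iso C W X j"
  shows "exact_pair C W Y Z (u \<cdot> j) v"
proof -
  obtain k where k: "j \<in> Hom C W X" "k \<in> Hom C X W" "k \<cdot> j = Idn C W" "j \<cdot> k = Idn C X"
    using j by (rule is_isoE)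
  note u = exact_pairD(1)[OF ex] and v = exact_pairD(2)[OF ex]
  show ?thesis
    unfolding exact_pair_def
  proof (intro conjI allI ballI impI)
    show "u \<cdot> j \<in> Hom C W Y" using Cmp_in_Hom[OF k(1) u] .
    show "v \<in> Hom C Y Z" by (rule v)
    show "v \<cdot> (u \<cdot> j) = 0"
      using Cmp_assoc[OF k(1) u v] exact_pairD(3)[OF ex] Cmp_zero_left[OF k(1)] by simp
  next
    fix U f assume f: "f \<in> Hom C U Y" "v \<cdot> f = 0"
    then obtain g where g: "g \<in> Hom C U X" "f = u \<cdot> g" using exact_pairD(4)[OF ex] by blast
    have kg: "k \<cdot> g \<in> Hom C U W" using Cmp_in_Hom[OF g(1) k(2)] .
    have "(u \<cdot> j) \<cdot> (k \<cdot> g) = f"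
      using Cmp_sandwich[OF g(1) k(2,1) u] k(4) Cmp_Idn_left[OF g(1)] g(2) by simp
    then show "\<exists>g\<in>Hom C U W. f = (u \<cdot> j) \<cdot> g" using kg by metis
  next
    fix U f assume f: "f \<in> Hom C Y U" "f \<cdot> (u \<cdot> j) = 0"
    have "f \<cdot> u = 0"
      using f(2) Cmp_assoc[OF k(1) u f(1)] Cmp_zero_left[OF k(1)]
      by (intro iso_cancel_right[OF j Cmp_in_Hom[OF u f(1)] zero_in_Hom]) simp
    then show "\<exists>g\<in>Hom C Z U. f = g \<cdot> v" using exact_pairD(5)[OF ex f(1)] by blast
  qed
qed

lemma exact_pair_iso_middle:
  assumes ex: "exact_pair C X Y Z u v"
    and jk: "j \<in> Hom C W Y" "k \<in> Hom C Y W" "k \<cdot> j = Idn C W" "j \<cdot> k = Idn C Y"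
  shows "exact_pair C X W Z (k \<cdot> u) (v \<cdot> j)"
proof -
  note u = exact_pairD(1)[OF ex] and v = exact_pairD(2)[OF ex]
  have j: "is_iso C W Y j" and k: "is_iso C Y W k" unfolding is_iso_def using jk by blast+
  show ?thesis
    unfolding exact_pair_def
  proof (intro conjI allI ballI impI)
    show "k \<cdot> u \<in> Hom C X W" "v \<cdot> j \<in> Hom C W Z" using Cmp_in_Hom u v jk by blast+
    show "(v \<cdot> j) \<cdot> (k \<cdot> u) = 0"
      using Cmp_sandwich[OF u jk(2,1) v] jk(4) Cmp_Idn_left[OF u] exact_pairD(3)[OF ex] by simp
  next
    fix U f assume f: "f \<in> Hom C U W" "(v \<cdot> j) \<cdot> f = 0"
    then obtain g where g: "g \<in> Hom C U X" "j \<cdot> f = u \<cdot> g"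
      using exact_pairD(4)[OF ex Cmp_in_Hom[OF f(1) jk(1)]] Cmp_assoc[OF f(1) jk(1) v] by auto
    have "f = k \<cdot> (j \<cdot> f)"
      using Cmp_assoc[OF f(1) jk(1,2)] jk(3) Cmp_Idn_left[OF f(1)] by simp
    then show "\<exists>g\<in>Hom C U X. f = (k \<cdot> u) \<cdot> g" using g Cmp_assoc[OF g(1) u jk(2)]
      by (intro bexI[of _ g]) simp_all
  next
    fix U f assume f: "f \<in> Hom C W U" "f \<cdot> (k \<cdot> u) = 0"
    then obtain g where g: "g \<in> Hom C Z U" "f \<cdot> k = g \<cdot> v"
      using exact_pairD(5)[OF ex Cmp_in_Hom[OF jk(2) f(1)]] Cmp_assoc[OF u jk(2) f(1)] by auto
    have "f = (f \<cdot> k) \<cdot> j"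
      using Cmp_assoc[OF jk(1,2) f(1)] jk(3) Cmp_Idn_right[OF f(1)] by simp
    then show "\<exists>g\<in>Hom C Z U. f = g \<cdot> (v \<cdot> j)" using g Cmp_assoc[OF jk(1) v g(1)]
      by (intro bexI[of _ g]) simp_all
  qed
qed

lemma exact_pair_uminus_right:
  assumes ex: "exact_pair C X Y Z u v"
  shows "exact_pair C X Y Z u (- v)"
proof -
  note u = exact_pairD(1)[OF ex] and v = exact_pairD(2)[OF ex]
  show ?thesis
    unfolding exact_pair_def
  proof (intro conjI allI ballI impI)
    show "u \<in> Hom C X Y" "- v \<in> Hom C Y Z" using u uminus_in_Hom[OF v] by auto
    show "(- v) \<cdot> u = 0" using Cmp_uminus_left[OF u v] exact_pairD(3)[OF ex] by simp
  next
    fix U f assume f: "f \<in> Hom C U Y" "(- v) \<cdot> f = 0"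
    then show "\<exists>g\<in>Hom C U X. f = u \<cdot> g"
      using exact_pairD(4)[OF ex f(1)] Cmp_uminus_left[OF f(1) v] by simp
  next
    fix U f assume f: "f \<in> Hom C Y U" "f \<cdot> u = 0"
    then obtain g where g: "g \<in> Hom C Z U" "f = g \<cdot> v" using exact_pairD(5)[OF ex] by blast
    then have "f = (- g) \<cdot> (- v)"
      using Cmp_uminus_left[OF uminus_in_Hom[OF v] g(1)] Cmp_uminus_right[OF v g(1)] by simp
    then show "\<exists>g\<in>Hom C Z U. f = g \<cdot> (- v)" using uminus_in_Hom[OF g(1)] by blast
  qed
qed

text \<open>
  For the shift functor this moves an exact pair of the form \<open>Z \<rightarrow> X[1] \<rightarrow> Y[1]\<close> back by one place.
\<close>

lemma exact_pair_reflect: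
  assumes F: "is_functor C F" and ff: "fully_faithful C F" and F0: "\<And>X Y. FMor F X Y 0 = 0"
    and u: "u \<in> Hom C X Y" and v: "v \<in> Hom C Y Z"
    and ex: "exact_pair C (FOb F X) (FOb F Y) (FOb F Z) (FMor F X Y u) (FMor F Y Z v)"
  shows "exact_pair C X Y Z u v"
  unfolding exact_pair_def
proof (intro conjI allI ballI impI)
  show "u \<in> Hom C X Y" "v \<in> Hom C Y Z" by (rule u, rule v)
  show "v \<cdot> u = 0"
    using is_functorD(3)[OF F u v] exact_pairD(3)[OF ex] F0
    by (intro fully_faithfulD(1)[OF ff Cmp_in_Hom[OF u v] zero_in_Hom]) simp
next
  fix U f assume f: "f \<in> Hom C U Y" "v \<cdot> f = 0"
  then have "FMor F Y Z v \<cdot> FMor F U Y f = 0" using is_functorD(3)[OF F f(1) v] F0 by simp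
  then obtain h where h: "h \<in> Hom C (FOb F U) (FOb F X)" "FMor F U Y f = FMor F X Y u \<cdot> h"
    using exact_pairD(4)[OF ex is_functorD(1)[OF F f(1)]] by blast
  then obtain g where g: "g \<in> Hom C U X" "FMor F U X g = h" using fully_faithfulD(2)[OF ff] by blast
  have "f = u \<cdot> g"
    using is_functorD(3)[OF F g(1) u] g(2) h(2)
    by (intro fully_faithfulD(1)[OF ff f(1) Cmp_in_Hom[OF g(1) u]]) simp
  then show "\<exists>g\<in>Hom C U X. f = u \<cdot> g" using g(1) by blast
next
  fix U f assume f: "f \<in> Hom C Y U" "f \<cdot> u = 0"
  then have "FMor F Y U f \<cdot> FMor F X Y u = 0" using is_functorD(3)[OF F u f(1)] F0 by simp
  then obtain h where h: "h \<in> Hom C (FOb F Z) (FOb F U)" "FMor F Y U f = h \<cdot> FMor F Y Z v"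
    using exact_pairD(5)[OF ex is_functorD(1)[OF F f(1)]] by blast
  then obtain g where g: "g \<in> Hom C Z U" "FMor F Z U g = h" using fully_faithfulD(2)[OF ff] by blast
  have "f = g \<cdot> v"
    using is_functorD(3)[OF F v g(1)] g(2) h(2)
    by (intro fully_faithfulD(1)[OF ff f(1) Cmp_in_Hom[OF v g(1)]]) simp
  then show "\<exists>g\<in>Hom C Z U. f = g \<cdot> v" using g(1) by blast
qed

end

context triangulated_category
begin

lemma Shift_functor: "is_functor C (Shift C)"
  using linear_Shift unfolding is_linear_functor_def by blast

lemmas Shift_in_Hom = is_functorD(1)[OF Shift_functor]
  and Shift_Idn = is_functorD(2)[OF Shift_functor]
  and Shift_Cmp = is_functorD(3)[OF Shift_functor]

lemma Shift_add:
  "\<lbrakk>f \<in> Hom C X Y; g \<in> Hom C X Y\<rbrakk> \<Longrightarrow> ShMor C X Y (f + g) = ShMor C X Y f + ShMor C X Y g"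
  using linear_Shift unfolding is_linear_functor_def by blast

lemma Shift_zero: "ShMor C X Y 0 = 0"
  using Shift_add[of 0 X Y 0] by simp

lemma Shift_uminus: "f \<in> Hom C X Y \<Longrightarrow> ShMor C X Y (- f) = - ShMor C X Y f"
  using Shift_add[of f X Y "- f"] uminus_in_Hom[of f X Y] Shift_zero[of X Y]
  by (simp add: minus_unique)

lemma Shift_sum:
  "(\<And>s. s \<in> I \<Longrightarrow> f s \<in> Hom C X Y) \<Longrightarrow> ShMor C X Y (\<Sum>s\<in>I. f s) = (\<Sum>s\<in>I. ShMor C X Y (f s))"
proof (induction I rule: infinite_finite_induct)
  case (insert s I)
  then show ?case using Shift_add[OF _ sum_in_Hom, of "f s" X Y I f] by simp
qed (simp_all add: Shift_zero)

lemma Shift_fully_faithful: "fully_faithful C (Shift C)"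
  by (rule autoequivalence_fully_faithful[OF autoequivalence_Shift])

lemmas Shift_faithful = fully_faithfulD(1)[OF Shift_fully_faithful]
  and Shift_full = fully_faithfulD(2)[OF Shift_fully_faithful]

lemma unshift_exists:
  obtains W j where "is_iso C (ShOb C W) Z j"
  using autoequivalence_essentially_surjective[OF autoequivalence_Shift]
  unfolding essentially_surjective_def by blast

lemma zero_object_Shift: "zero_object C Z \<Longrightarrow> zero_object C (ShOb C Z)"
  using Shift_Idn[of Z] Shift_zero by (simp add: zero_object_iff)

lemma Dist_rotate:
  assumes "Dist C X Y Z u v w"
  shows "Dist C Y Z (ShOb C X) v w (- ShMor C X Y u)"
  using TR2 Dist_in_Hom[OF assms] assms by blast

text \<open>
  The hom functors are cohomological. A morphism that is killed by \<open>v\<close> or by \<open>u\<close> is one component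
  of a partial morphism between the given triangle and a triangle on an identity morphism, and
  completing it yields the factorization. Rotations of \<open>U \<rightarrow> U \<rightarrow> 0\<close> provide the triangles that
  start with \<open>U \<rightarrow> 0\<close> and with \<open>0 \<rightarrow> U\<close>.
\<close>

lemma exact_of_Dist:
  assumes D: "Dist C X Y Z u v w"
  shows "exact_pair C X Y Z u v"
proof -
  have mem: "u \<in> Hom C X Y" "v \<in> Hom C Y Z" "w \<in> Hom C Z (ShOb C X)" using Dist_in_Hom[OF D] by auto
  obtain N where N: "zero_object C N" using zero_object_exists[OF additive] .
  show ?thesis
    unfolding exact_pair_def
  proof (intro conjI allI ballI impI)
    show "u \<in> Hom C X Y" "v \<in> Hom C Y Z" by (rule mem)+
    obtain c where "c \<in> Hom C N Z" "v \<cdot> u = c \<cdot> 0"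
      using TR3[OF TR1_Idn[OF N, of X] D Idn_in_Hom mem(1)] by blast
    then show "v \<cdot> u = 0" using Cmp_zero_right by auto
  next
    fix U f assume f: "f \<in> Hom C U Y" "v \<cdot> f = 0"
    have "Dist C U N (ShOb C U) 0 0 (- ShMor C U U (Idn C U))"
      by (rule Dist_rotate[OF TR1_Idn[OF N]])
    moreover have "v \<cdot> f = 0 \<cdot> 0" using f(2) Cmp_zero_right[OF zero_in_Hom] by simp
    ultimately obtain c where c: "c \<in> Hom C (ShOb C U) (ShOb C X)"
      "(- ShMor C X Y u) \<cdot> c = ShMor C U Y f \<cdot> (- ShMor C U U (Idn C U))"
      using TR3[OF _ Dist_rotate[OF D] f(1) zero_in_Hom] by metis
    obtain g where g: "g \<in> Hom C U X" "ShMor C U X g = c" using Shift_full[OF c(1)] by blast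
    have "- (ShMor C X Y u \<cdot> c) = - ShMor C U Y f"
      using c(2) Cmp_uminus_left[OF c(1) Shift_in_Hom[OF mem(1)]] Shift_Idn
        Cmp_uminus_right[OF Idn_in_Hom Shift_in_Hom[OF f(1)]]
          Cmp_Idn_right[OF Shift_in_Hom[OF f(1)]] by simp
    then have "f = u \<cdot> g"
      using Shift_Cmp[OF g(1) mem(1)] g(2)
      by (intro Shift_faithful[OF f(1) Cmp_in_Hom[OF g(1) mem(1)]]) simp
    then show "\<exists>g\<in>Hom C U X. f = u \<cdot> g" using g(1) by blast
  next
    fix U f assume f: "f \<in> Hom C Y U" "f \<cdot> u = 0"
    have "Dist C U U (ShOb C N) (Idn C U) 0 (- ShMor C N U 0)"
      using TR1_Idn[OF zero_object_Shift[OF N]] Shift_zero by simp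
    then have "Dist C N U U 0 (Idn C U) 0"
      using TR2[OF zero_in_Hom Idn_in_Hom zero_in_Hom] by blast
    moreover have "0 \<cdot> 0 = f \<cdot> u" using f(2) Cmp_zero_right[OF zero_in_Hom] by simp
    ultimately obtain c where "c \<in> Hom C Z U" "Idn C U \<cdot> f = c \<cdot> v"
      using TR3[OF D _ zero_in_Hom f(1)] by metis
    then show "\<exists>g\<in>Hom C Z U. f = g \<cdot> v" using Cmp_Idn_left[OF f(1)] by auto
  qed
qed

lemma unshift_morphism:
  assumes j: "is_iso C (ShOb C W) Z j" and w: "w \<in> Hom C Z (ShOb C X)"
  obtains a where "a \<in> Hom C W X" "ShMor C W X a = w \<cdot> j"
proof -
  have "w \<cdot> j \<in> Hom C (ShOb C W) (ShOb C X)" using j w Cmp_in_Hom unfolding is_iso_def by blast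
  then show thesis using Shift_full that by blast
qed

text \<open>
  Since the shift is only an equivalence, the objects \<open>Z[-1]\<close> and \<open>Y[-1]\<close> to the left of \<open>X\<close> have
  to be chosen, as \<open>W\<close> and \<open>W'\<close>, and exactness on the left is obtained by reflecting exactness on
  the right along the shift.
\<close>

lemma long_exact_sequence:
  assumes f: "f \<in> Hom C X Y"
  obtains W' W Z b a v w j k where
    "is_iso C (ShOb C W') Y k" "is_iso C (ShOb C W) Z j"
    "exact_pair C W' W X b a" "exact_pair C W X Y a f" "exact_pair C X Y Z f v"
    "exact_pair C Y Z (ShOb C X) v w" "exact_pair C Z (ShOb C X) (ShOb C Y) w (- ShMor C X Y f)"
proof -
  obtain Z v w where D: "Dist C X Y Z f v w" using TR1_cone[OF f] by blast
  have w: "w \<in> Hom C Z (ShOb C X)" and v: "v \<in> Hom C Y Z" using Dist_in_Hom[OF D] by auto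
  note 1 = exact_of_Dist[OF D] and 2 = exact_of_Dist[OF Dist_rotate[OF D]]
    and 3 = exact_of_Dist[OF Dist_rotate[OF Dist_rotate[OF D]]]
  obtain W j where j: "is_iso C (ShOb C W) Z j" by (rule unshift_exists)
  obtain a where a: "a \<in> Hom C W X" "ShMor C W X a = w \<cdot> j" by (rule unshift_morphism[OF j w])
  note reflect = exact_pair_reflect[OF Shift_functor Shift_fully_faithful Shift_zero]
  have "exact_pair C W X Y a (- f)"
    using exact_pair_iso_left[OF 3 j] a Shift_uminus[OF f]
      by (intro reflect[OF a(1) uminus_in_Hom[OF f]]) simp
  from exact_pair_uminus_right[OF this] have WXY: "exact_pair C W X Y a f" by simp
  obtain j' where j': "j \<in> Hom C (ShOb C W) Z" "j' \<in> Hom C Z (ShOb C W)"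
    "j' \<cdot> j = Idn C (ShOb C W)" "j \<cdot> j' = Idn C Z"
    using j by (rule is_isoE)
  obtain W' k where k: "is_iso C (ShOb C W') Y k" by (rule unshift_exists)
  obtain b where b: "b \<in> Hom C W' W" "ShMor C W' W b = (j' \<cdot> v) \<cdot> k"
    by (rule unshift_morphism[OF k Cmp_in_Hom[OF v j'(2)]])
  have "exact_pair C W' W X b a"
    using exact_pair_iso_left[OF exact_pair_iso_middle[OF 2 j'] k] a b
      by (intro reflect[OF b(1) a(1)]) simp
  then show thesis using that[OF k j _ WXY 1 2 3] by blast
qed

end

section \<open>Approximations by a cluster tilting object\<close>

context linear_category
begin

lemma retract_of_powerI:
  assumes "\<And>s. s < (n::nat) \<Longrightarrow> i s \<in> Hom C P X" "\<And>s. s < n \<Longrightarrow> p s \<in> Hom C X P"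
    and "(\<Sum>s<n. i s \<cdot> p s) = Idn C X"
  shows "retract_of_power C P X"
  unfolding retract_of_power_def using assms by (intro exI[of _ n] exI[of _ i] exI[of _ p]) simp

lemma retract_of_power_iso:
  assumes X: "retract_of_power C P X" and j: "is_iso C X Y j"
  shows "retract_of_power C P Y"
proof -
  obtain n i p where ip: "\<And>s. s < (n::nat) \<Longrightarrow> i s \<in> Hom C P X" "\<And>s. s < n \<Longrightarrow> p s \<in> Hom C X P"
    "\<And>W f. f \<in> Hom C W X \<Longrightarrow> f = (\<Sum>s<n. i s \<cdot> (p s \<cdot> f))"
    "\<And>Z g. g \<in> Hom C X Z \<Longrightarrow> g = (\<Sum>s<n. (g \<cdot> i s) \<cdot> p s)"
    by (rule retract_expand[OF X]) (rule that)
  obtain k where k: "j \<in> Hom C X Y" "k \<in> Hom C Y X" "j \<cdot> k = Idn C Y" using is_isoE[OF j] by blast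
  have ji: "j \<cdot> i s \<in> Hom C P Y" and pk: "p s \<cdot> k \<in> Hom C Y P" if "s < n" for s
    by (rule Cmp_in_Hom[OF ip(1)[OF that] k(1)], rule Cmp_in_Hom[OF k(2) ip(2)[OF that]])
  have ipk: "i s \<cdot> (p s \<cdot> k) \<in> Hom C Y X" if "s < n" for s
    by (rule Cmp_in_Hom[OF pk[OF that] ip(1)[OF that]])
  have "Idn C Y = j \<cdot> (\<Sum>s<n. i s \<cdot> (p s \<cdot> k))" using k(3) ip(3)[OF k(2)] by simp
  also have "\<dots> = (\<Sum>s<n. j \<cdot> (i s \<cdot> (p s \<cdot> k)))" using ipk by (intro Cmp_sum_right[OF k(1)]) auto
  also have "\<dots> = (\<Sum>s<n. (j \<cdot> i s) \<cdot> (p s \<cdot> k))"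
    by (intro sum.cong refl) (simp add: Cmp_assoc[OF pk ip(1) k(1)])
  finally have "(\<Sum>s<n. (j \<cdot> i s) \<cdot> (p s \<cdot> k)) = Idn C Y" by simp
  then show ?thesis
    by (intro retract_of_powerI[where i = "\<lambda>s. j \<cdot> i s" and p = "\<lambda>s. p s \<cdot> k"]) (use ji pk in
      simp_all)
qed

lemma retract_of_power_iso_base:
  assumes X: "retract_of_power C P X" and j: "is_iso C P P' j"
  shows "retract_of_power C P' X"
proof -
  obtain n i p where ip: "\<And>s. s < (n::nat) \<Longrightarrow> i s \<in> Hom C P X" "\<And>s. s < n \<Longrightarrow> p s \<in> Hom C X P"
    and Id: "(\<Sum>s<n. i s \<cdot> p s) = Idn C X"
    using X unfolding retract_of_power_def by blast
  obtain k where k: "j \<in> Hom C P P'" "k \<in> Hom C P' P" "k \<cdot> j = Idn C P" using is_isoE[OF j] by blast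
  have ik: "i s \<cdot> k \<in> Hom C P' X" and jp: "j \<cdot> p s \<in> Hom C X P'" if "s < n" for s
    by (rule Cmp_in_Hom[OF k(2) ip(1)[OF that]], rule Cmp_in_Hom[OF ip(2)[OF that] k(1)])
  have eq: "(\<Sum>s<n. (i s \<cdot> k) \<cdot> (j \<cdot> p s)) = (\<Sum>s<n. i s \<cdot> p s)"
    by (intro sum.cong refl) (simp add: Cmp_sandwich[OF ip(2) k(1,2) ip(1)] k(3)
      Cmp_Idn_left[OF ip(2)])
  show ?thesis
    by (rule retract_of_powerI[where i = "\<lambda>s. i s \<cdot> k" and p = "\<lambda>s. j \<cdot> p s"]) (use ik jp eq Id in
      simp_all)
qed

lemma retract_of_power_direct_sum:
  assumes D: "direct_sum C (replicate n P) Y i p"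
  shows "retract_of_power C P Y"
  using direct_sumD(1,2,5)[OF D] by (intro retract_of_powerI[of n i P Y p]) simp_all

lemma retract_of_power_add_objects:
  assumes "X \<in> add_objects C P"
  shows "retract_of_power C P X"
proof -
  obtain n Y i p where D: "direct_sum C (replicate n P) Y i p" and "direct_summand C X Y"
    using assms unfolding add_objects_def by auto
  then obtain X' j q where D': "direct_sum C [X, X'] Y j q"
    unfolding direct_summand_def by blast
  have j: "j 0 \<in> Hom C X Y" and q: "q 0 \<in> Hom C Y X" and qj: "q 0 \<cdot> j 0 = Idn C X"
    using direct_sumD(1-3)[OF D', of 0] by auto
  have ip: "i s \<in> Hom C P Y" "p s \<in> Hom C Y P" if "s < n" for s
    using direct_sumD(1,2)[OF D, of s] that by simp_all
  have Id: "(\<Sum>s<n. i s \<cdot> p s) = Idn C Y" using direct_sumD(5)[OF D] by simp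
  have qi: "q 0 \<cdot> i s \<in> Hom C P X" and pj: "p s \<cdot> j 0 \<in> Hom C X P" if "s < n" for s
    by (rule Cmp_in_Hom[OF ip(1)[OF that] q], rule Cmp_in_Hom[OF j ip(2)[OF that]])
  have ipm: "i s \<cdot> p s \<in> Hom C Y Y" if "s < n" for s
    by (rule Cmp_in_Hom[OF ip(2)[OF that] ip(1)[OF that]])
  have "(\<Sum>s<n. (q 0 \<cdot> i s) \<cdot> (p s \<cdot> j 0)) = (\<Sum>s<n. q 0 \<cdot> ((i s \<cdot> p s) \<cdot> j 0))"
    by (intro sum.cong refl) (simp add: Cmp_assoc[OF pj ip(1) q] Cmp_assoc[OF j ip(2,1)])
  also have "\<dots> = q 0 \<cdot> (\<Sum>s<n. (i s \<cdot> p s) \<cdot> j 0)"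
    using Cmp_in_Hom[OF j ipm] by (intro Cmp_sum_right[OF q, symmetric]) auto
  also have "(\<Sum>s<n. (i s \<cdot> p s) \<cdot> j 0) = (\<Sum>s<n. i s \<cdot> p s) \<cdot> j 0"
    using ipm by (intro Cmp_sum_left[OF j, symmetric]) auto
  also have "q 0 \<cdot> \<dots> = Idn C X" using Id Cmp_Idn_left[OF j] qj by simp
  finally have eq: "(\<Sum>s<n. (q 0 \<cdot> i s) \<cdot> (p s \<cdot> j 0)) = Idn C X" .
  show ?thesis
    by (rule retract_of_powerI[where i = "\<lambda>s. q 0 \<cdot> i s" and p = "\<lambda>s. p s \<cdot> j 0"]) (use qi pj eq
      in simp_all)
qed

lemma self_in_add_objects:
  assumes "has_finite_direct_sums C"
  shows "P \<in> add_objects C P"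
proof -
  obtain N where N: "Idn C N = 0" using zero_object_exists[OF assms] zero_object_iff by blast
  let ?i = "\<lambda>s::nat. if s = 0 then Idn C P else 0"
  note Id = Idn_in_Hom[of P]
  note comp = Cmp_Idn_left[OF Id] Cmp_zero_left[OF Id] Cmp_zero_right[OF Id]
    Cmp_zero_right[OF zero_in_Hom]
  have single: "direct_sum C (replicate 1 P) P ?i ?i"
    unfolding direct_sum_def using Id comp by simp
  have less2: "s < length [P, N] \<longleftrightarrow> s = 0 \<or> s = 1" for s by (simp, arith)
  have "direct_sum C [P, N] P ?i ?i"
    unfolding direct_sum_def less2 using Id comp N by (auto simp: lessThan_Suc)
  then have "direct_summand C P P" unfolding direct_summand_def by blast
  with single show ?thesis unfolding add_objects_def by blast
qed

lemma Hom_to_retract_zero: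
  assumes X: "retract_of_power C P X" and zero: "Hom C Y P = {0}" and f: "f \<in> Hom C Y X"
  shows "f = 0"
proof -
  obtain n i p where ip: "\<And>s. s < (n::nat) \<Longrightarrow> i s \<in> Hom C P X" "\<And>s. s < n \<Longrightarrow> p s \<in> Hom C X P"
    "\<And>W f. f \<in> Hom C W X \<Longrightarrow> f = (\<Sum>s<n. i s \<cdot> (p s \<cdot> f))"
    "\<And>Z g. g \<in> Hom C X Z \<Longrightarrow> g = (\<Sum>s<n. (g \<cdot> i s) \<cdot> p s)"
    by (rule retract_expand[OF X]) (rule that)
  have "i s \<cdot> (p s \<cdot> f) = 0" if "s < n" for s
    using Cmp_in_Hom[OF f ip(2)[OF that]] zero Cmp_zero_right[OF ip(1)[OF that]] by simp
  then show ?thesis using ip(3)[OF f] by simp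
qed

lemma Hom_from_retract_zero:
  assumes X: "retract_of_power C P X" and zero: "Hom C P Y = {0}" and f: "f \<in> Hom C X Y"
  shows "f = 0"
proof -
  obtain n i p where ip: "\<And>s. s < (n::nat) \<Longrightarrow> i s \<in> Hom C P X" "\<And>s. s < n \<Longrightarrow> p s \<in> Hom C X P"
    "\<And>W f. f \<in> Hom C W X \<Longrightarrow> f = (\<Sum>s<n. i s \<cdot> (p s \<cdot> f))"
    "\<And>Z g. g \<in> Hom C X Z \<Longrightarrow> g = (\<Sum>s<n. (g \<cdot> i s) \<cdot> p s)"
    by (rule retract_expand[OF X]) (rule that)
  have "(f \<cdot> i s) \<cdot> p s = 0" if "s < n" for s
    using Cmp_in_Hom[OF ip(1)[OF that] f] zero Cmp_zero_left[OF ip(2)[OF that]] by simp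
  then show ?thesis using ip(4)[OF f] by simp
qed

lemma right_approximation:
  assumes "has_finite_direct_sums C" "hom_finite C"
  obtains P0 f where "retract_of_power C P P0" "f \<in> Hom C P0 Y"
    "\<And>g. g \<in> Hom C P Y \<Longrightarrow> \<exists>h\<in>Hom C P P0. g = f \<cdot> h"
proof -
  obtain bs where bs: "distinct bs" "set bs \<subseteq> Hom C P Y" "vs.independent (set bs)"
    "Hom C P Y \<subseteq> vs.span (set bs)"
    by (rule Hom_finite_basis[OF assms(2) subspace_Hom order.refl]) (rule that)
  let ?n = "length bs"
  have bsH: "bs ! s \<in> Hom C P Y" if "s < ?n" for s by (rule subsetD[OF bs(2) nth_mem[OF that]])
  obtain P0 i p where D: "direct_sum C (replicate ?n P) P0 i p"
    using assms(1) unfolding has_finite_direct_sums_def by blast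
  have i: "i s \<in> Hom C P P0" if "s < ?n" for s using direct_sumD(1)[OF D, of s] that by simp
  have "\<exists>f\<in>Hom C P0 Y. \<forall>s<?n. f \<cdot> i s = bs ! s"
  proof (rule direct_sum_cotuple[OF D, of "\<lambda>s. bs ! s" Y])
    show "bs ! s \<in> Hom C (replicate ?n P ! s) Y" if "s < length (replicate ?n P)" for s
      using bsH that by simp
    show ?thesis if "f \<in> Hom C P0 Y" "\<And>s. s < length (replicate ?n P) \<Longrightarrow> f \<cdot> i s = bs ! s" for f
      using that(1) that(2) by (intro bexI[of _ f]) simp_all
  qed
  then obtain f where f: "f \<in> Hom C P0 Y" "\<And>s. s < ?n \<Longrightarrow> f \<cdot> i s = bs ! s" by blast
  show thesis
  proof (rule that[OF retract_of_power_direct_sum[OF D] f(1)])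
    fix g assume "g \<in> Hom C P Y"
    then have "g \<in> vs.span (set bs)" using bs(4) by blast
    then show "\<exists>h\<in>Hom C P P0. g = f \<cdot> h"
    proof (induction rule: vs.span_induct_alt)
      case base
      show ?case using Cmp_zero_right[OF f(1)] by (intro bexI[of _ 0]) simp_all
    next
      case (step c b g)
      then obtain h where h: "h \<in> Hom C P P0" "g = f \<cdot> h" by blast
      obtain s where s: "s < ?n" "b = bs ! s" using step(1) by (metis in_set_conv_nth)
      note ci = Scl_in_Hom[OF i[OF s(1)], of c]
      have "f \<cdot> (Scl C c (i s) + h) = Scl C c b + g"
        using Cmp_add_right[OF ci h(1) f(1)] Cmp_Scl_right[OF i[OF s(1)] f(1)] f(2)[OF s(1)] s(2)
          h(2) by simp
      then show ?case using add_in_Hom[OF ci h(1)] by metis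
    qed
  qed
qed

end

lemma hom_finite_op: "hom_finite (op_cat C) \<longleftrightarrow> hom_finite C"
  unfolding hom_finite_def op_cat_simps by blast

lemma has_finite_direct_sums_op: "has_finite_direct_sums (op_cat C) \<longleftrightarrow> has_finite_direct_sums C"
  unfolding has_finite_direct_sums_def direct_sum_op by blast

context triangulated_category
begin

lemma retract_of_power_Shift_iff:
  "retract_of_power C (ShOb C P) (ShOb C X) \<longleftrightarrow> retract_of_power C P X"
proof
  assume "retract_of_power C P X"
  then obtain n i p where ip: "\<And>s. s < (n::nat) \<Longrightarrow> i s \<in> Hom C P X" "\<And>s. s < n \<Longrightarrow> p s \<in> Hom C X P"
    and Id: "(\<Sum>s<n. i s \<cdot> p s) = Idn C X"
    unfolding retract_of_power_def by blast
  have "(\<Sum>s<n. ShMor C P X (i s) \<cdot> ShMor C X P (p s)) = (\<Sum>s<n. ShMor C X X (i s \<cdot> p s))"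
    by (intro sum.cong refl) (simp add: Shift_Cmp[OF ip(2,1)])
  also have "\<dots> = ShMor C X X (\<Sum>s<n. i s \<cdot> p s)"
    using Cmp_in_Hom[OF ip(2,1)] by (intro Shift_sum[symmetric]) auto
  also have "\<dots> = Idn C (ShOb C X)" using Id Shift_Idn by simp
  finally show "retract_of_power C (ShOb C P) (ShOb C X)"
    by (intro retract_of_powerI[where i = "\<lambda>s. ShMor C P X (i s)" and p = "\<lambda>s. ShMor C X P (p s)"])
      (use Shift_in_Hom[OF ip(1)] Shift_in_Hom[OF ip(2)] in simp_all)
next
  assume "retract_of_power C (ShOb C P) (ShOb C X)"
  then obtain n i p where ip: "\<And>s. s < (n::nat) \<Longrightarrow> i s \<in> Hom C (ShOb C P) (ShOb C X)"
    "\<And>s. s < n \<Longrightarrow> p s \<in> Hom C (ShOb C X) (ShOb C P)"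
    and Id: "(\<Sum>s<n. i s \<cdot> p s) = Idn C (ShOb C X)"
    unfolding retract_of_power_def by blast
  have "\<forall>s. \<exists>f. s < n \<longrightarrow> f \<in> Hom C P X \<and> ShMor C P X f = i s" using Shift_full[OF ip(1)] by blast
  from choice[OF this] have "\<exists>i'. \<forall>s<n. i' s \<in> Hom C P X \<and> ShMor C P X (i' s) = i s" by simp
  then obtain i' where i': "\<And>s. s < n \<Longrightarrow> i' s \<in> Hom C P X" "\<And>s. s < n \<Longrightarrow> ShMor C P X (i' s) = i s"
    by blast
  have "\<forall>s. \<exists>f. s < n \<longrightarrow> f \<in> Hom C X P \<and> ShMor C X P f = p s" using Shift_full[OF ip(2)] by blast
  from choice[OF this] have "\<exists>p'. \<forall>s<n. p' s \<in> Hom C X P \<and> ShMor C X P (p' s) = p s" by simp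
  then obtain p' where p': "\<And>s. s < n \<Longrightarrow> p' s \<in> Hom C X P" "\<And>s. s < n \<Longrightarrow> ShMor C X P (p' s) = p s"
    by blast
  have mem: "i' s \<cdot> p' s \<in> Hom C X X" if "s < n" for s
    by (rule Cmp_in_Hom[OF p'(1)[OF that] i'(1)[OF that]])
  have "(\<Sum>s<n. i' s \<cdot> p' s) = Idn C X"
  proof (rule Shift_faithful[OF _ Idn_in_Hom])
    show "(\<Sum>s<n. i' s \<cdot> p' s) \<in> Hom C X X" using mem by (intro sum_in_Hom) auto
    have "ShMor C X X (\<Sum>s<n. i' s \<cdot> p' s) = (\<Sum>s<n. ShMor C X X (i' s \<cdot> p' s))"
      using mem by (intro Shift_sum) auto
    also have "\<dots> = (\<Sum>s<n. i s \<cdot> p s)"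
      by (intro sum.cong refl) (simp add: Shift_Cmp[OF p'(1) i'(1)] i'(2) p'(2))
    finally show "ShMor C X X (\<Sum>s<n. i' s \<cdot> p' s) = ShMor C X X (Idn C X)" using Id Shift_Idn
      by simp
  qed
  then show "retract_of_power C P X"
    by (intro retract_of_powerI[where i = i' and p = p']) (use i'(1) p'(1) in simp_all)
qed

lemma cluster_tilting_rigid:
  assumes "cluster_tilting C T"
  shows "Hom C T (ShOb C T) = {0}"
  using self_in_add_objects[OF additive, of T] assms unfolding cluster_tilting_def by blast

text \<open>
  Complete a right approximation \<open>f: T0 \<rightarrow> Y\<close> to a triangle \<open>W \<rightarrow> T0 \<rightarrow> Y \<rightarrow> W[1]\<close>. Every morphism \<open>T
  \<rightarrow> W[1]\<close> dies in \<open>T0[1]\<close>, because \<open>Hom(T,T[1]) = 0\<close>, so it comes from \<open>Y\<close>; as \<open>f\<close> is an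
  approximation, it is \<open>0\<close>. Hence \<open>W\<close> lies in \<open>add T\<close>.
\<close>

lemma cluster_tilting_resolution:
  assumes T: "cluster_tilting C T" and fin: "hom_finite C"
  shows "\<exists>T1 T0 Q1 Q0 a b c d.
      retract_of_power C T T1 \<and> retract_of_power C T T0 \<and>
      retract_of_power C (ShOb C T) Q1 \<and> retract_of_power C (ShOb C T) Q0 \<and>
      exact_pair C T1 T0 Y a b \<and> exact_pair C T0 Y Q1 b c \<and> exact_pair C Y Q1 Q0 c d"
proof -
  obtain T0 f where T0: "retract_of_power C T T0" and f: "f \<in> Hom C T0 Y"
    and approx: "\<And>g. g \<in> Hom C T Y \<Longrightarrow> \<exists>h\<in>Hom C T T0. g = f \<cdot> h"
    by (rule right_approximation[OF additive fin]) (rule that)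
  obtain W' W Z b a v w j k where
    les: "is_iso C (ShOb C W') Y k" "is_iso C (ShOb C W) Z j"
    "exact_pair C W' W T0 b a" "exact_pair C W T0 Y a f" "exact_pair C T0 Y Z f v"
    "exact_pair C Y Z (ShOb C T0) v w" "exact_pair C Z (ShOb C T0) (ShOb C Y) w (- ShMor C T0 Y f)"
    by (rule long_exact_sequence[OF f]) (rule that)
  have ST0: "retract_of_power C (ShOb C T) (ShOb C T0)" using T0 retract_of_power_Shift_iff by blast
  have v: "v \<in> Hom C Y Z" and w: "w \<in> Hom C Z (ShOb C T0)"
    using exact_pairD(1,2)[OF les(6)] by auto
  have jH: "j \<in> Hom C (ShOb C W) Z" using les(2) unfolding is_iso_def by blast
  have "g = 0" if g: "g \<in> Hom C T (ShOb C W)" for g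
  proof -
    have jg: "j \<cdot> g \<in> Hom C T Z" using Cmp_in_Hom[OF g jH] .
    have "w \<cdot> (j \<cdot> g) = 0"
      by (rule Hom_to_retract_zero[OF ST0 cluster_tilting_rigid[OF T] Cmp_in_Hom[OF jg w]])
    then obtain h where h: "h \<in> Hom C T Y" "j \<cdot> g = v \<cdot> h"
      using exact_pairD(4)[OF les(6) jg] by blast
    obtain h' where h': "h' \<in> Hom C T T0" "h = f \<cdot> h'" using approx[OF h(1)] by blast
    have "j \<cdot> g = 0"
      using h(2) h'(2) Cmp_assoc[OF h'(1) f v] exact_pairD(3)[OF les(5)] Cmp_zero_left[OF h'(1)]
        by simp
    then show "g = 0"
      using Cmp_zero_right[OF jH] by (intro iso_cancel_left[OF les(2) g zero_in_Hom]) simp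
  qed
  then have "Hom C T (ShOb C W) = {0}" using zero_in_Hom[of T "ShOb C W"] by blast
  then have "W \<in> add_objects C T" using T unfolding cluster_tilting_def by blast
  then have W: "retract_of_power C T W" by (rule retract_of_power_add_objects)
  then have "retract_of_power C (ShOb C T) Z"
    using retract_of_power_iso[OF _ les(2)] retract_of_power_Shift_iff by blast
  then show ?thesis using W T0 ST0 les(4-6) by blast
qed

text \<open>
  The dual argument: complete a left approximation \<open>f: Y \<rightarrow> T0\<close> to a triangle \<open>Y \<rightarrow> T0 \<rightarrow> Z \<rightarrow> Y[1]\<close>;
  then \<open>Hom(Z,T[1]) = 0\<close>. Here \<open>Q1\<close> is \<open>Z[-1]\<close> and \<open>Q0\<close> is \<open>T0[-1]\<close>.
\<close>

lemma cluster_tilting_coresolution: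
  assumes T: "cluster_tilting C T" and fin: "hom_finite C" and l: "is_iso C (ShOb C T') T l"
  shows "\<exists>T1 T0 Q1 Q0 a b c d.
      retract_of_power C T T1 \<and> retract_of_power C T T0 \<and>
      retract_of_power C T' Q1 \<and> retract_of_power C T' Q0 \<and>
      exact_pair C Y T0 T1 b a \<and> exact_pair C Q1 Y T0 c b \<and> exact_pair C Q0 Q1 Y d c"
proof -
  interpret op: linear_category "op_cat C" by (rule linear_category_op)
  have "\<exists>T0 f. retract_of_power C T T0 \<and> f \<in> Hom C Y T0 \<and>
      (\<forall>g\<in>Hom C Y T. \<exists>h\<in>Hom C T0 T. g = h \<cdot> f)"
  proof (rule op.right_approximation[of T Y])
    show "has_finite_direct_sums (op_cat C)" "hom_finite (op_cat C)"
      using additive fin by (simp_all add: has_finite_direct_sums_op hom_finite_op)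
    fix T0 f
    assume "retract_of_power (op_cat C) T T0" "f \<in> Hom (op_cat C) T0 Y"
      "\<And>g. g \<in> Hom (op_cat C) T Y \<Longrightarrow> \<exists>h\<in>Hom (op_cat C) T T0. g = Cmp (op_cat C) f h"
    then show ?thesis
      unfolding retract_of_power_op op_cat_simps by (intro exI[of _ T0] exI[of _ f] conjI ballI)
  qed
  then obtain T0 f where T0: "retract_of_power C T T0" and f: "f \<in> Hom C Y T0"
    and approx: "\<And>g. g \<in> Hom C Y T \<Longrightarrow> \<exists>h\<in>Hom C T0 T. g = h \<cdot> f" by blast
  obtain W' W Z b a v w j k where
    les: "is_iso C (ShOb C W') T0 k" "is_iso C (ShOb C W) Z j"
    "exact_pair C W' W Y b a" "exact_pair C W Y T0 a f" "exact_pair C Y T0 Z f v"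
    "exact_pair C T0 Z (ShOb C Y) v w" "exact_pair C Z (ShOb C Y) (ShOb C T0) w (- ShMor C Y T0 f)"
    by (rule long_exact_sequence[OF f]) (rule that)
  have v: "v \<in> Hom C T0 Z" and w: "w \<in> Hom C Z (ShOb C Y)"
    using exact_pairD(1,2)[OF les(6)] by auto
  have "g = 0" if g: "g \<in> Hom C Z (ShOb C T)" for g
  proof -
    have "g \<cdot> v = 0"
      by (rule Hom_from_retract_zero[OF T0 cluster_tilting_rigid[OF T] Cmp_in_Hom[OF v g]])
    then obtain h where h: "h \<in> Hom C (ShOb C Y) (ShOb C T)" "g = h \<cdot> w"
      using exact_pairD(5)[OF les(6) g] by blast
    obtain h0 where h0: "h0 \<in> Hom C Y T" "ShMor C Y T h0 = h" using Shift_full[OF h(1)] by blast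
    obtain h1 where h1: "h1 \<in> Hom C T0 T" "h0 = h1 \<cdot> f" using approx[OF h0(1)] by blast
    have Sf: "ShMor C Y T0 f \<in> Hom C (ShOb C Y) (ShOb C T0)" using Shift_in_Hom[OF f] .
    have "ShMor C Y T0 f \<cdot> w = 0"
      using exact_pairD(3)[OF les(7)] Cmp_uminus_left[OF w Sf] by simp
    then show "g = 0"
      using h(2) h0(2) h1(2) Shift_Cmp[OF f h1(1)] Cmp_assoc[OF w Sf Shift_in_Hom[OF h1(1)]]
        Cmp_zero_right[OF Shift_in_Hom[OF h1(1)]] by simp
  qed
  then have "Hom C Z (ShOb C T) = {0}" using zero_in_Hom[of Z "ShOb C T"] by blast
  then have "Z \<in> add_objects C T" using T unfolding cluster_tilting_def by blast
  then have Z: "retract_of_power C T Z" by (rule retract_of_power_add_objects)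
  have unshift: "retract_of_power C T' V" if V: "retract_of_power C T U" and i:
    "is_iso C (ShOb C V) U i" for V U i
  proof -
    obtain i' where i': "is_iso C U (ShOb C V) i'" using i unfolding is_iso_def by blast
    obtain l' where l': "is_iso C T (ShOb C T') l'" using l unfolding is_iso_def by blast
    show ?thesis
      using retract_of_power_iso_base[OF retract_of_power_iso[OF V i'] l']
        retract_of_power_Shift_iff by blast
  qed
  show ?thesis
    using Z T0 unshift[OF Z les(2)] unshift[OF T0 les(1)] les(3-5) by blast
qed

lemma cluster_tilting_resolved:
  assumes "cluster_tilting C T" "hom_finite C" "idempotent_complete C"
  shows "resolved_category C T (ShOb C T)"
proof unfold_locales
  show "\<exists>Z v. exact_pair C X Y Z u v" if "u \<in> Hom C X Y" for u X Y
    using TR1_cone[OF that] exact_of_Dist by blast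
qed (rule additive assms(2,3) cluster_tilting_resolution[OF assms(1,2)])+

lemma cluster_tilting_resolved_op:
  assumes "cluster_tilting C T" "hom_finite C" "idempotent_complete C" and l:
    "is_iso C (ShOb C T') T l"
  shows "resolved_category (op_cat C) T T'"
proof -
  interpret op: linear_category "op_cat C" by (rule linear_category_op)
  show ?thesis
  proof unfold_locales
    show "has_finite_direct_sums (op_cat C)" "hom_finite (op_cat C)"
      "idempotent_complete (op_cat C)"
      using assms additive
        by (simp_all add: has_finite_direct_sums_op hom_finite_op idempotent_complete_op)
    show "\<exists>Z v. exact_pair (op_cat C) X Y Z u v" if "u \<in> Hom (op_cat C) X Y" for u X Y
    proof -
      have "u \<in> Hom C Y X" using that by simp
      then show ?thesis unfolding exact_pair_op by (rule long_exact_sequence) blast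
    qed
    show "\<exists>T1 T0 Q1 Q0 a b c d.
      retract_of_power (op_cat C) T T1 \<and> retract_of_power (op_cat C) T T0 \<and>
      retract_of_power (op_cat C) T' Q1 \<and> retract_of_power (op_cat C) T' Q0 \<and>
      exact_pair (op_cat C) T1 T0 Y a b \<and> exact_pair (op_cat C) T0 Y Q1 b c \<and> exact_pair (op_cat
        C) Y Q1 Q0 c d" for Y
      unfolding exact_pair_op retract_of_power_op
      using cluster_tilting_coresolution[OF assms(1,2) l, of Y] by blast
  qed
qed

end

section \<open>The Serre functor\<close>

context linear_category
begin

lemma representsD:
  assumes "represents X A \<xi>"
  shows "form X A \<xi>"
    and "form X Y \<phi> \<Longrightarrow> \<exists>g\<in>Hom C Y A. \<forall>f\<in>Hom C X Y. \<phi> f = \<xi> (g \<cdot> f)"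
    and "\<lbrakk>g \<in> Hom C Y A; \<And>f. f \<in> Hom C X Y \<Longrightarrow> \<xi> (g \<cdot> f) = 0\<rbrakk> \<Longrightarrow> g = 0"
proof -
  show "form X A \<xi>" using assms unfolding represents_def by (rule conjunct1)
  have "onto_at X A \<xi> Y" and ker: "kernel_at X A \<xi> Y \<subseteq> {0}"
    using assms unfolding represents_def by simp_all
  then show "\<exists>g\<in>Hom C Y A. \<forall>f\<in>Hom C X Y. \<phi> f = \<xi> (g \<cdot> f)" if "form X Y \<phi>"
    using that unfolding onto_at_def by simp
  show "g = 0" if "g \<in> Hom C Y A" "\<And>f. f \<in> Hom C X Y \<Longrightarrow> \<xi> (g \<cdot> f) = 0"
  proof -
    have "g \<in> kernel_at X A \<xi> Y" unfolding kernel_at_def using that by simp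
    then show ?thesis using ker by blast
  qed
qed

lemma represents_unique:
  assumes rep: "represents X A \<xi>" and g: "g \<in> Hom C Y A" and g': "g' \<in> Hom C Y A"
    and eq: "\<And>f. f \<in> Hom C X Y \<Longrightarrow> \<xi> (g \<cdot> f) = \<xi> (g' \<cdot> f)"
  shows "g = g'"
proof -
  note \<xi> = representsD(1)[OF rep]
  have "\<xi> ((g - g') \<cdot> f) = 0" if f: "f \<in> Hom C X Y" for f
    using Cmp_diff_left[OF f g g'] eq[OF f]
      vs.linear_form_diff[OF subspace_Hom \<xi> Cmp_in_Hom[OF f g] Cmp_in_Hom[OF f g']] by simp
  then have "g - g' = 0" by (rule representsD(3)[OF rep diff_in_Hom[OF g g']])
  then show ?thesis by simp
qed

lemma represents_transpose:
  assumes fin: "hom_finite C" and rep: "represents X A \<xi>"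
  shows "form Y A \<psi> \<Longrightarrow> \<exists>f\<in>Hom C X Y. \<forall>g\<in>Hom C Y A. \<psi> g = \<xi> (g \<cdot> f)"
    and "\<lbrakk>f \<in> Hom C X Y; \<forall>g\<in>Hom C Y A. \<xi> (g \<cdot> f) = 0\<rbrakk> \<Longrightarrow> f = 0"
proof -
  note \<xi> = representsD(1)[OF rep]
  obtain B where "finite B" "vs.span B = Hom C X Y"
    using fin unfolding hom_finite_def by blast
  then have B: "finite B" "Hom C X Y \<subseteq> vs.span B" by simp_all
  have left: "form X Y (\<lambda>f. \<xi> (g \<cdot> f))" if "g \<in> Hom C Y A" for g by (rule form_pullback[OF \<xi> that])
  have right: "form Y A (\<lambda>g. \<xi> (g \<cdot> f))" if "f \<in> Hom C X Y" for f
    by (rule form_pullback_arg[OF \<xi> that])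
  have onto: "\<exists>g\<in>Hom C Y A. \<forall>f\<in>Hom C X Y. \<phi> f = \<xi> (g \<cdot> f)" if "form X Y \<phi>" for \<phi>
    by (rule representsD(2)[OF rep that])
  have inj: "g = 0" if "g \<in> Hom C Y A" "\<forall>f\<in>Hom C X Y. \<xi> (g \<cdot> f) = 0" for g
    using that(2) by (intro representsD(3)[OF rep that(1)]) simp
  note transpose = vs.perfect_pairing_transpose[where \<beta> = "\<lambda>f g. \<xi> (g \<cdot> f)",
    OF subspace_Hom[of X Y] B subspace_Hom[of Y A]]
  show "\<exists>f\<in>Hom C X Y. \<forall>g\<in>Hom C Y A. \<psi> g = \<xi> (g \<cdot> f)" if \<psi>: "form Y A \<psi>"
  proof (rule transpose(1))
  qed (rule left right onto inj \<psi>, assumption+ | rule \<psi>)+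
  show "f = 0" if f: "f \<in> Hom C X Y" "\<forall>g\<in>Hom C Y A. \<xi> (g \<cdot> f) = 0"
  proof (rule transpose(2))
  qed (rule left right onto inj, assumption+ | rule f)+
qed

text \<open>
  Representing the dual of \<open>Hom(-,Z)\<close> by \<open>W\<close> in the opposite category is, by transposing the
  perfect pairing, the same as representing the dual of \<open>Hom(W,-)\<close> by \<open>Z\<close>. So \<open>Z\<close> lies in the
  essential image of the Serre functor.
\<close>

lemma represents_op:
  assumes fin: "hom_finite C" and rep: "linear_category.represents (op_cat C) Z W \<xi>"
  shows "represents W Z \<xi>"
proof -
  interpret op: linear_category "op_cat C" by (rule linear_category_op)
  have "hom_finite (op_cat C)" using fin by (simp add: hom_finite_op)
  note transpose = op.represents_transpose[OF this rep, unfolded op_cat_simps]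
  have "form W Z \<xi>" using op.representsD(1)[OF rep] by simp
  moreover have "onto_at W Z \<xi> Y" for Y
    unfolding onto_at_def using transpose(1) by blast
  moreover have "kernel_at W Z \<xi> Y \<subseteq> {0}" for Y
    unfolding kernel_at_def using transpose(2) by blast
  ultimately show ?thesis unfolding represents_def by blast
qed

lemma represents_iso:
  assumes A: "represents X A \<xi>" and B: "represents X B \<zeta>"
  shows "\<exists>j. is_iso C A B j"
proof -
  obtain j where j: "j \<in> Hom C A B" "\<forall>f\<in>Hom C X A. \<xi> f = \<zeta> (j \<cdot> f)"
    using representsD(2)[OF B representsD(1)[OF A]] by blast
  obtain k where k: "k \<in> Hom C B A" "\<forall>f\<in>Hom C X B. \<zeta> f = \<xi> (k \<cdot> f)"
    using representsD(2)[OF A representsD(1)[OF B]] by blast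
  have "k \<cdot> j = Idn C A"
    using j k Cmp_assoc[OF _ j(1) k(1)] Cmp_in_Hom[OF _ j(1)] Cmp_Idn_left
    by (intro represents_unique[OF A Cmp_in_Hom[OF j(1) k(1)] Idn_in_Hom]) simp
  moreover have "j \<cdot> k = Idn C B"
    using j k Cmp_assoc[OF _ k(1) j(1)] Cmp_in_Hom[OF _ k(1)] Cmp_Idn_left
    by (intro represents_unique[OF B Cmp_in_Hom[OF k(1) j(1)] Idn_in_Hom]) simp
  ultimately show ?thesis unfolding is_iso_def using j(1) k(1) by blast
qed

end

text \<open>
  The form \<open>\<tau> X\<close> on \<open>Hom(X, S X)\<close> is the trace form of Serre duality: the pairing of \<open>Hom(X,Y)\<close>
  with \<open>Hom(Y, S X)\<close> is \<open>\<tau> X (h \<cdot> f)\<close>. By the last assumption each object \<open>Z\<close> represents a functor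
  that \<open>S W\<close> represents too, so it is isomorphic to \<open>S W\<close>.
\<close>

locale represented_duals = linear_category C
  for C :: "('k::field, 'o, 'm::ab_group_add, 'z) lin_cat_scheme" (structure) +
  fixes S :: "'o \<Rightarrow> 'o" and \<tau> :: "'o \<Rightarrow> 'm \<Rightarrow> 'k"
  assumes finite: "hom_finite C" and rep: "represents X (S X) (\<tau> X)"
    and corep: "\<exists>W \<xi>. represents W Z \<xi>"
begin

lemmas \<tau>_form = representsD(1)[OF rep]
  and \<tau>_unique = represents_unique[OF rep]
  and \<tau>_transpose = represents_transpose[OF finite rep]

text \<open>
  The action on morphisms is forced by naturality of the duality in its first argument.
\<close>

definition Smor :: "'o \<Rightarrow> 'o \<Rightarrow> 'm \<Rightarrow> 'm" where
  "Smor X Y a = (SOME g. g \<in> Hom C (S X) (S Y) \<and> (\<forall>f\<in>Hom C Y (S X). \<tau> Y (g \<cdot> f) = \<tau> X (f \<cdot> a)))"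

definition SF :: "('o, 'm) endofunctor" where
  "SF = \<lparr>FOb = S, FMor = Smor\<rparr>"

lemma SF_simps [simp]: "FOb SF = S" "FMor SF = Smor"
  by (simp_all add: SF_def)

lemma Smor:
  assumes a: "a \<in> Hom C X Y"
  shows "Smor X Y a \<in> Hom C (S X) (S Y)"
    and "f \<in> Hom C Y (S X) \<Longrightarrow> \<tau> Y (Smor X Y a \<cdot> f) = \<tau> X (f \<cdot> a)"
proof -
  have "\<exists>g. g \<in> Hom C (S X) (S Y) \<and> (\<forall>f\<in>Hom C Y (S X). \<tau> Y (g \<cdot> f) = \<tau> X (f \<cdot> a))"
  proof -
    obtain g where "g \<in> Hom C (S X) (S Y)" "\<forall>f\<in>Hom C Y (S X). \<tau> X (f \<cdot> a) = \<tau> Y (g \<cdot> f)"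
      using representsD(2)[OF rep form_pullback_arg[OF \<tau>_form a]] by blast
    then show ?thesis by (intro exI[of _ g]) simp
  qed
  from someI_ex[OF this, folded Smor_def]
  show "Smor X Y a \<in> Hom C (S X) (S Y)"
    and "f \<in> Hom C Y (S X) \<Longrightarrow> \<tau> Y (Smor X Y a \<cdot> f) = \<tau> X (f \<cdot> a)" by auto
qed

lemma Smor_eqI:
  assumes a: "a \<in> Hom C X Y" and g: "g \<in> Hom C (S X) (S Y)"
    and "\<And>f. f \<in> Hom C Y (S X) \<Longrightarrow> \<tau> Y (g \<cdot> f) = \<tau> X (f \<cdot> a)"
  shows "Smor X Y a = g"
  using assms(3) Smor(2)[OF a] by (intro \<tau>_unique[OF Smor(1)[OF a] g]) simp

lemma SF_linear: "is_linear_functor C SF"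
  unfolding is_linear_functor_def is_functor_def SF_simps
proof (intro conjI allI ballI)
  show "Smor X Y f \<in> Hom C (S X) (S Y)" if "f \<in> Hom C X Y" for X Y f by (rule Smor(1)[OF that])
  show "Smor X X (Idn C X) = Idn C (S X)" for X
    by (rule Smor_eqI[OF Idn_in_Hom Idn_in_Hom]) (simp add: Cmp_Idn_left Cmp_Idn_right)
next
  fix X Y Z a b assume a: "a \<in> Hom C X Y" and b: "b \<in> Hom C Y Z"
  note Sa = Smor(1)[OF a] and Sb = Smor(1)[OF b]
  show "Smor X Z (b \<cdot> a) = Smor Y Z b \<cdot> Smor X Y a"
  proof (rule Smor_eqI[OF Cmp_in_Hom[OF a b] Cmp_in_Hom[OF Sa Sb]])
    fix f assume f: "f \<in> Hom C Z (S X)"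
    show "\<tau> Z ((Smor Y Z b \<cdot> Smor X Y a) \<cdot> f) = \<tau> X (f \<cdot> (b \<cdot> a))"
      using Cmp_assoc[OF f Sa Sb] Smor(2)[OF b Cmp_in_Hom[OF f Sa]] Cmp_assoc[OF b f Sa]
        Smor(2)[OF a Cmp_in_Hom[OF b f]] Cmp_assoc[OF a b f] by simp
  qed
next
  fix X Y a b assume a: "a \<in> Hom C X Y" and b: "b \<in> Hom C X Y"
  note Sa = Smor(1)[OF a] and Sb = Smor(1)[OF b]
  show "Smor X Y (a + b) = Smor X Y a + Smor X Y b"
  proof (rule Smor_eqI[OF add_in_Hom[OF a b] add_in_Hom[OF Sa Sb]])
    fix f assume f: "f \<in> Hom C Y (S X)"
    show "\<tau> Y ((Smor X Y a + Smor X Y b) \<cdot> f) = \<tau> X (f \<cdot> (a + b))"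
      using Cmp_add_left[OF f Sa Sb] Cmp_add_right[OF a b f] Smor(2)[OF a f] Smor(2)[OF b f]
        linear_form_add[OF \<tau>_form Cmp_in_Hom[OF f Sa] Cmp_in_Hom[OF f Sb]]
        linear_form_add[OF \<tau>_form Cmp_in_Hom[OF a f] Cmp_in_Hom[OF b f]] by simp
  qed
next
  fix X Y c a assume a: "a \<in> Hom C X Y"
  note Sa = Smor(1)[OF a]
  show "Smor X Y (Scl C c a) = Scl C c (Smor X Y a)"
  proof (rule Smor_eqI[OF Scl_in_Hom[OF a] Scl_in_Hom[OF Sa]])
    fix f assume f: "f \<in> Hom C Y (S X)"
    show "\<tau> Y (Scl C c (Smor X Y a) \<cdot> f) = \<tau> X (f \<cdot> Scl C c a)"
      using Cmp_Scl_left[OF f Sa] Cmp_Scl_right[OF a f] Smor(2)[OF a f]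
        linear_form_scale[OF \<tau>_form Cmp_in_Hom[OF f Sa]]
        linear_form_scale[OF \<tau>_form Cmp_in_Hom[OF a f]] by simp
  qed
qed

lemma \<tau>_separates:
  assumes f: "f \<in> Hom C X Y" and g: "g \<in> Hom C X Y"
    and eq: "\<And>h. h \<in> Hom C Y (S X) \<Longrightarrow> \<tau> X (h \<cdot> f) = \<tau> X (h \<cdot> g)"
  shows "f = g"
proof -
  have "\<tau> X (h \<cdot> (f - g)) = 0" if h: "h \<in> Hom C Y (S X)" for h
    using Cmp_diff_right[OF f g h] eq[OF h]
      vs.linear_form_diff[OF subspace_Hom \<tau>_form Cmp_in_Hom[OF f h] Cmp_in_Hom[OF g h]] by simp
  then have "f - g = 0" using \<tau>_transpose(2)[OF diff_in_Hom[OF f g]] by blast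
  then show ?thesis by simp
qed

lemma SF_fully_faithful: "fully_faithful C SF"
  unfolding fully_faithful_def SF_simps
proof (intro allI bij_betwI')
  fix X Y
  show "(Smor X Y a = Smor X Y b) = (a = b)" if a: "a \<in> Hom C X Y" and b: "b \<in> Hom C X Y" for a b
  proof
    assume eq: "Smor X Y a = Smor X Y b"
    show "a = b"
      using Smor(2)[OF a] Smor(2)[OF b] eq by (intro \<tau>_separates[OF a b]) simp
  qed simp
  show "Smor X Y a \<in> Hom C (S X) (S Y)" if "a \<in> Hom C X Y" for a by (rule Smor(1)[OF that])
  fix g assume g: "g \<in> Hom C (S X) (S Y)"
  obtain a where a: "a \<in> Hom C X Y" "\<forall>f\<in>Hom C Y (S X). \<tau> Y (g \<cdot> f) = \<tau> X (f \<cdot> a)"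
    using \<tau>_transpose(1)[OF form_pullback[OF \<tau>_form g]] by blast
  have "g = Smor X Y a" using Smor_eqI[OF a(1) g] a(2) by simp
  then show "\<exists>a\<in>Hom C X Y. g = Smor X Y a" using a(1) by blast
qed

lemma SF_autoequivalence: "is_autoequivalence C SF"
proof (rule autoequivalenceI[OF _ SF_fully_faithful])
  show "is_functor C SF" using SF_linear unfolding is_linear_functor_def by blast
  show "essentially_surjective C SF"
    unfolding essentially_surjective_def SF_simps using corep represents_iso[OF rep] by metis
qed

lemma SF_duality: "serre_duality C SF (\<lambda>X Y f. restrict (\<lambda>h. \<tau> X (h \<cdot> f)) (Hom C Y (S X)))"
  unfolding serre_duality_def SF_simps
proof (intro conjI allI ballI)
  fix X Y
  let ?\<eta> = "\<lambda>f. restrict (\<lambda>h. \<tau> X (h \<cdot> f)) (Hom C Y (S X))"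
  show "bij_betw ?\<eta> (Hom C X Y) (dual_space (Scl C) (Hom C Y (S X)))"
  proof (rule bij_betwI')
    show "(?\<eta> f = ?\<eta> g) = (f = g)" if fg: "f \<in> Hom C X Y" "g \<in> Hom C X Y" for f g
    proof
      assume eq: "?\<eta> f = ?\<eta> g"
      show "f = g"
      proof (rule \<tau>_separates[OF fg])
        fix h assume "h \<in> Hom C Y (S X)"
        then show "\<tau> X (h \<cdot> f) = \<tau> X (h \<cdot> g)" using fun_cong[OF eq, of h] by simp
      qed
    qed simp
    show "?\<eta> f \<in> dual_space (Scl C) (Hom C Y (S X))" if f: "f \<in> Hom C X Y" for f
      using form_pullback_arg[OF \<tau>_form f]
      by (simp add: dual_space_def linear_form_def add_in_Hom Scl_in_Hom)
    fix \<psi> assume \<psi>: "\<psi> \<in> dual_space (Scl C) (Hom C Y (S X))"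
    then have "form Y (S X) \<psi>" by (simp add: dual_space_def linear_form_def)
    then obtain f where f: "f \<in> Hom C X Y" "\<forall>h\<in>Hom C Y (S X). \<psi> h = \<tau> X (h \<cdot> f)"
      using \<tau>_transpose(1) by blast
    have "\<psi> = ?\<eta> f"
      using \<psi> f(2) by (intro extensionalityI[of _ "Hom C Y (S X)"]) (simp_all add: dual_space_def)
    then show "\<exists>f\<in>Hom C X Y. \<psi> = ?\<eta> f" using f(1) by blast
  qed
next
  fix X Y f g h assume "f \<in> Hom C X Y" "g \<in> Hom C X Y" and h: "h \<in> Hom C Y (S X)"
  then show "restrict (\<lambda>h. \<tau> X (h \<cdot> (f + g))) (Hom C Y (S X)) h
    = restrict (\<lambda>h. \<tau> X (h \<cdot> f)) (Hom C Y (S X)) h + restrict (\<lambda>h. \<tau> X (h \<cdot> g)) (Hom C Y (S X)) h"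
    using linear_form_add[OF form_pullback[OF \<tau>_form h]] by simp
next
  fix X Y a f h assume "f \<in> Hom C X Y" and h: "h \<in> Hom C Y (S X)"
  then show "restrict (\<lambda>h. \<tau> X (h \<cdot> Scl C a f)) (Hom C Y (S X)) h
    = a * restrict (\<lambda>h. \<tau> X (h \<cdot> f)) (Hom C Y (S X)) h"
    using linear_form_scale[OF form_pullback[OF \<tau>_form h]] by simp
next
  fix X Y Y' f b h assume f: "f \<in> Hom C X Y" and b: "b \<in> Hom C Y Y'" and h: "h \<in> Hom C Y' (S X)"
  show "restrict (\<lambda>h. \<tau> X (h \<cdot> (b \<cdot> f))) (Hom C Y' (S X)) h
    = restrict (\<lambda>h. \<tau> X (h \<cdot> f)) (Hom C Y (S X)) (h \<cdot> b)"
    using Cmp_assoc[OF f b h] Cmp_in_Hom[OF b h] h by simp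
next
  fix X X' Y f a h assume f: "f \<in> Hom C X Y" and a: "a \<in> Hom C X' X" and h: "h \<in> Hom C Y (S X')"
  note Sa = Smor(1)[OF a]
  show "restrict (\<lambda>h. \<tau> X' (h \<cdot> (f \<cdot> a))) (Hom C Y (S X')) h
    = restrict (\<lambda>h. \<tau> X (h \<cdot> f)) (Hom C Y (S X)) (Smor X' X a \<cdot> h)"
    using Smor(2)[OF a Cmp_in_Hom[OF f h]] Cmp_assoc[OF a f h] Cmp_assoc[OF f h Sa]
      Cmp_in_Hom[OF h Sa] h by simp
qed

theorem serre_functor_exists: "\<exists>S. serre_functor C S"
  unfolding serre_functor_def using SF_linear SF_autoequivalence SF_duality by blast

end

theorem theorem1p5:
  fixes C :: "('k::field, 'o, 'm::ab_group_add) tri_cat"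
  assumes "triangulated_category C"
    and "krull_schmidt C"
    and "hom_finite C"
    and "\<exists>T. cluster_tilting C T"
  shows "\<exists>S. serre_functor C S"
proof -
  interpret triangulated_category C by (rule assms(1))
  obtain T where T: "cluster_tilting C T" using assms(4) by blast
  note complete = krull_schmidt_idempotent_complete[OF assms(2)]
  obtain T' l where l: "is_iso C (ShOb C T') T l" by (rule unshift_exists)
  interpret right: resolved_category C T "ShOb C T"
    by (rule cluster_tilting_resolved[OF T assms(3) complete])
  interpret left: resolved_category "op_cat C" T T'
    by (rule cluster_tilting_resolved_op[OF T assms(3) complete l])
  obtain S \<tau> where rep: "\<And>X. represents X (S X) (\<tau> X)" using right.dual_representable by metis
  have "\<exists>W \<xi>. represents W Z \<xi>" for Z
    using left.dual_representable[of Z] represents_op[OF assms(3)] by blast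
  then interpret represented_duals C S \<tau>
    using assms(3) rep by unfold_locales auto
  show ?thesis by (rule serre_functor_exists)
qed

end
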